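(* Let $T_1$ and $T_2$ be semi-model theories and let $f:T_1\to T_2$ be a morphism of theories (under $\mathrm{Id}_0$). Then the induced adjunction $f_!\dashv f^*$ between $T_1\text{-}\mathbf{Mod}$ and $T_2\text{-}\mathbf{Mod}$ is a Quillen adjunction. It is a Quillen equivalence if and only if $f$ is a Morita equivalence.
   Context: **Partial Horn theories.** A many-sorted signature has sorts, function symbols $\sigma:s_1\times\dots\times s_k\to s$ and predicate symbols $R:s_1\times\dots\times s_k$. Atomic formulas are $t_1=t_2$ and $R(t_1,\dots,t_n)$; $t\downarrow$ abbreviates $t=t$; a Horn formula is a finite conjunction of atomic formulas ($\top$ if empty). A sequent is $\varphi\vdash^{V}\psi$ with $\varphi,\psi$ Horn formulas with free variables in $V$. A partial Horn theory is a signature with a set of sequents (axioms); $\varphi\vdash^V_T\psi$ means derivability in partial Horn logic (Palmgren–Vickers; function symbols are interpreted as partial functions). $T\text{-}\mathbf{Mod}$ is the category of models. A morphism $f:T\to T'$ of theories with the same sorts sends each function symbol $\sigma$ to a restricted term $t|_\chi$ (a term $t$ with a Horn formula $\chi$, regarded as defined iff $\chi$ holds and $t$ is defined, and then equal to $t$) and each predicate symbol to a Horn formula, in the appropriate variables, so that axioms go to theorems; morphisms are identified when provably equal. **Algebraic dependent type theories** ("theories"). Sorts: $(\mathrm{ctx},n),(\mathrm{tm},n)$, $n\in\mathbb N$; write $(\mathrm{ty},n)=(\mathrm{ctx},n+1)$. The theory of substitutions has symbols $\mathbf 1:(\mathrm{ctx},0)$, $\mathrm{ft}_n:(\mathrm{ty},n)\to(\mathrm{ctx},n)$,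 $\mathrm{ty}_n:(\mathrm{tm},n)\to(\mathrm{ty},n)$, $v_{n,i}:(\mathrm{ctx},n)\to(\mathrm{tm},n)$ ($0\le i<n$, de Bruijn variables), $\mathrm{subst}_{p,n,k}:(\mathrm{ctx},n)\times(p,k)\times(\mathrm{tm},n)^k\to(p,n)$ ($p\in\{\mathrm{ty},\mathrm{tm}\}$), with axioms making its models contextual categories: $\mathbf 1$ is the only element of $(\mathrm{ctx},0)$; $\mathrm{ft},\mathrm{ty},v$ are total; $\mathrm{subst}(\Gamma,t,a_1,\dots,a_k)$ is defined iff the $a_i$ lie in context $\Gamma$ and have the types in the context of $t$, substituted along $a_1,\dots,a_{i-1}$; the usual typing of substitutions and variables and the usual unit, variable and associativity laws hold. Put $\mathrm{ctx}_{\mathrm{ty},n}(t)=\mathrm{ft}_n(t)$, $\mathrm{ctx}_{\mathrm{tm},n}(t)=\mathrm{ft}_n(\mathrm{ty}_n(t))$, $\mathrm{ctx}^i_{p,n}(t)=\mathrm{ft}^i(\mathrm{ctx}_{p,n+i}(t))$. An algebraic dependent type theory extends the theory of substitutions by symbols $\sigma_m:(\mathrm{ctx},m)\times(p_1,m+n_1)\times\dots\times(p_k,m+n_k)\to(p,m+n)$, $m\in\mathbb N$, one family for each basic function symbol $\sigma:(p_1,n_1)\times\dots\times(p_k,n_k)\to(p,n)$ (similarly for predicates $R_m$), and axioms, such that if $\sigma_m(\Gamma,x_1,\dots,x_k)$ is defined then $\mathrm{ctx}^n_{p,m}(\sigma_m(\Gamma,x_1,\dots,x_k))=\Gamma$ and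 $\mathrm{ctx}^{n_i}_{p_i,m}(x_i)=\Gamma$ (and $R_m(\Gamma,x_1,\dots,x_k)$ implies the latter), and $\mathrm{subst}$ commutes with all symbols. Morphisms fix the theory of substitutions and are compatible with the index $m$. $\Gamma\vdash b:B$ means $\mathrm{ft}(B)=\Gamma$ and $\mathrm{ty}(b)=B$; $x:A\vdash\dots$ is the named version. **Identity structure.** $\mathrm{Id}_0$ is the theory with one basic function symbol $\mathrm{Id}:(\mathrm{tm},0)\times(\mathrm{tm},0)\to(\mathrm{ty},0)$ and the only axiom $\mathrm{Id}(x,y)\downarrow\ \vdash^{x,y}\mathrm{ty}(x)=\mathrm{ty}(y)$. All theories are equipped with a morphism from $\mathrm{Id}_0$, and morphisms respect it. **Relative homotopies.** In a model $X$: between $a,a'\in X_{(\mathrm{tm},n)}$, a term $h\in X_{(\mathrm{tm},n)}$ with $\mathrm{ty}(h)=\mathrm{Id}(a,a')$; between $A,A'\in X_{(\mathrm{ty},n)}$, a tuple $(f,g,p,g',p')$ of elements of $X_{(\mathrm{tm},n+1)}$ with $x:A\vdash f:A'$, $y:A'\vdash g:A$, $x:A\vdash p:\mathrm{Id}(g[y\mapsto f],x)$, $y:A'\vdash g':A$, $y:A'\vdash p':\mathrm{Id}(f[x\mapsto g'],y)$. **Weak equivalences and cofibrations of models.** Put $d_{\mathrm{ty}}=\mathrm{ctx}$, $d_{\mathrm{tm}}=\mathrm{ty}$, $e_{\mathrm{ty}}(a)=\mathrm{ft}(a)$, $e_{\mathrm{tm}}(a)=\mathrm{ty}(a)$. A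 morphism $f:X\to Y$ of models is a weak equivalence if for each $p\in\{\mathrm{ty},\mathrm{tm}\}$, $A\in X_{(d_p,n)}$ and $a\in Y_{(p,n)}$ with $e_p(a)=f(A)$ there is $a'\in X_{(p,n)}$ with $e_p(a')=A$ and $f(a')$ relatively homotopic to $a$. Cofibrations of models are generated by the set $\mathrm I$ of maps $F(\{A:(d_p,n)\})\to F(\{e_p(a)=A\})$, where $F(S)$ is the free model on the given generators and relations. **Semi-model theories.** A theory $T$ is semi-model if there is a left semi-model structure on $T\text{-}\mathbf{Mod}$ whose cofibrations are the class generated by $\mathrm I$ and whose weak equivalences are the morphisms $f:X\to Y$ of models such that every $a\in Y_{(p,n)}$ with $e_p(a)=f(A)$, $A\in X_{(d_p,n)}$, is relatively homotopic to $f(a')$ for some $a'\in X_{(p,n)}$ with $e_p(a')=A$ (a left semi-model structure is as a model structure, except that lifting of trivial cofibrations against fibrations, and factorization into a trivial cofibration followed by a fibration, are required only for maps with cofibrant domain). A Quillen adjunction is an adjunction whose left adjoint preserves generating cofibrations and generating trivial cofibrations; it is a Quillen equivalence if for all cofibrant $X$ and fibrant $Y$ a map $f_!(X)\to Y$ is a weak equivalence iff its adjunct $X\to f^*(Y)$ is. **Morita equivalences.** A morphism $f:T_1\to T_2$ induces $f_!\dashv f^*$, where $f^*:T_2\text{-}\mathbf{Mod}\to T_1\text{-}\mathbf{Mod}$ is the reduct functor; $f$ is a Morita equivalence if the unit $\eta_X:X\to f^*(f_!(X))$ is a weak equivalence for every cofibrant model $X$ of $T_1$.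
   Formalization: The generating trivial cofibrations, left unspecified, are taken to be the maps from F({a}) to F({relative homotopy with source a}), and a semi-model theory is one whose structure has as fibrations exactly the maps with the right lifting property against these. *)

theory Defs
  imports Main
begin

section \<open>Partial Horn theories\<close>

datatype ('f, 's) trm = Var nat 's | App 'f "('f, 's) trm list"

datatype ('f, 'r, 's) atom = Eq "('f, 's) trm" "('f, 's) trm" | Rel 'r "('f, 's) trm list"

text \<open>A Horn formula is the conjunction of a list of atoms; variables carry their sort.\<close>

type_synonym ('f, 'r, 's) horn = "('f, 'r, 's) atom list"

type_synonym ('f, 'r, 's) sequent =
  "(nat \<times> 's) set \<times> ('f, 'r, 's) horn \<times> ('f, 'r, 's) horn"

record ('f, 'r, 's) phl =
  fsyms :: "'f set"
  far :: "'f \<Rightarrow> 's list"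
  fres :: "'f \<Rightarrow> 's"
  psyms :: "'r set"
  par :: "'r \<Rightarrow> 's list"
  axioms :: "('f, 'r, 's) sequent set"

abbreviation defd :: "('f, 's) trm \<Rightarrow> ('f, 'r, 's) atom" where
  "defd t \<equiv> Eq t t"

definition ctxvars :: "'s list \<Rightarrow> (nat \<times> 's) set" where
  "ctxvars ss = {(i, ss ! i) | i. i < length ss}"

definition varterms :: "'s list \<Rightarrow> ('f, 's) trm list" where
  "varterms ss = map (\<lambda>i. Var i (ss ! i)) [0..<length ss]"

inductive has_sort :: "('f, 'r, 's) phl \<Rightarrow> (nat \<times> 's) set \<Rightarrow> ('f, 's) trm \<Rightarrow> 's \<Rightarrow> bool"
  for T V where
  "(i, s) \<in> V \<Longrightarrow> has_sort T V (Var i s) s"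
| "f \<in> fsyms T \<Longrightarrow> list_all2 (has_sort T V) ts (far T f) \<Longrightarrow> has_sort T V (App f ts) (fres T f)"

fun wf_atom :: "('f, 'r, 's) phl \<Rightarrow> (nat \<times> 's) set \<Rightarrow> ('f, 'r, 's) atom \<Rightarrow> bool" where
  "wf_atom T V (Eq t u) \<longleftrightarrow> (\<exists>s. has_sort T V t s \<and> has_sort T V u s)"
| "wf_atom T V (Rel R ts) \<longleftrightarrow> R \<in> psyms T \<and> list_all2 (has_sort T V) ts (par T R)"

definition wf_horn :: "('f, 'r, 's) phl \<Rightarrow> (nat \<times> 's) set \<Rightarrow> ('f, 'r, 's) horn \<Rightarrow> bool" where
  "wf_horn T V \<phi> \<longleftrightarrow> (\<forall>a\<in>set \<phi>. wf_atom T V a)"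

primrec sub :: "(nat \<Rightarrow> 's \<Rightarrow> ('f, 's) trm) \<Rightarrow> ('f, 's) trm \<Rightarrow> ('f, 's) trm" where
  "sub \<theta> (Var i s) = \<theta> i s"
| "sub \<theta> (App f ts) = App f (map (sub \<theta>) ts)"

fun sub_atom :: "(nat \<Rightarrow> 's \<Rightarrow> ('f, 's) trm) \<Rightarrow> ('f, 'r, 's) atom \<Rightarrow> ('f, 'r, 's) atom" where
  "sub_atom \<theta> (Eq t u) = Eq (sub \<theta> t) (sub \<theta> u)"
| "sub_atom \<theta> (Rel R ts) = Rel R (map (sub \<theta>) ts)"

text \<open>
  Partial Horn logic in natural deduction style: \<open>derives T V \<phi> a\<close> says that the sequent with
  context \<open>V\<close>, premise \<open>\<phi>\<close> and the single atom \<open>a\<close> as conclusion is derivable. All operations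
  and predicates are strict, and only defined terms may be substituted into an axiom.
\<close>

inductive derives ::
  "('f, 'r, 's) phl \<Rightarrow> (nat \<times> 's) set \<Rightarrow> ('f, 'r, 's) horn \<Rightarrow> ('f, 'r, 's) atom \<Rightarrow> bool"
  for T V \<phi> where
  hyp: "a \<in> set \<phi> \<Longrightarrow> derives T V \<phi> a"
| var: "(i, s) \<in> V \<Longrightarrow> derives T V \<phi> (defd (Var i s))"
| sym: "derives T V \<phi> (Eq t u) \<Longrightarrow> derives T V \<phi> (Eq u t)"
| trans: "derives T V \<phi> (Eq t u) \<Longrightarrow> derives T V \<phi> (Eq u w) \<Longrightarrow> derives T V \<phi> (Eq t w)"
| fun_strict: "derives T V \<phi> (defd (App f ts)) \<Longrightarrow> t \<in> set ts \<Longrightarrow> derives T V \<phi> (defd t)"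
| rel_strict: "derives T V \<phi> (Rel R ts) \<Longrightarrow> t \<in> set ts \<Longrightarrow> derives T V \<phi> (defd t)"
| fun_cong: "derives T V \<phi> (defd (App f ts)) \<Longrightarrow>
    list_all2 (\<lambda>t u. derives T V \<phi> (Eq t u)) ts us \<Longrightarrow> derives T V \<phi> (Eq (App f ts) (App f us))"
| rel_cong: "derives T V \<phi> (Rel R ts) \<Longrightarrow>
    list_all2 (\<lambda>t u. derives T V \<phi> (Eq t u)) ts us \<Longrightarrow> derives T V \<phi> (Rel R us)"
| axiom: "(W, \<psi>, \<chi>) \<in> axioms T \<Longrightarrow>
    (\<And>i s. (i, s) \<in> W \<Longrightarrow> has_sort T V (\<theta> i s) s \<and> derives T V \<phi> (defd (\<theta> i s))) \<Longrightarrow>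
    (\<And>a. a \<in> set \<psi> \<Longrightarrow> derives T V \<phi> (sub_atom \<theta> a)) \<Longrightarrow>
    b \<in> set \<chi> \<Longrightarrow> derives T V \<phi> (sub_atom \<theta> b)"

definition entails ::
  "('f, 'r, 's) phl \<Rightarrow> (nat \<times> 's) set \<Rightarrow> ('f, 'r, 's) horn \<Rightarrow> ('f, 'r, 's) horn \<Rightarrow> bool" where
  "entails T V \<phi> \<psi> \<longleftrightarrow> (\<forall>a\<in>set \<psi>. derives T V \<phi> a)"


subsection \<open>Restricted terms and interpretations\<close>

text \<open>The restricted term \<open>(t, \<chi>)\<close> is defined iff \<open>\<chi>\<close> holds and \<open>t\<close> is defined.\<close>

type_synonym ('f, 'r, 's) rtrm = "('f, 's) trm \<times> ('f, 'r, 's) horn"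

definition wf_rtrm :: "('f, 'r, 's) phl \<Rightarrow> 's list \<Rightarrow> 's \<Rightarrow> ('f, 'r, 's) rtrm \<Rightarrow> bool" where
  "wf_rtrm T ss s r \<longleftrightarrow> has_sort T (ctxvars ss) (fst r) s \<and> wf_horn T (ctxvars ss) (snd r)"

definition horn_eq ::
  "('f, 'r, 's) phl \<Rightarrow> 's list \<Rightarrow> ('f, 'r, 's) horn \<Rightarrow> ('f, 'r, 's) horn \<Rightarrow> bool" where
  "horn_eq T ss \<phi> \<psi> \<longleftrightarrow> entails T (ctxvars ss) \<phi> \<psi> \<and> entails T (ctxvars ss) \<psi> \<phi>"

definition rtrm_eq ::
  "('f, 'r, 's) phl \<Rightarrow> 's list \<Rightarrow> ('f, 'r, 's) rtrm \<Rightarrow> ('f, 'r, 's) rtrm \<Rightarrow> bool" where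
  "rtrm_eq T ss r r' \<longleftrightarrow>
     entails T (ctxvars ss) (defd (fst r) # snd r) (Eq (fst r) (fst r') # snd r') \<and>
     entails T (ctxvars ss) (defd (fst r') # snd r') (Eq (fst r) (fst r') # snd r)"

record ('f, 'r, 'g, 'q, 's) interp =
  fmap :: "'f \<Rightarrow> ('g, 'q, 's) rtrm"
  pmap :: "'r \<Rightarrow> ('g, 'q, 's) horn"

definition plug_sub :: "('g, 's) trm list \<Rightarrow> nat \<Rightarrow> 's \<Rightarrow> ('g, 's) trm" where
  "plug_sub us i s = (if i < length us then us ! i else Var i s)"

text \<open>
  Substituting restricted terms for the arguments keeps their restrictions, together with the
  definedness of those arguments that need not occur in the resulting formula.
\<close>

definition arg_conds :: "('g, 'q, 's) rtrm list \<Rightarrow> ('g, 'q, 's) horn" where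
  "arg_conds rs = concat (map snd rs) @ map (\<lambda>r. defd (fst r)) rs"

definition plug :: "('g, 'q, 's) rtrm \<Rightarrow> ('g, 'q, 's) rtrm list \<Rightarrow> ('g, 'q, 's) rtrm" where
  "plug r rs = (sub (plug_sub (map fst rs)) (fst r),
     arg_conds rs @ map (sub_atom (plug_sub (map fst rs))) (snd r))"

primrec tr :: "('f, 'r, 'g, 'q, 's) interp \<Rightarrow> ('f, 's) trm \<Rightarrow> ('g, 'q, 's) rtrm" where
  "tr F (Var i s) = (Var i s, [])"
| "tr F (App f ts) = plug (fmap F f) (map (tr F) ts)"

fun tr_atom :: "('f, 'r, 'g, 'q, 's) interp \<Rightarrow> ('f, 'r, 's) atom \<Rightarrow> ('g, 'q, 's) horn" where
  "tr_atom F (Eq t u) = Eq (fst (tr F t)) (fst (tr F u)) # snd (tr F t) @ snd (tr F u)"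
| "tr_atom F (Rel R ts) =
     arg_conds (map (tr F) ts) @
     map (sub_atom (plug_sub (map (\<lambda>t. fst (tr F t)) ts))) (pmap F R)"

definition tr_horn :: "('f, 'r, 'g, 'q, 's) interp \<Rightarrow> ('f, 'r, 's) horn \<Rightarrow> ('g, 'q, 's) horn" where
  "tr_horn F \<phi> = concat (map (tr_atom F) \<phi>)"

definition tr_rtrm :: "('f, 'r, 'g, 'q, 's) interp \<Rightarrow> ('f, 'r, 's) rtrm \<Rightarrow> ('g, 'q, 's) rtrm" where
  "tr_rtrm F r = (fst (tr F (fst r)), snd (tr F (fst r)) @ tr_horn F (snd r))"

definition phl_morphism ::
  "('f, 'r, 's) phl \<Rightarrow> ('g, 'q, 's) phl \<Rightarrow> ('f, 'r, 'g, 'q, 's) interp \<Rightarrow> bool" where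
  "phl_morphism S T F \<longleftrightarrow>
     (\<forall>f\<in>fsyms S. wf_rtrm T (far S f) (fres S f) (fmap F f)) \<and>
     (\<forall>R\<in>psyms S. wf_horn T (ctxvars (par S R)) (pmap F R)) \<and>
     (\<forall>(V, \<phi>, \<psi>)\<in>axioms S. entails T V (tr_horn F \<phi>) (tr_horn F \<psi>))"


subsection \<open>Models\<close>

record ('f, 'r, 's, 'u) model =
  car :: "'s \<Rightarrow> 'u set"
  fn :: "'f \<Rightarrow> 'u list \<Rightarrow> 'u option"
  rl :: "'r \<Rightarrow> 'u list \<Rightarrow> bool"

definition elems :: "('f, 'r, 's, 'u) model \<Rightarrow> 's list \<Rightarrow> 'u list \<Rightarrow> bool" where
  "elems M ss xs \<longleftrightarrow> list_all2 (\<lambda>s x. x \<in> car M s) ss xs"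

primrec tm_val :: "('f, 'r, 's, 'u) model \<Rightarrow> (nat \<Rightarrow> 's \<Rightarrow> 'u) \<Rightarrow> ('f, 's) trm \<Rightarrow> 'u option" where
  "tm_val M v (Var i s) = Some (v i s)"
| "tm_val M v (App f ts) =
     (case those (map (tm_val M v) ts) of None \<Rightarrow> None | Some xs \<Rightarrow> fn M f xs)"

fun sat :: "('f, 'r, 's, 'u) model \<Rightarrow> (nat \<Rightarrow> 's \<Rightarrow> 'u) \<Rightarrow> ('f, 'r, 's) atom \<Rightarrow> bool" where
  "sat M v (Eq t u) \<longleftrightarrow> tm_val M v t \<noteq> None \<and> tm_val M v t = tm_val M v u"
| "sat M v (Rel R ts) \<longleftrightarrow> (\<exists>xs. those (map (tm_val M v) ts) = Some xs \<and> rl M R xs)"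

definition sat_horn where
  "sat_horn M v \<phi> \<longleftrightarrow> (\<forall>a\<in>set \<phi>. sat M v a)"

text \<open>
  The operations and predicates of a model are undefined, respectively false, outside the
  carriers and on symbols that do not belong to the signature.
\<close>

definition is_model :: "('f, 'r, 's) phl \<Rightarrow> ('f, 'r, 's, 'u) model \<Rightarrow> bool" where
  "is_model T M \<longleftrightarrow>
     (\<forall>f xs y. fn M f xs = Some y \<longrightarrow> f \<in> fsyms T \<and> elems M (far T f) xs \<and> y \<in> car M (fres T f)) \<and>
     (\<forall>R xs. rl M R xs \<longrightarrow> R \<in> psyms T \<and> elems M (par T R) xs) \<and>
     (\<forall>(V, \<phi>, \<psi>)\<in>axioms T. \<forall>v. (\<forall>(i, s)\<in>V. v i s \<in> car M s) \<longrightarrow>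
        sat_horn M v \<phi> \<longrightarrow> sat_horn M v \<psi>)"

text \<open>Homomorphisms preserve, but need not reflect, definedness and predicates.\<close>

definition is_hom ::
  "('f, 'r, 's) phl \<Rightarrow> ('f, 'r, 's, 'u) model \<Rightarrow> ('f, 'r, 's, 'u) model \<Rightarrow> ('s \<Rightarrow> 'u \<Rightarrow> 'u) \<Rightarrow> bool"
where
  "is_hom T M N h \<longleftrightarrow>
     (\<forall>s a. if a \<in> car M s then h s a \<in> car N s else h s a = undefined) \<and>
     (\<forall>f xs y. fn M f xs = Some y \<longrightarrow> fn N f (map2 h (far T f) xs) = Some (h (fres T f) y)) \<and>
     (\<forall>R xs. rl M R xs \<longrightarrow> rl N R (map2 h (par T R) xs))"

definition reduct ::
  "('f, 'r, 's) phl \<Rightarrow> ('f, 'r, 'g, 'q, 's) interp \<Rightarrow> ('g, 'q, 's, 'u) model \<Rightarrow> ('f, 'r, 's, 'u) model"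
where
  "reduct S F M =
     \<lparr>car = car M,
      fn = (\<lambda>f xs. if f \<in> fsyms S \<and> elems M (far S f) xs \<and>
                      sat_horn M (\<lambda>i s. xs ! i) (snd (fmap F f))
                   then tm_val M (\<lambda>i s. xs ! i) (fst (fmap F f)) else None),
      rl = (\<lambda>R xs. R \<in> psyms S \<and> elems M (par S R) xs \<and>
                   sat_horn M (\<lambda>i s. xs ! i) (pmap F R))\<rparr>"


section \<open>Categories and left semi-model structures\<close>

record ('o, 'a) category =
  Obj :: "'o set"
  Arr :: "'a set"
  Dom :: "'a \<Rightarrow> 'o"
  Cod :: "'a \<Rightarrow> 'o"
  Ident :: "'o \<Rightarrow> 'a"
  Comp :: "'a \<Rightarrow> 'a \<Rightarrow> 'a"

definition Hom :: "('o, 'a) category \<Rightarrow> 'o \<Rightarrow> 'o \<Rightarrow> 'a set" where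
  "Hom C X Y = {a \<in> Arr C. Dom C a = X \<and> Cod C a = Y}"

definition initial :: "('o, 'a) category \<Rightarrow> 'o \<Rightarrow> bool" where
  "initial C X \<longleftrightarrow> X \<in> Obj C \<and> (\<forall>Y\<in>Obj C. \<exists>!a. a \<in> Hom C X Y)"

definition terminal :: "('o, 'a) category \<Rightarrow> 'o \<Rightarrow> bool" where
  "terminal C X \<longleftrightarrow> X \<in> Obj C \<and> (\<forall>Y\<in>Obj C. \<exists>!a. a \<in> Hom C Y X)"

definition lifts :: "('o, 'a) category \<Rightarrow> 'a \<Rightarrow> 'a \<Rightarrow> bool" where
  "lifts C i p \<longleftrightarrow>
     (\<forall>u\<in>Hom C (Dom C i) (Dom C p). \<forall>v\<in>Hom C (Cod C i) (Cod C p).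
        Comp C p u = Comp C v i \<longrightarrow>
        (\<exists>d\<in>Hom C (Cod C i) (Dom C p). Comp C d i = u \<and> Comp C p d = v))"

definition rlp :: "('o, 'a) category \<Rightarrow> 'a set \<Rightarrow> 'a set" where
  "rlp C S = {p \<in> Arr C. \<forall>i\<in>S. lifts C i p}"

definition llp :: "('o, 'a) category \<Rightarrow> 'a set \<Rightarrow> 'a set" where
  "llp C S = {i \<in> Arr C. \<forall>p\<in>S. lifts C i p}"

definition retract_of :: "('o, 'a) category \<Rightarrow> 'a \<Rightarrow> 'a \<Rightarrow> bool" where
  "retract_of C f g \<longleftrightarrow>
     (\<exists>s\<in>Hom C (Dom C f) (Dom C g). \<exists>r\<in>Hom C (Dom C g) (Dom C f).
      \<exists>s'\<in>Hom C (Cod C f) (Cod C g). \<exists>r'\<in>Hom C (Cod C g) (Cod C f).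
        Comp C r s = Ident C (Dom C f) \<and> Comp C r' s' = Ident C (Cod C f) \<and>
        Comp C g s = Comp C s' f \<and> Comp C f r = Comp C r' g)"

definition retract_closed :: "('o, 'a) category \<Rightarrow> 'a set \<Rightarrow> bool" where
  "retract_closed C S \<longleftrightarrow> (\<forall>g\<in>S. \<forall>f\<in>Arr C. retract_of C f g \<longrightarrow> f \<in> S)"

definition two_of_three :: "('o, 'a) category \<Rightarrow> 'a set \<Rightarrow> bool" where
  "two_of_three C W \<longleftrightarrow>
     (\<forall>f\<in>Arr C. \<forall>g\<in>Arr C. Cod C f = Dom C g \<longrightarrow>
        (f \<in> W \<and> g \<in> W \<longrightarrow> Comp C g f \<in> W) \<and>
        (f \<in> W \<and> Comp C g f \<in> W \<longrightarrow> g \<in> W) \<and>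
        (g \<in> W \<and> Comp C g f \<in> W \<longrightarrow> f \<in> W))"

definition cofibrant :: "('o, 'a) category \<Rightarrow> 'a set \<Rightarrow> 'o \<Rightarrow> bool" where
  "cofibrant C Cof X \<longleftrightarrow> (\<exists>Z. initial C Z \<and> (\<exists>i\<in>Hom C Z X. i \<in> Cof))"

definition fibrant :: "('o, 'a) category \<Rightarrow> 'a set \<Rightarrow> 'o \<Rightarrow> bool" where
  "fibrant C Fib X \<longleftrightarrow> (\<exists>Z. terminal C Z \<and> (\<exists>p\<in>Hom C X Z. p \<in> Fib))"

definition left_semi_model_structure ::
  "('o, 'a) category \<Rightarrow> 'a set \<Rightarrow> 'a set \<Rightarrow> 'a set \<Rightarrow> bool" where
  "left_semi_model_structure C Cof W Fib \<longleftrightarrow>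
     Cof \<subseteq> Arr C \<and> W \<subseteq> Arr C \<and> Fib \<subseteq> Arr C \<and>
     two_of_three C W \<and>
     retract_closed C Cof \<and> retract_closed C W \<and> retract_closed C Fib \<and>
     (\<forall>i\<in>Cof. \<forall>p\<in>Fib \<inter> W. lifts C i p) \<and>
     (\<forall>i\<in>Cof \<inter> W. cofibrant C Cof (Dom C i) \<longrightarrow> (\<forall>p\<in>Fib. lifts C i p)) \<and>
     (\<forall>f\<in>Arr C. \<exists>i\<in>Cof. \<exists>p\<in>Fib \<inter> W. Cod C i = Dom C p \<and> Comp C p i = f) \<and>
     (\<forall>f\<in>Arr C. cofibrant C Cof (Dom C f) \<longrightarrow>
        (\<exists>i\<in>Cof \<inter> W. \<exists>p\<in>Fib. Cod C i = Dom C p \<and> Comp C p i = f))"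

definition universal_arrow ::
  "('o, 'a) category \<Rightarrow> ('p, 'b) category \<Rightarrow> ('p \<Rightarrow> 'o) \<Rightarrow> ('b \<Rightarrow> 'a) \<Rightarrow> 'o \<Rightarrow> 'p \<Rightarrow> 'a \<Rightarrow> bool"
where
  "universal_arrow C D Go Ga X Z e \<longleftrightarrow>
     Z \<in> Obj D \<and> e \<in> Hom C X (Go Z) \<and>
     (\<forall>Y\<in>Obj D. \<forall>g\<in>Hom C X (Go Y). \<exists>!k. k \<in> Hom D Z Y \<and> Comp C (Ga k) e = g)"


section \<open>Algebraic dependent type theories\<close>

datatype kind = Ctx | Tm

type_synonym sort = "kind \<times> nat"

text \<open>\<open>TY\<close> and \<open>TM\<close> are the two values of \<open>p\<close>; a type in a context of length \<open>n\<close> is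
  identified with the extended context.\<close>

datatype pk = TY | TM

fun psort :: "pk \<Rightarrow> nat \<Rightarrow> sort" where
  "psort TY n = (Ctx, Suc n)"
| "psort TM n = (Tm, n)"

text \<open>\<open>Op f m\<close> is the member with index \<open>m\<close> of the family of the basic function symbol \<open>f\<close>.\<close>

datatype 'f fsym = One | Ft nat | TyOf nat | Vr nat nat | Subst pk nat nat | Op 'f nat

type_synonym 'r psym = "'r \<times> nat"

type_synonym 'f stm = "('f fsym, sort) trm"
type_synonym ('f, 'r) shorn = "('f fsym, 'r psym, sort) horn"
type_synonym ('f, 'r) sphl = "('f fsym, 'r psym, sort) phl"
type_synonym ('f, 'r, 'u) smodel = "('f fsym, 'r psym, sort, 'u) model"
type_synonym ('f, 'r, 'g, 'q) mor = "('f fsym, 'r psym, 'g fsym, 'q psym, sort) interp"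

record ('f, 'r) adtt =
  ops :: "'f set"
  op_args :: "'f \<Rightarrow> (pk \<times> nat) list"
  op_res :: "'f \<Rightarrow> pk \<times> nat"
  preds :: "'r set"
  pred_args :: "'r \<Rightarrow> (pk \<times> nat) list"
  extra_axioms :: "('f fsym, 'r psym, sort) sequent set"

definition shift_args :: "nat \<Rightarrow> (pk \<times> nat) list \<Rightarrow> sort list" where
  "shift_args m ps = (Ctx, m) # map (\<lambda>(p, n). psort p (m + n)) ps"

fun sym_args :: "('f, 'r, 'z) adtt_scheme \<Rightarrow> 'f fsym \<Rightarrow> sort list" where
  "sym_args T One = []"
| "sym_args T (Ft n) = [(Ctx, Suc n)]"
| "sym_args T (TyOf n) = [(Tm, n)]"
| "sym_args T (Vr n i) = [(Ctx, n)]"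
| "sym_args T (Subst p n k) = (Ctx, n) # psort p k # replicate k (Tm, n)"
| "sym_args T (Op f m) = shift_args m (op_args T f)"

fun sym_res :: "('f, 'r, 'z) adtt_scheme \<Rightarrow> 'f fsym \<Rightarrow> sort" where
  "sym_res T One = (Ctx, 0)"
| "sym_res T (Ft n) = (Ctx, n)"
| "sym_res T (TyOf n) = (Ctx, Suc n)"
| "sym_res T (Vr n i) = (Tm, n)"
| "sym_res T (Subst p n k) = psort p n"
| "sym_res T (Op f m) = psort (fst (op_res T f)) (m + snd (op_res T f))"

definition sym_set :: "('f, 'r, 'z) adtt_scheme \<Rightarrow> 'f fsym set" where
  "sym_set T = {One} \<union> range Ft \<union> range TyOf \<union> {Vr n i | n i. i < n} \<union>
     {Subst p n k | p n k. True} \<union> {Op f m | f m. f \<in> ops T}"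


subsection \<open>The theory of substitutions\<close>

fun ctx_tm :: "pk \<Rightarrow> nat \<Rightarrow> 'f stm \<Rightarrow> 'f stm" where
  "ctx_tm TY n t = App (Ft n) [t]"
| "ctx_tm TM n t = App (Ft n) [App (TyOf n) [t]]"

text \<open>\<open>ft_iter n i\<close> is the \<open>i\<close>-fold iterate of \<open>ft\<close> from \<open>(Ctx, n + i)\<close> to \<open>(Ctx, n)\<close>.\<close>

fun ft_iter :: "nat \<Rightarrow> nat \<Rightarrow> 'f stm \<Rightarrow> 'f stm" where
  "ft_iter n 0 t = t"
| "ft_iter n (Suc i) t = App (Ft n) [ft_iter (Suc n) i t]"

definition ctx_iter :: "pk \<Rightarrow> nat \<Rightarrow> nat \<Rightarrow> 'f stm \<Rightarrow> 'f stm" where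
  "ctx_iter p n i t = ft_iter n i (ctx_tm p (n + i) t)"

text \<open>\<open>v\<^bsub>n,n-1\<^esub>, ..., v\<^bsub>n,lo\<^esub>\<close>, that is, from the outermost variable inwards.\<close>

definition vars_down :: "nat \<Rightarrow> nat \<Rightarrow> 'f stm \<Rightarrow> 'f stm list" where
  "vars_down n lo G = map (\<lambda>i. App (Vr n i) [G]) (rev [lo..<n])"

text \<open>
  \<open>ctx_map n k G D as\<close> states that \<open>as\<close> is a morphism from the context \<open>G\<close> of length \<open>n\<close> to the
  context \<open>D\<close> of length \<open>k\<close>. The type of the variable at position \<open>i\<close> (from the left, starting
  with 0) of \<open>D\<close> is \<open>ft\<^bsup>k-1-i\<^esup> D\<close>.
\<close>

definition ctx_map :: "nat \<Rightarrow> nat \<Rightarrow> 'f stm \<Rightarrow> 'f stm \<Rightarrow> 'f stm list \<Rightarrow> ('f, 'r) shorn" where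
  "ctx_map n k G D as = concat (map (\<lambda>i.
     [Eq (ctx_tm TM n (as ! i)) G,
      Eq (App (TyOf n) [as ! i])
         (App (Subst TY n i) (G # ft_iter (Suc i) (k - Suc i) D # take i as))]) [0..<k])"

definition var_list :: "nat \<Rightarrow> nat \<Rightarrow> sort \<Rightarrow> 'f stm list" where
  "var_list start k s = map (\<lambda>i. Var (start + i) s) [0..<k]"

definition one_axioms :: "('f fsym, 'r psym, sort) sequent set" where
  "one_axioms =
     {({}, [], [defd (App One [])]),
      (ctxvars [(Ctx, 0)], [], [Eq (Var 0 (Ctx, 0)) (App One [])])}"

definition total_axioms :: "('f fsym, 'r psym, sort) sequent set" where
  "total_axioms =
     {(ctxvars [(Ctx, Suc n)], [], [defd (App (Ft n) [Var 0 (Ctx, Suc n)])]) | n. True} \<union>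
     {(ctxvars [(Tm, n)], [], [defd (App (TyOf n) [Var 0 (Tm, n)])]) | n. True} \<union>
     {(ctxvars [(Ctx, n)], [], [defd (App (Vr n i) [Var 0 (Ctx, n)])]) | n i. i < n}"

definition subst_def_axioms :: "('f fsym, 'r psym, sort) sequent set" where
  "subst_def_axioms = (\<Union>p n k.
     let ss = (Ctx, n) # psort p k # replicate k (Tm, n);
         G = Var 0 (Ctx, n); t = Var 1 (psort p k); as = var_list 2 k (Tm, n);
         \<delta> = [defd (App (Subst p n k) (G # t # as))];
         \<gamma> = ctx_map n k G (ctx_tm p k t) as
     in {(ctxvars ss, \<delta>, \<gamma>), (ctxvars ss, \<gamma>, \<delta>)})"

definition subst_typing_axioms :: "('f fsym, 'r psym, sort) sequent set" where
  "subst_typing_axioms = (\<Union>n k.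
     let G = Var 0 (Ctx, n); A = Var 1 (psort TY k); t = Var 1 (psort TM k);
         as = var_list 2 k (Tm, n);
         A' = App (Subst TY n k) (G # A # as); t' = App (Subst TM n k) (G # t # as)
     in {(ctxvars ((Ctx, n) # psort TY k # replicate k (Tm, n)), [defd A'],
            [Eq (ctx_tm TY n A') G]),
         (ctxvars ((Ctx, n) # psort TM k # replicate k (Tm, n)), [defd t'],
            [Eq (App (TyOf n) [t']) (App (Subst TY n k) (G # App (TyOf k) [t] # as))])})"

definition var_typing_axioms :: "('f fsym, 'r psym, sort) sequent set" where
  "var_typing_axioms = {(ctxvars [(Ctx, n)], [],
     [Eq (App (TyOf n) [App (Vr n i) [G]])
         (App (Subst TY n (n - Suc i)) (G # ft_iter (n - i) i G # vars_down n (Suc i) G))])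
     | n i G. i < n \<and> G = Var 0 (Ctx, n)}"

definition unit_axioms :: "('f fsym, 'r psym, sort) sequent set" where
  "unit_axioms = {(ctxvars [psort p n], [],
     [Eq (App (Subst p n n) (ctx_tm p n t # t # vars_down n 0 (ctx_tm p n t))) t])
     | p n t. t = Var 0 (psort p n)}"

definition subst_var_axioms :: "('f fsym, 'r psym, sort) sequent set" where
  "subst_var_axioms = {(ctxvars ((Ctx, n) # (Ctx, k) # replicate k (Tm, n)),
     [defd t], [Eq t (as ! (k - Suc i))])
     | n k i as t. i < k \<and> as = var_list 2 k (Tm, n) \<and>
         t = App (Subst TM n k) (Var 0 (Ctx, n) # App (Vr k i) [Var 1 (Ctx, k)] # as)}"

definition assoc_axioms :: "('f fsym, 'r psym, sort) sequent set" where
  "assoc_axioms = (\<Union>p n k l.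
     let ss = (Ctx, n) # (Ctx, k) # psort p l # replicate l (Tm, k) @ replicate k (Tm, n);
         G = Var 0 (Ctx, n); D = Var 1 (Ctx, k); t = Var 2 (psort p l);
         bs = var_list 3 l (Tm, k); as = var_list (3 + l) k (Tm, n);
         lhs = App (Subst p n k) (G # App (Subst p k l) (D # t # bs) # as);
         rhs = App (Subst p n l) (G # t # map (\<lambda>b. App (Subst TM n k) (G # b # as)) bs)
     in {(ctxvars ss, [defd lhs], [Eq lhs rhs])})"

definition subst_axioms :: "('f fsym, 'r psym, sort) sequent set" where
  "subst_axioms = one_axioms \<union> total_axioms \<union> subst_def_axioms \<union> subst_typing_axioms \<union>
     var_typing_axioms \<union> unit_axioms \<union> subst_var_axioms \<union> assoc_axioms"


subsection \<open>Contexts of the symbols and their stability under substitution\<close>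

text \<open>
  Let \<open>as\<close> be a morphism from the context \<open>D\<close> of length \<open>k\<close> to a context \<open>G\<close> of length \<open>m\<close>.
  For a context \<open>B\<close> of length \<open>m + n\<close> extending \<open>G\<close>, \<open>ext_ctx k m n D B as\<close> is the extension of
  \<open>D\<close> by the last \<open>n\<close> types of \<open>B\<close> substituted along \<open>as\<close>; for \<open>x\<close> of sort \<open>psort p (m + n)\<close> over
  \<open>G\<close>, \<open>ext_subst p k m n D x as\<close> substitutes \<open>as\<close>, weakened to the extended context and completed
  by the last \<open>n\<close> variables, in \<open>x\<close>.
\<close>

definition lift_map :: "nat \<Rightarrow> nat \<Rightarrow> 'f stm \<Rightarrow> 'f stm list \<Rightarrow> 'f stm list" where
  "lift_map k n E as =
     map (\<lambda>a. App (Subst TM (k + n) k) (E # a # vars_down (k + n) n E)) as @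
     map (\<lambda>i. App (Vr (k + n) i) [E]) (rev [0..<n])"

fun ext_ctx :: "nat \<Rightarrow> nat \<Rightarrow> nat \<Rightarrow> 'f stm \<Rightarrow> 'f stm \<Rightarrow> 'f stm list \<Rightarrow> 'f stm" where
  "ext_ctx k m 0 D B as = D"
| "ext_ctx k m (Suc n) D B as =
     (let E = ext_ctx k m n D (App (Ft (m + n)) [B]) as
      in App (Subst TY (k + n) (m + n)) (E # B # lift_map k n E as))"

definition ext_subst :: "pk \<Rightarrow> nat \<Rightarrow> nat \<Rightarrow> nat \<Rightarrow> 'f stm \<Rightarrow> 'f stm \<Rightarrow> 'f stm list \<Rightarrow> 'f stm" where
  "ext_subst p k m n D x as =
     (let E = ext_ctx k m n D (ctx_tm p (m + n) x) as
      in App (Subst p (k + n) (m + n)) (E # x # lift_map k n E as))"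

text \<open>The arguments \<open>x\<^sub>1, ..., x\<^sub>k\<close> of a symbol with index \<open>m\<close>; the variable 0 is the context.\<close>

definition arg_vars :: "nat \<Rightarrow> (pk \<times> nat) list \<Rightarrow> 'f stm list" where
  "arg_vars m ps = tl (varterms (shift_args m ps))"

definition args_over :: "nat \<Rightarrow> (pk \<times> nat) list \<Rightarrow> ('f, 'r) shorn" where
  "args_over m ps =
     map2 (\<lambda>(p, n) x. Eq (ctx_iter p m n x) (Var 0 (Ctx, m))) ps (arg_vars m ps)"

definition op_context_axioms ::
  "('f, 'r, 'z) adtt_scheme \<Rightarrow> ('f fsym, 'r psym, sort) sequent set" where
  "op_context_axioms T = {(ctxvars (shift_args m (op_args T f)), [defd t],
       Eq (ctx_iter (fst (op_res T f)) m (snd (op_res T f)) t) (Var 0 (Ctx, m)) #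
       args_over m (op_args T f))
     | f m t. f \<in> ops T \<and> t = App (Op f m) (varterms (shift_args m (op_args T f)))}"

definition pred_context_axioms ::
  "('f, 'r, 'z) adtt_scheme \<Rightarrow> ('f fsym, 'r psym, sort) sequent set" where
  "pred_context_axioms T = {(ctxvars (shift_args m (pred_args T R)),
       [Rel (R, m) (varterms (shift_args m (pred_args T R)))], args_over m (pred_args T R))
     | R m. R \<in> preds T}"

definition op_subst_axioms ::
  "('f, 'r, 'z) adtt_scheme \<Rightarrow> ('f fsym, 'r psym, sort) sequent set" where
  "op_subst_axioms T = (\<Union>f\<in>ops T. \<Union>m k.
     let ps = op_args T f; ss = shift_args m ps; l = length ss;
         D = Var l (Ctx, k); as = var_list (Suc l) m (Tm, k);
         t = App (Op f m) (varterms ss);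
         lhs = ext_subst (fst (op_res T f)) k m (snd (op_res T f)) D t as;
         rhs = App (Op f k)
           (D # map2 (\<lambda>(p, n) x. ext_subst p k m n D x as) ps (arg_vars m ps))
     in {(ctxvars (ss @ (Ctx, k) # replicate m (Tm, k)),
          defd t # ctx_map k m D (Var 0 (Ctx, m)) as, [Eq lhs rhs])})"

definition pred_subst_axioms ::
  "('f, 'r, 'z) adtt_scheme \<Rightarrow> ('f fsym, 'r psym, sort) sequent set" where
  "pred_subst_axioms T = (\<Union>R\<in>preds T. \<Union>m k.
     let ps = pred_args T R; ss = shift_args m ps; l = length ss;
         D = Var l (Ctx, k); as = var_list (Suc l) m (Tm, k)
     in {(ctxvars (ss @ (Ctx, k) # replicate m (Tm, k)),
          Rel (R, m) (varterms ss) # ctx_map k m D (Var 0 (Ctx, m)) as,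
          [Rel (R, k) (D # map2 (\<lambda>(p, n) x. ext_subst p k m n D x as) ps (arg_vars m ps))])})"

definition phl_of :: "('f, 'r, 'z) adtt_scheme \<Rightarrow> ('f, 'r) sphl" where
  "phl_of T = \<lparr>
     fsyms = sym_set T,
     far = sym_args T,
     fres = sym_res T,
     psyms = {(R, m) | R m. R \<in> preds T},
     par = (\<lambda>(R, m). shift_args m (pred_args T R)),
     axioms = subst_axioms \<union> op_context_axioms T \<union> pred_context_axioms T \<union>
       op_subst_axioms T \<union> pred_subst_axioms T \<union> extra_axioms T\<rparr>"


subsection \<open>Morphisms of theories\<close>

text \<open>
  \<open>lift_tm m\<close> raises the index of all symbols of a term by \<open>m\<close>: the variables acquire sorts over
  a context of length \<open>m\<close>, namely the variable 0, which replaces the empty context, and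
  substitutions act as the identity on that context.
\<close>

fun lift_app :: "nat \<Rightarrow> 'f fsym \<Rightarrow> 'f stm list \<Rightarrow> 'f stm" where
  "lift_app m One ts = Var 0 (Ctx, m)"
| "lift_app m (Ft n) ts = App (Ft (m + n)) ts"
| "lift_app m (TyOf n) ts = App (TyOf (m + n)) ts"
| "lift_app m (Vr n i) ts = App (Vr (m + n) i) ts"
| "lift_app m (Subst p n k) ts =
     App (Subst p (m + n) (m + k)) (take 2 ts @ vars_down (m + n) n (hd ts) @ drop 2 ts)"
| "lift_app m (Op f j) ts = App (Op f (m + j)) ts"

primrec lift_tm :: "nat \<Rightarrow> 'f stm \<Rightarrow> 'f stm" where
  "lift_tm m (Var i s) = Var i (fst s, m + snd s)"
| "lift_tm m (App f ts) = lift_app m f (map (lift_tm m) ts)"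

fun lift_atom :: "nat \<Rightarrow> ('f fsym, 'r psym, sort) atom \<Rightarrow> ('f fsym, 'r psym, sort) atom" where
  "lift_atom m (Eq t u) = Eq (lift_tm m t) (lift_tm m u)"
| "lift_atom m (Rel R ts) = Rel (fst R, m + snd R) (map (lift_tm m) ts)"

definition adtt_morphism ::
  "('f, 'r, 'y) adtt_scheme \<Rightarrow> ('g, 'q, 'z) adtt_scheme \<Rightarrow> ('f, 'r, 'g, 'q) mor \<Rightarrow> bool" where
  "adtt_morphism S T F \<longleftrightarrow>
     phl_morphism (phl_of S) (phl_of T) F \<and>
     fmap F One = (App One [], []) \<and>
     (\<forall>n. fmap F (Ft n) = (App (Ft n) (varterms (sym_args S (Ft n))), [])) \<and>
     (\<forall>n. fmap F (TyOf n) = (App (TyOf n) (varterms (sym_args S (TyOf n))), [])) \<and>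
     (\<forall>n i. fmap F (Vr n i) = (App (Vr n i) (varterms (sym_args S (Vr n i))), [])) \<and>
     (\<forall>p n k. fmap F (Subst p n k) =
        (App (Subst p n k) (varterms (sym_args S (Subst p n k))), [])) \<and>
     (\<forall>f\<in>ops S. \<forall>m. rtrm_eq (phl_of T) (shift_args m (op_args S f))
        (fmap F (Op f m))
        (lift_tm m (fst (fmap F (Op f 0))),
         args_over m (op_args S f) @ map (lift_atom m) (snd (fmap F (Op f 0))))) \<and>
     (\<forall>R\<in>preds S. \<forall>m. horn_eq (phl_of T) (shift_args m (pred_args S R))
        (pmap F (R, m))
        (args_over m (pred_args S R) @ map (lift_atom m) (pmap F (R, 0))))"


subsection \<open>Theories under \<open>Id\<^sub>0\<close>\<close>

text \<open>There are no predicate symbols; the type \<open>unit\<close> of their names is a dummy.\<close>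

definition Id0 :: "(unit, unit) adtt" where
  "Id0 = \<lparr>
     ops = {()}, op_args = (\<lambda>_. [(TM, 0), (TM, 0)]), op_res = (\<lambda>_. (TY, 0)),
     preds = {}, pred_args = (\<lambda>_. []),
     extra_axioms = {(ctxvars [(Ctx, m), (Tm, m), (Tm, m)],
        [defd (App (Op () m) [Var 0 (Ctx, m), Var 1 (Tm, m), Var 2 (Tm, m)])],
        [Eq (App (TyOf m) [Var 1 (Tm, m)]) (App (TyOf m) [Var 2 (Tm, m)])]) | m. True}\<rparr>"

record ('f, 'r) id_theory = "('f, 'r) adtt" +
  id_mor :: "(unit, unit, 'f, 'r) mor"

definition is_theory :: "('f, 'r) id_theory \<Rightarrow> bool" where
  "is_theory T \<longleftrightarrow>
     (\<forall>(V, \<phi>, \<psi>)\<in>extra_axioms T.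
        finite V \<and> wf_horn (phl_of T) V \<phi> \<and> wf_horn (phl_of T) V \<psi>) \<and>
     adtt_morphism Id0 T (id_mor T)"

definition theory_morphism ::
  "('f, 'r) id_theory \<Rightarrow> ('g, 'q) id_theory \<Rightarrow> ('f, 'r, 'g, 'q) mor \<Rightarrow> bool" where
  "theory_morphism S T F \<longleftrightarrow>
     adtt_morphism S T F \<and>
     (\<forall>m. rtrm_eq (phl_of T) [(Ctx, m), (Tm, m), (Tm, m)]
        (tr_rtrm F (fmap (id_mor S) (Op () m))) (fmap (id_mor T) (Op () m)))"


section \<open>The category of models\<close>

type_synonym ('f, 'r, 'u) model_arrow =
  "('f, 'r, 'u) smodel \<times> (sort \<Rightarrow> 'u \<Rightarrow> 'u) \<times> ('f, 'r, 'u) smodel"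

text \<open>The category of models whose carriers are subsets of the type \<open>'u\<close>.\<close>

definition Mod :: "('f, 'r) id_theory \<Rightarrow> (('f, 'r, 'u) smodel, ('f, 'r, 'u) model_arrow) category" where
  "Mod T = \<lparr>
     Obj = {M. is_model (phl_of T) M},
     Arr = {(M, h, N). is_model (phl_of T) M \<and> is_model (phl_of T) N \<and> is_hom (phl_of T) M N h},
     Dom = (\<lambda>(M, h, N). M),
     Cod = (\<lambda>(M, h, N). N),
     Ident = (\<lambda>M. (M, \<lambda>s a. if a \<in> car M s then a else undefined, M)),
     Comp = (\<lambda>(M', g, N) (M, h, N').
       (M, \<lambda>s a. if a \<in> car M s then g s (h s a) else undefined, N))\<rparr>"

text \<open>The free models on finitely many generators exist, and left adjoints of reduct functors
  exist, if \<open>'u\<close> is infinite and not smaller than the set of basic function symbols.\<close>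

definition small_theory :: "'u itself \<Rightarrow> ('f, 'r) id_theory \<Rightarrow> bool" where
  "small_theory _ T \<longleftrightarrow> infinite (UNIV :: 'u set) \<and> (\<exists>g :: 'f \<Rightarrow> 'u. inj_on g (ops T))"

text \<open>
  \<open>free_model T ss S M xs\<close>: the tuple \<open>xs\<close> of elements of sorts \<open>ss\<close> is the universal one that
  satisfies the relations \<open>S\<close>, that is, \<open>M\<close> is the free model on generators of sorts \<open>ss\<close>
  subject to \<open>S\<close>.
\<close>

definition free_model ::
  "('f, 'r) id_theory \<Rightarrow> sort list \<Rightarrow> (('f, 'r, 'u) smodel \<Rightarrow> 'u list \<Rightarrow> bool) \<Rightarrow>
   ('f, 'r, 'u) smodel \<Rightarrow> 'u list \<Rightarrow> bool" where
  "free_model T ss S M xs \<longleftrightarrow>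
     M \<in> Obj (Mod T) \<and> elems M ss xs \<and> S M xs \<and>
     (\<forall>N ys. N \<in> Obj (Mod T) \<longrightarrow> elems N ss ys \<longrightarrow> S N ys \<longrightarrow>
        (\<exists>!h. is_hom (phl_of T) M N h \<and> map2 h ss xs = ys))"


subsection \<open>Relative homotopies\<close>

text \<open>In a model, \<open>Ft\<close>, \<open>TyOf\<close> and \<open>Vr\<close> are total; substitution and identity types are partial.\<close>

definition ft_of :: "('f, 'r, 'u) smodel \<Rightarrow> nat \<Rightarrow> 'u \<Rightarrow> 'u" where
  "ft_of M n A = the (fn M (Ft n) [A])"

definition ty_of :: "('f, 'r, 'u) smodel \<Rightarrow> nat \<Rightarrow> 'u \<Rightarrow> 'u" where
  "ty_of M n a = the (fn M (TyOf n) [a])"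

definition vr_of :: "('f, 'r, 'u) smodel \<Rightarrow> nat \<Rightarrow> nat \<Rightarrow> 'u \<Rightarrow> 'u" where
  "vr_of M n i G = the (fn M (Vr n i) [G])"

definition id_of :: "('f, 'r) id_theory \<Rightarrow> ('f, 'r, 'u) smodel \<Rightarrow> nat \<Rightarrow> 'u \<Rightarrow> 'u \<Rightarrow> 'u option" where
  "id_of T M n a b =
     fn (reduct (phl_of Id0) (id_mor T) M) (Op () n) [ft_of M n (ty_of M n a), a, b]"

text \<open>
  For types \<open>A\<close>, \<open>A'\<close> over the same context of length \<open>n\<close>, \<open>wk M n A A'\<close> is \<open>A'\<close> weakened to the
  context \<open>A\<close>, and \<open>inst M n A g f\<close> is the substitution of \<open>f\<close>, a term in the context \<open>A\<close>, for the
  last variable of \<open>g\<close>, a term in the context \<open>A'\<close>.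
\<close>

definition wk :: "('f, 'r, 'u) smodel \<Rightarrow> nat \<Rightarrow> 'u \<Rightarrow> 'u \<Rightarrow> 'u option" where
  "wk M n A A' =
     fn M (Subst TY (Suc n) n) (A # A' # map (\<lambda>i. vr_of M (Suc n) i A) (rev [1..<Suc n]))"

definition inst :: "('f, 'r, 'u) smodel \<Rightarrow> nat \<Rightarrow> 'u \<Rightarrow> 'u \<Rightarrow> 'u \<Rightarrow> 'u option" where
  "inst M n A g f =
     fn M (Subst TM (Suc n) (Suc n))
       (A # g # map (\<lambda>i. vr_of M (Suc n) i A) (rev [1..<Suc n]) @ [f])"

text \<open>\<open>A \<turnstile> b : B\<close> for a term \<open>b\<close> in a context of length \<open>n\<close> and a possibly undefined \<open>B\<close>.\<close>

definition typed :: "('f, 'r, 'u) smodel \<Rightarrow> nat \<Rightarrow> 'u \<Rightarrow> 'u \<Rightarrow> 'u option \<Rightarrow> bool" where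
  "typed M n G b B \<longleftrightarrow> (\<exists>C. B = Some C \<and> ft_of M n C = G \<and> ty_of M n b = C)"

definition tm_homotopy :: "('f, 'r) id_theory \<Rightarrow> ('f, 'r, 'u) smodel \<Rightarrow> nat \<Rightarrow> 'u \<Rightarrow> 'u \<Rightarrow> 'u \<Rightarrow> bool"
where
  "tm_homotopy T M n a a' h \<longleftrightarrow> id_of T M n a a' = Some (ty_of M n h)"

definition ty_homotopy ::
  "('f, 'r) id_theory \<Rightarrow> ('f, 'r, 'u) smodel \<Rightarrow> nat \<Rightarrow> 'u \<Rightarrow> 'u \<Rightarrow> 'u \<Rightarrow> 'u \<Rightarrow> 'u \<Rightarrow> 'u \<Rightarrow> 'u \<Rightarrow> bool"
where
  "ty_homotopy T M n A A' f g p g' p' \<longleftrightarrow>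
     ft_of M n A = ft_of M n A' \<and>
     typed M (Suc n) A f (wk M n A A') \<and>
     typed M (Suc n) A' g (wk M n A' A) \<and>
     (\<exists>gf. inst M n A g f = Some gf \<and>
        typed M (Suc n) A p (id_of T M (Suc n) gf (vr_of M (Suc n) 0 A))) \<and>
     typed M (Suc n) A' g' (wk M n A' A) \<and>
     (\<exists>fg'. inst M n A' f g' = Some fg' \<and>
        typed M (Suc n) A' p' (id_of T M (Suc n) fg' (vr_of M (Suc n) 0 A')))"

fun htpy_sorts :: "pk \<Rightarrow> nat \<Rightarrow> sort list" where
  "htpy_sorts TM n = [(Tm, n)]"
| "htpy_sorts TY n = replicate 5 (Tm, Suc n)"

fun is_homotopy ::
  "('f, 'r) id_theory \<Rightarrow> ('f, 'r, 'u) smodel \<Rightarrow> pk \<Rightarrow> nat \<Rightarrow> 'u \<Rightarrow> 'u \<Rightarrow> 'u list \<Rightarrow> bool" where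
  "is_homotopy T M TM n a a' hs \<longleftrightarrow> (\<exists>h. hs = [h] \<and> tm_homotopy T M n a a' h)"
| "is_homotopy T M TY n A A' hs \<longleftrightarrow>
     (\<exists>f g p g' p'. hs = [f, g, p, g', p'] \<and> ty_homotopy T M n A A' f g p g' p')"

definition homotopic ::
  "('f, 'r) id_theory \<Rightarrow> ('f, 'r, 'u) smodel \<Rightarrow> pk \<Rightarrow> nat \<Rightarrow> 'u \<Rightarrow> 'u \<Rightarrow> bool" where
  "homotopic T M p n a a' \<longleftrightarrow> (\<exists>hs. elems M (htpy_sorts p n) hs \<and> is_homotopy T M p n a a' hs)"


subsection \<open>Weak equivalences, cofibrations and fibrations\<close>

fun dsort :: "pk \<Rightarrow> nat \<Rightarrow> sort" where
  "dsort TY n = (Ctx, n)"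
| "dsort TM n = (Ctx, Suc n)"

fun bd :: "('f, 'r, 'u) smodel \<Rightarrow> pk \<Rightarrow> nat \<Rightarrow> 'u \<Rightarrow> 'u" where
  "bd M TY n a = ft_of M n a"
| "bd M TM n a = ty_of M n a"

definition weqs :: "('f, 'r) id_theory \<Rightarrow> ('f, 'r, 'u) model_arrow set" where
  "weqs T = {(X, f, Y) \<in> Arr (Mod T).
     \<forall>p n. \<forall>A\<in>car X (dsort p n). \<forall>a\<in>car Y (psort p n). bd Y p n a = f (dsort p n) A \<longrightarrow>
       (\<exists>a'\<in>car X (psort p n). bd X p n a' = A \<and> homotopic T Y p n (f (psort p n) a') a)}"

definition gen_cofs :: "('f, 'r) id_theory \<Rightarrow> ('f, 'r, 'u) model_arrow set" where
  "gen_cofs T = {(P, i, Q) \<in> Arr (Mod T). \<exists>p n A A' a.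
     free_model T [dsort p n] (\<lambda>M xs. True) P [A] \<and>
     free_model T [dsort p n, psort p n] (\<lambda>M xs. bd M p n (xs ! 1) = xs ! 0) Q [A', a] \<and>
     i (dsort p n) A = A'}"

text \<open>
  The generating trivial cofibrations are the inclusions of the free model on one element \<open>a\<close> into
  the free model on a relative homotopy with source \<open>a\<close>.
\<close>

definition gen_triv_cofs :: "('f, 'r) id_theory \<Rightarrow> ('f, 'r, 'u) model_arrow set" where
  "gen_triv_cofs T = {(P, i, Q) \<in> Arr (Mod T). \<exists>p n a b b' hs.
     free_model T [psort p n] (\<lambda>M xs. True) P [a] \<and>
     free_model T (psort p n # psort p n # htpy_sorts p n)
       (\<lambda>M xs. is_homotopy T M p n (xs ! 0) (xs ! 1) (drop 2 xs)) Q (b # b' # hs) \<and>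
     i (psort p n) a = b}"

definition cofs :: "('f, 'r) id_theory \<Rightarrow> ('f, 'r, 'u) model_arrow set" where
  "cofs T = llp (Mod T) (rlp (Mod T) (gen_cofs T))"

text \<open>
  The cofibrations and weak equivalences do not determine the fibrations of a left semi-model
  structure; they are understood to be the maps with the right lifting property against the
  generating trivial cofibrations, which the notion of a Quillen adjunction refers to.
\<close>

definition fibs :: "('f, 'r) id_theory \<Rightarrow> ('f, 'r, 'u) model_arrow set" where
  "fibs T = rlp (Mod T) (gen_triv_cofs T)"

definition semi_model :: "'u itself \<Rightarrow> ('f, 'r) id_theory \<Rightarrow> bool" where
  "semi_model _ T \<longleftrightarrow>
     left_semi_model_structure (Mod T) (cofs T) (weqs T)
       (fibs T :: ('f, 'r, 'u) model_arrow set)"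


section \<open>The adjunction induced by a morphism of theories\<close>

definition pull_obj ::
  "('f, 'r) id_theory \<Rightarrow> ('f, 'r, 'g, 'q) mor \<Rightarrow> ('g, 'q, 'u) smodel \<Rightarrow> ('f, 'r, 'u) smodel" where
  "pull_obj T1 F M = reduct (phl_of T1) F M"

definition pull_arr ::
  "('f, 'r) id_theory \<Rightarrow> ('f, 'r, 'g, 'q) mor \<Rightarrow> ('g, 'q, 'u) model_arrow \<Rightarrow> ('f, 'r, 'u) model_arrow"
where
  "pull_arr T1 F = (\<lambda>(M, h, N). (pull_obj T1 F M, h, pull_obj T1 F N))"

definition is_unit ::
  "('f, 'r) id_theory \<Rightarrow> ('g, 'q) id_theory \<Rightarrow> ('f, 'r, 'g, 'q) mor \<Rightarrow>
   ('f, 'r, 'u) smodel \<Rightarrow> ('g, 'q, 'u) smodel \<Rightarrow> ('f, 'r, 'u) model_arrow \<Rightarrow> bool" where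
  "is_unit T1 T2 F = universal_arrow (Mod T1) (Mod T2) (pull_obj T1 F) (pull_arr T1 F)"

definition push_unit ::
  "('f, 'r) id_theory \<Rightarrow> ('g, 'q) id_theory \<Rightarrow> ('f, 'r, 'g, 'q) mor \<Rightarrow>
   ('f, 'r, 'u) smodel \<Rightarrow> ('g, 'q, 'u) smodel \<times> ('f, 'r, 'u) model_arrow" where
  "push_unit T1 T2 F X = (SOME (Z, e). is_unit T1 T2 F X Z e)"

definition push_obj where "push_obj T1 T2 F X = fst (push_unit T1 T2 F X)"

definition unit_arr where "unit_arr T1 T2 F X = snd (push_unit T1 T2 F X)"

definition adjunct ::
  "('f, 'r) id_theory \<Rightarrow> ('g, 'q) id_theory \<Rightarrow> ('f, 'r, 'g, 'q) mor \<Rightarrow>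
   ('f, 'r, 'u) smodel \<Rightarrow> ('g, 'q, 'u) model_arrow \<Rightarrow> ('f, 'r, 'u) model_arrow" where
  "adjunct T1 T2 F X k = Comp (Mod T1) (pull_arr T1 F k) (unit_arr T1 T2 F X)"

definition push_arr ::
  "('f, 'r) id_theory \<Rightarrow> ('g, 'q) id_theory \<Rightarrow> ('f, 'r, 'g, 'q) mor \<Rightarrow>
   ('f, 'r, 'u) model_arrow \<Rightarrow> ('g, 'q, 'u) model_arrow" where
  "push_arr T1 T2 F h =
     (let X = Dom (Mod T1) h; Y = Cod (Mod T1) h in
      THE k. k \<in> Hom (Mod T2) (push_obj T1 T2 F X) (push_obj T1 T2 F Y) \<and>
             adjunct T1 T2 F X k = Comp (Mod T1) (unit_arr T1 T2 F Y) h)"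

definition is_adjunction ::
  "'u itself \<Rightarrow> ('f, 'r) id_theory \<Rightarrow> ('g, 'q) id_theory \<Rightarrow> ('f, 'r, 'g, 'q) mor \<Rightarrow> bool" where
  "is_adjunction _ T1 T2 F \<longleftrightarrow>
     (\<forall>M\<in>Obj (Mod T2). pull_obj T1 F (M :: ('g, 'q, 'u) smodel) \<in> Obj (Mod T1)) \<and>
     (\<forall>k\<in>Arr (Mod T2). pull_arr T1 F (k :: ('g, 'q, 'u) model_arrow) \<in> Arr (Mod T1)) \<and>
     (\<forall>X\<in>Obj (Mod T1). is_unit T1 T2 F (X :: ('f, 'r, 'u) smodel)
        (push_obj T1 T2 F X) (unit_arr T1 T2 F X))"

definition quillen_adjunction ::
  "'u itself \<Rightarrow> ('f, 'r) id_theory \<Rightarrow> ('g, 'q) id_theory \<Rightarrow> ('f, 'r, 'g, 'q) mor \<Rightarrow> bool" where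
  "quillen_adjunction U T1 T2 F \<longleftrightarrow>
     is_adjunction U T1 T2 F \<and>
     (\<forall>i\<in>gen_cofs T1. push_arr T1 T2 F (i :: ('f, 'r, 'u) model_arrow) \<in> cofs T2) \<and>
     (\<forall>j\<in>gen_triv_cofs T1.
        push_arr T1 T2 F (j :: ('f, 'r, 'u) model_arrow) \<in> cofs T2 \<inter> weqs T2)"

definition quillen_equivalence ::
  "'u itself \<Rightarrow> ('f, 'r) id_theory \<Rightarrow> ('g, 'q) id_theory \<Rightarrow> ('f, 'r, 'g, 'q) mor \<Rightarrow> bool" where
  "quillen_equivalence U T1 T2 F \<longleftrightarrow>
     quillen_adjunction U T1 T2 F \<and>
     (\<forall>X Y. cofibrant (Mod T1) (cofs T1) (X :: ('f, 'r, 'u) smodel) \<longrightarrow>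
            fibrant (Mod T2) (fibs T2) Y \<longrightarrow>
        (\<forall>k\<in>Hom (Mod T2) (push_obj T1 T2 F X) Y.
           k \<in> weqs T2 \<longleftrightarrow> adjunct T1 T2 F X k \<in> weqs T1))"

definition morita_equivalence ::
  "'u itself \<Rightarrow> ('f, 'r) id_theory \<Rightarrow> ('g, 'q) id_theory \<Rightarrow> ('f, 'r, 'g, 'q) mor \<Rightarrow> bool" where
  "morita_equivalence _ T1 T2 F \<longleftrightarrow>
     (\<forall>X. cofibrant (Mod T1) (cofs T1) (X :: ('f, 'r, 'u) smodel) \<longrightarrow>
        unit_arr T1 T2 F X \<in> weqs T1)"

end

theory Submission
  imports Defs
begin

text \<open>
  The reduct functor \<open>f\<^sup>*\<close> changes neither the carriers nor the operations of the theory of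
  substitutions nor the identity types, so it preserves and reflects weak equivalences. Its left
  adjoint sends a free model to the free model on the same generators and relations, hence
  generating (trivial) cofibrations to generating (trivial) cofibrations. The generating trivial
  cofibrations of a semi-model theory are trivial cofibrations by the retract argument, because
  the free model on one type or term is cofibrant: trivial fibrations are surjective, by
  induction on the length of the context.

  The adjunct of \<open>k : f\<^sub>!(X) \<rightarrow> Y\<close> is \<open>f\<^sup>*(k) \<circ> \<eta>\<^sub>X\<close>. By 2-out-of-3, if \<open>\<eta>\<^sub>X\<close> is a weak equivalence, then
  \<open>k\<close> is one iff its adjunct is; conversely, \<open>\<eta>\<^sub>X\<close> is a weak equivalence if the adjunct of a
  fibrant replacement of \<open>f\<^sub>!(X)\<close> is.
\<close>

section \<open>Semantics of partial Horn logic\<close>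

text \<open>All models have their carriers in one fixed type \<open>'u\<close>, so free models and
  the values of the left adjoint must be constructed inside that type. Their terms are therefore
  coded by elements of \<open>'u\<close>; this is where the cardinality bound of
  \<open>small_theory\<close> comes from. Terms are identified when they agree in all models of a
  suitable class, not when they are provably equal. Derivations enter only through soundness, which
  transfers translated axioms and provably equal restricted terms to models. The left adjoint is
  picked by choice, so everything about it is deduced from the universal property of the unit. It
  matters here that the generating sets contain every arrow with the right universal property, not
  one representative of each. In a left semi-model structure the factorization into a trivial
  cofibration and a fibration is available for cofibrant domains only. This forces two cofibrancy
  proofs: for the domains of the generating trivial cofibrations, and for \<open>f_!(X)\<close>,
  whose fibrant replacement is taken.\<close>

lemma those_eq_Some_iff: "those ys = Some xs \<longleftrightarrow> ys = map Some xs"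
  by (induction ys arbitrary: xs) (auto split: option.splits)

lemma map_eq_map_Some_D:
  assumes "map g ts = map Some xs" "t \<in> set ts"
  shows "\<exists>x. g t = Some x"
proof -
  have "g t \<in> set (map Some xs)" using assms by (metis image_eqI list.set_map)
  then show ?thesis by auto
qed

lemma has_sort_Var [simp]: "has_sort T V (Var i s) s' \<longleftrightarrow> s' = s \<and> (i, s) \<in> V"
  by (auto intro: has_sort.intros elim: has_sort.cases)

lemma has_sort_App [simp]:
  "has_sort T V (App f ts) s \<longleftrightarrow>
     f \<in> fsyms T \<and> list_all2 (has_sort T V) ts (far T f) \<and> s = fres T f"
  by (auto intro: has_sort.intros elim: has_sort.cases)

lemma tm_val_App_eq_Some_iff:
  "tm_val M v (App f ts) = Some y \<longleftrightarrow> (\<exists>xs. map (tm_val M v) ts = map Some xs \<and> fn M f xs = Some y)"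
  by (auto simp: those_eq_Some_iff[symmetric] split: option.splits)

lemma sat_Eq_iff:
  "sat M v (Eq t u) \<longleftrightarrow> (\<exists>x. tm_val M v t = Some x \<and> tm_val M v u = Some x)"
  by (cases "tm_val M v t") auto

lemma sat_Rel_iff:
  "sat M v (Rel R ts) \<longleftrightarrow> (\<exists>xs. map (tm_val M v) ts = map Some xs \<and> rl M R xs)"
  by (simp add: those_eq_Some_iff)

lemma sat_horn_simps [simp]:
  "sat_horn M v []"
  "sat_horn M v (a # \<phi>) \<longleftrightarrow> sat M v a \<and> sat_horn M v \<phi>"
  "sat_horn M v (\<phi> @ \<psi>) \<longleftrightarrow> sat_horn M v \<phi> \<and> sat_horn M v \<psi>"
  "sat_horn M v (concat \<Phi>) \<longleftrightarrow> (\<forall>\<phi>\<in>set \<Phi>. sat_horn M v \<phi>)"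
  by (auto simp: sat_horn_def)

lemma wf_horn_simps [simp]:
  "wf_horn T V []"
  "wf_horn T V (a # \<phi>) \<longleftrightarrow> wf_atom T V a \<and> wf_horn T V \<phi>"
  "wf_horn T V (\<phi> @ \<psi>) \<longleftrightarrow> wf_horn T V \<phi> \<and> wf_horn T V \<psi>"
  "wf_horn T V (concat \<Phi>) \<longleftrightarrow> (\<forall>\<phi>\<in>set \<Phi>. wf_horn T V \<phi>)"
  by (auto simp: wf_horn_def)

definition valuation :: "('f, 'r, 's, 'u) model \<Rightarrow> (nat \<times> 's) set \<Rightarrow> (nat \<Rightarrow> 's \<Rightarrow> 'u) \<Rightarrow> bool" where
  "valuation M V v \<longleftrightarrow> (\<forall>(i, s)\<in>V. v i s \<in> car M s)"

text \<open>Raw theories put no sorting condition on their axioms. Substitution is controlled only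
  for terms whose variables lie in the context, so soundness of the axiom rule relies on this
  condition.\<close>

definition wf_phl :: "('f, 'r, 's) phl \<Rightarrow> bool" where
  "wf_phl T \<longleftrightarrow> (\<forall>(V, \<phi>, \<psi>)\<in>axioms T. wf_horn T V \<phi> \<and> wf_horn T V \<psi>)"

lemma is_model_fnD:
  "is_model T M \<Longrightarrow> fn M f xs = Some y \<Longrightarrow> f \<in> fsyms T \<and> elems M (far T f) xs \<and> y \<in> car M (fres T f)"
  unfolding is_model_def by blast

lemma is_model_rlD:
  "is_model T M \<Longrightarrow> rl M R xs \<Longrightarrow> R \<in> psyms T \<and> elems M (par T R) xs"
  unfolding is_model_def by blast

lemma is_model_axiomD:
  "is_model T M \<Longrightarrow> (V, \<phi>, \<psi>) \<in> axioms T \<Longrightarrow> valuation M V v \<Longrightarrow> sat_horn M v \<phi> \<Longrightarrow> sat_horn M v \<psi>"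
  unfolding is_model_def valuation_def by blast

lemma elems_length: "elems M ss xs \<Longrightarrow> length xs = length ss"
  unfolding elems_def by (auto dest: list_all2_lengthD)

lemma elems_nth: "elems M ss xs \<Longrightarrow> i < length ss \<Longrightarrow> xs ! i \<in> car M (ss ! i)"
  unfolding elems_def by (auto dest: list_all2_nthD)

lemma elems_simps [simp]:
  "elems M [] xs \<longleftrightarrow> xs = []"
  "elems M (s # ss) xs \<longleftrightarrow> (\<exists>y ys. xs = y # ys \<and> y \<in> car M s \<and> elems M ss ys)"
  "elems M ss [] \<longleftrightarrow> ss = []"
  by (auto simp: elems_def list_all2_Cons1)

lemma valuation_nth: "elems M ss xs \<Longrightarrow> valuation M (ctxvars ss) (\<lambda>i s. xs ! i)"
  by (auto simp: valuation_def ctxvars_def elems_nth)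

text \<open>No induction is involved: an application takes its value in the result carrier by the
  model condition on operations, whatever its arguments are.\<close>

lemma tm_val_in_car:
  assumes "is_model T M" "valuation M V v" "has_sort T V t s" "tm_val M v t = Some x"
  shows "x \<in> car M s"
proof (cases t)
  case (Var i s')
  then show ?thesis using assms by (auto simp: valuation_def)
next
  case (App f ts)
  then show ?thesis using assms
    by (metis has_sort_App is_model_fnD tm_val_App_eq_Some_iff)
qed

lemma list_all2_has_sort_D:
  "list_all2 (has_sort T V) ts ss \<Longrightarrow> t \<in> set ts \<Longrightarrow> \<exists>s. has_sort T V t s"
  by (auto simp: list_all2_conv_all_nth in_set_conv_nth)

lemma tm_val_sub:
  assumes "\<forall>i s. (i, s) \<in> V \<longrightarrow> tm_val M v (\<theta> i s) = Some (w i s)" "has_sort T V t s"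
  shows "tm_val M v (sub \<theta> t) = tm_val M w t"
  using assms(2)
proof (induction t arbitrary: s)
  case (Var i s')
  then show ?case using assms(1) by simp
next
  case (App f ts)
  have "map (tm_val M v) (map (sub \<theta>) ts) = map (tm_val M w) ts"
    using App list_all2_has_sort_D[of T V ts "far T f"] by fastforce
  then show ?case by (simp del: map_map)
qed

lemma tm_val_map_sub:
  assumes "\<forall>i s. (i, s) \<in> V \<longrightarrow> tm_val M v (\<theta> i s) = Some (w i s)"
    "list_all2 (has_sort T V) ts ss"
  shows "map (tm_val M v) (map (sub \<theta>) ts) = map (tm_val M w) ts"
proof -
  have "tm_val M v (sub \<theta> t) = tm_val M w t" if "t \<in> set ts" for t
    using list_all2_has_sort_D[OF assms(2) that] tm_val_sub[OF assms(1)] by blast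
  then show ?thesis by simp
qed

lemma sat_sub:
  assumes "\<forall>i s. (i, s) \<in> V \<longrightarrow> tm_val M v (\<theta> i s) = Some (w i s)" "wf_atom T V a"
  shows "sat M v (sub_atom \<theta> a) \<longleftrightarrow> sat M w a"
proof (cases a)
  case (Eq t u)
  then obtain s where "has_sort T V t s" "has_sort T V u s" using assms(2) by auto
  then have "tm_val M v (sub \<theta> t) = tm_val M w t" "tm_val M v (sub \<theta> u) = tm_val M w u"
    by (simp_all add: tm_val_sub[OF assms(1)])
  then show ?thesis by (simp add: Eq)
next
  case (Rel R ts)
  then have "map (tm_val M v) (map (sub \<theta>) ts) = map (tm_val M w) ts"
    using assms(2) by (auto intro!: tm_val_map_sub[OF assms(1)] simp del: map_map)
  then show ?thesis by (simp add: Rel del: map_map)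
qed

lemma sat_horn_sub:
  assumes "\<forall>i s. (i, s) \<in> V \<longrightarrow> tm_val M v (\<theta> i s) = Some (w i s)" "wf_horn T V \<phi>"
  shows "sat_horn M v (map (sub_atom \<theta>) \<phi>) \<longleftrightarrow> sat_horn M w \<phi>"
  using sat_sub[OF assms(1)] assms(2) by (auto simp: sat_horn_def wf_horn_def)

lemma list_all2_tm_val_eq:
  assumes "list_all2 (\<lambda>t u. P t u \<and> sat M v (Eq t u)) ts us"
  shows "map (tm_val M v) ts = map (tm_val M v) us"
  using assms by (induction rule: list_all2_induct) auto

lemma derives_sound:
  assumes "wf_phl T" "is_model T M" "valuation M V v" "sat_horn M v \<phi>" "derives T V \<phi> a"
  shows "sat M v a"
  using assms(5)
proof (induction rule: derives.induct)
  case (hyp a)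
  then show ?case using assms(4) by (auto simp: sat_horn_def)
next
  case (fun_strict f ts t)
  then obtain y where "tm_val M v (App f ts) = Some y" by (auto simp del: tm_val.simps)
  with fun_strict(2) show ?case
    unfolding tm_val_App_eq_Some_iff by (auto dest: map_eq_map_Some_D)
next
  case (rel_strict R ts t)
  then show ?case unfolding sat_Rel_iff by (auto dest: map_eq_map_Some_D)
next
  case (fun_cong f ts us)
  have "map (tm_val M v) ts = map (tm_val M v) us"
    by (rule list_all2_tm_val_eq[OF fun_cong.IH(2)])
  then show ?case using fun_cong.IH(1) by simp
next
  case (rel_cong R ts us)
  have "map (tm_val M v) ts = map (tm_val M v) us"
    by (rule list_all2_tm_val_eq[OF rel_cong.IH(2)])
  then show ?case using rel_cong.IH(1) by simp
next
  case (axiom W \<psi> \<chi> \<theta> b)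
  \<comment> \<open>The axiom is evaluated at the values of the substituted terms. The axiom rule
    substitutes defined terms only, so \<open>the\<close> can meet \<open>None\<close> only outside
    \<open>W\<close>, where the well-sorted axiom has no variables.\<close>
  define w where "w i s = the (tm_val M v (\<theta> i s))" for i s
  have w: "\<forall>i s. (i, s) \<in> W \<longrightarrow> tm_val M v (\<theta> i s) = Some (w i s)"
    using axiom.IH(1) by (fastforce simp: w_def)
  have wf: "wf_horn T W \<psi>" "wf_horn T W \<chi>"
    using assms(1) axiom.hyps(1) by (auto simp: wf_phl_def)
  have "sat_horn M v (map (sub_atom \<theta>) \<psi>)"
    using axiom.IH(2) by (auto simp: sat_horn_def)
  then have "sat_horn M w \<psi>" using sat_horn_sub[OF w] wf by blast
  moreover have "valuation M W w"
    unfolding valuation_def using axiom.IH(1) w tm_val_in_car[OF assms(2,3)] by blast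
  ultimately have "sat_horn M w \<chi>" using is_model_axiomD[OF assms(2) axiom.hyps(1)] by blast
  then have "sat_horn M v (map (sub_atom \<theta>) \<chi>)" using sat_horn_sub[OF w] wf by blast
  then show ?case using axiom.hyps by (auto simp: sat_horn_def)
next
  case (var i s)
  then show ?case by simp
next
  case (sym t u)
  then show ?case by (metis sat.simps(1))
next
  case (trans t u w)
  then show ?case by (metis sat.simps(1))
qed

lemma entails_sound:
  assumes "wf_phl T" "is_model T M" "valuation M V v" "entails T V \<phi> \<psi>" "sat_horn M v \<phi>"
  shows "sat_horn M v \<psi>"
  using assms derives_sound[of T M V v \<phi>] by (auto simp: entails_def sat_horn_def)

section \<open>Reducts\<close>

definition rtm_val :: "('f, 'r, 's, 'u) model \<Rightarrow> (nat \<Rightarrow> 's \<Rightarrow> 'u) \<Rightarrow> ('f, 'r, 's) rtrm \<Rightarrow> 'u option" where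
  "rtm_val M v r = (if sat_horn M v (snd r) then tm_val M v (fst r) else None)"

lemma fn_reduct:
  "fn (reduct S F M) f xs =
     (if f \<in> fsyms S \<and> elems M (far S f) xs then rtm_val M (\<lambda>i s. xs ! i) (fmap F f) else None)"
  by (simp add: reduct_def rtm_val_def)

lemma rl_reduct:
  "rl (reduct S F M) R xs \<longleftrightarrow>
     R \<in> psyms S \<and> elems M (par S R) xs \<and> sat_horn M (\<lambda>i s. xs ! i) (pmap F R)"
  by (simp add: reduct_def)

lemma car_reduct [simp]: "car (reduct S F M) = car M"
  by (simp add: reduct_def)

lemma elems_reduct [simp]: "elems (reduct S F M) = elems M"
  by (simp add: fun_eq_iff elems_def)

lemma valuation_reduct [simp]: "valuation (reduct S F M) = valuation M"
  by (simp add: fun_eq_iff valuation_def)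

definition wf_interp :: "('f, 'r, 's) phl \<Rightarrow> ('g, 'q, 's) phl \<Rightarrow> ('f, 'r, 'g, 'q, 's) interp \<Rightarrow> bool" where
  "wf_interp S T F \<longleftrightarrow>
     (\<forall>f\<in>fsyms S. wf_rtrm T (far S f) (fres S f) (fmap F f)) \<and>
     (\<forall>R\<in>psyms S. wf_horn T (ctxvars (par S R)) (pmap F R))"

lemma phl_morphism_wf_interp: "phl_morphism S T F \<Longrightarrow> wf_interp S T F"
  by (simp add: phl_morphism_def wf_interp_def)

text \<open>A restricted argument has a value when its restriction holds and its term is defined;
  \<open>arg_conds\<close> lists precisely these two kinds of conditions.\<close>

lemma sat_arg_conds:
  "sat_horn M v (arg_conds rs) \<longleftrightarrow> (\<exists>xs. map (rtm_val M v) rs = map Some xs)"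
proof -
  have "sat_horn M v (arg_conds rs) \<longleftrightarrow> (\<forall>r\<in>set rs. \<exists>x. rtm_val M v r = Some x)"
    by (auto simp: arg_conds_def rtm_val_def) (auto simp: sat_horn_def)
  also have "\<dots> \<longleftrightarrow> (\<exists>xs. map (rtm_val M v) rs = map Some xs)"
    by (simp add: ex_map_conv)
  finally show ?thesis .
qed

lemma tm_val_plug_sub:
  assumes "map (rtm_val M v) rs = map Some xs" "length xs = length ss"
  shows "\<forall>i s. (i, s) \<in> ctxvars ss \<longrightarrow> tm_val M v (plug_sub (map fst rs) i s) = Some (xs ! i)"
proof (intro allI impI)
  fix i s assume "(i, s) \<in> ctxvars ss"
  have len: "length rs = length xs" using assms(1) by (metis length_map)
  then have i: "i < length rs" using \<open>(i, s) \<in> ctxvars ss\<close> assms by (auto simp: ctxvars_def)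
  then have "rtm_val M v (rs ! i) = Some (xs ! i)" using assms(1) len by (metis nth_map)
  then show "tm_val M v (plug_sub (map fst rs) i s) = Some (xs ! i)"
    using i by (auto simp: plug_sub_def rtm_val_def split: if_splits)
qed

text \<open>\<open>plug\<close> is strict composition of partial functions: an argument that the
  outer term drops must still be defined, which \<open>arg_conds\<close> records and substitution
  alone would lose.\<close>

lemma rtm_val_plug:
  assumes "wf_rtrm T ss s r" "length rs = length ss"
  shows "rtm_val M v (plug r rs) =
    (case those (map (rtm_val M v) rs) of None \<Rightarrow> None | Some xs \<Rightarrow> rtm_val M (\<lambda>i s. xs ! i) r)"
proof (cases "those (map (rtm_val M v) rs)")
  case None
  then have "\<not> sat_horn M v (arg_conds rs)"
    unfolding sat_arg_conds by (auto simp flip: those_eq_Some_iff)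
  then show ?thesis using None by (simp add: plug_def rtm_val_def)
next
  case (Some xs)
  then have xs: "map (rtm_val M v) rs = map Some xs" by (simp add: those_eq_Some_iff)
  then have len: "length xs = length ss" using assms(2) by (metis length_map)
  note plug = tm_val_plug_sub[OF xs len]
  have wf: "has_sort T (ctxvars ss) (fst r) s" "wf_horn T (ctxvars ss) (snd r)"
    using assms(1) by (auto simp: wf_rtrm_def)
  have "sat_horn M v (arg_conds rs)" using xs sat_arg_conds by blast
  moreover have "tm_val M v (sub (plug_sub (map fst rs)) (fst r)) = tm_val M (\<lambda>i s. xs ! i) (fst r)"
    using tm_val_sub[OF plug wf(1)] .
  moreover have "sat_horn M v (map (sub_atom (plug_sub (map fst rs))) (snd r)) \<longleftrightarrow>
      sat_horn M (\<lambda>i s. xs ! i) (snd r)"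
    using sat_horn_sub[OF plug wf(2)] .
  ultimately show ?thesis using Some by (simp add: plug_def rtm_val_def)
qed

text \<open>Both claims share one induction: an operation of the reduct tests whether its arguments
  lie in the carriers, whereas the translated term does not, so the step for the first claim uses
  the second one for the arguments.\<close>

lemma rtm_val_tr_in_car_and_eq:
  assumes "is_model T M" "wf_interp S T F" "valuation M V v" "has_sort S V t s"
  shows "rtm_val M v (tr F t) = tm_val (reduct S F M) v t \<and>
    (\<forall>x. tm_val (reduct S F M) v t = Some x \<longrightarrow> x \<in> car M s)"
  using assms(4)
proof (induction t arbitrary: s)
  case (Var i s')
  then show ?case using assms(3) by (auto simp: rtm_val_def valuation_def)
next
  case (App f ts)
  let ?R = "reduct S F M"
  from App.prems have f: "f \<in> fsyms S" "s = fres S f" and ts: "list_all2 (has_sort S V) ts (far S f)"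
    by auto
  have wf: "wf_rtrm T (far S f) (fres S f) (fmap F f)" using assms(2) f by (auto simp: wf_interp_def)
  have IH: "rtm_val M v (tr F t) = tm_val ?R v t" if "t \<in> set ts" for t
    using App.IH[OF that] list_all2_has_sort_D[OF ts that] by blast
  have eq: "map (rtm_val M v) (map (tr F) ts) = map (tm_val ?R v) ts" using IH by simp
  have el: "elems M (far S f) xs" if "map (tm_val ?R v) ts = map Some xs" for xs
  proof -
    have len: "length xs = length ts" using that by (metis length_map)
    have "xs ! i \<in> car M (far S f ! i)" if i: "i < length ts" for i
    proof -
      have "ts ! i \<in> set ts" "has_sort S V (ts ! i) (far S f ! i)"
        using i ts by (auto dest: list_all2_nthD)
      moreover have "tm_val ?R v (ts ! i) = Some (xs ! i)"
        using \<open>map (tm_val ?R v) ts = map Some xs\<close> len i by (metis nth_map)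
      ultimately show ?thesis using App.IH by blast
    qed
    then show ?thesis using len ts by (auto simp: elems_def list_all2_conv_all_nth)
  qed
  have "rtm_val M v (tr F (App f ts)) =
     (case those (map (tm_val ?R v) ts) of None \<Rightarrow> None | Some xs \<Rightarrow> rtm_val M (\<lambda>i s. xs ! i) (fmap F f))"
    unfolding tr.simps rtm_val_plug[OF wf, of "map (tr F) ts" M v, simplified, OF list_all2_lengthD[OF ts]]
    using eq unfolding map_map by (simp only:)
  also have "\<dots> = tm_val ?R v (App f ts)"
    using f el[unfolded those_eq_Some_iff[symmetric]]
    by (auto simp: fn_reduct split: option.splits)
  finally have 1: "rtm_val M v (tr F (App f ts)) = tm_val ?R v (App f ts)" .
  have "x \<in> car M s" if "tm_val ?R v (App f ts) = Some x" for x
  proof -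
    from that obtain xs where "fn ?R f xs = Some x"
      unfolding tm_val_App_eq_Some_iff by blast
    then have "elems M (far S f) xs" "tm_val M (\<lambda>i s. xs ! i) (fst (fmap F f)) = Some x"
      by (auto simp: fn_reduct rtm_val_def split: if_splits)
    then show ?thesis using tm_val_in_car[OF assms(1) valuation_nth] wf f
      by (auto simp: wf_rtrm_def)
  qed
  with 1 show ?case by blast
qed

lemmas rtm_val_tr = rtm_val_tr_in_car_and_eq[THEN conjunct1]

lemma sat_tr_atom:
  assumes "is_model T M" "wf_interp S T F" "valuation M V v" "wf_atom S V a"
  shows "sat_horn M v (tr_atom F a) \<longleftrightarrow> sat (reduct S F M) v a"
proof (cases a)
  case (Eq t u)
  then obtain s where "has_sort S V t s" "has_sort S V u s" using assms(4) by auto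
  note this[THEN rtm_val_tr[OF assms(1-3)], symmetric]
  then show ?thesis by (auto simp: Eq rtm_val_def)
next
  case (Rel R ts)
  then have R: "R \<in> psyms S" and ts: "list_all2 (has_sort S V) ts (par S R)" using assms(4) by auto
  let ?R = "reduct S F M"
  have "rtm_val M v (tr F t) = tm_val ?R v t" if "t \<in> set ts" for t
    using list_all2_has_sort_D[OF ts that] rtm_val_tr[OF assms(1-3)] by blast
  then have eq: "map (rtm_val M v) (map (tr F) ts) = map (tm_val ?R v) ts" by simp
  have el: "elems M (par S R) xs" if "map (tm_val ?R v) ts = map Some xs" for xs
  proof -
    have len: "length xs = length ts" using that by (metis length_map)
    have "xs ! i \<in> car M (par S R ! i)" if i: "i < length ts" for i
    proof -
      have "has_sort S V (ts ! i) (par S R ! i)"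
        using i ts by (auto dest: list_all2_nthD)
      moreover have "tm_val ?R v (ts ! i) = Some (xs ! i)"
        using \<open>map (tm_val ?R v) ts = map Some xs\<close> len i by (metis nth_map)
      ultimately show ?thesis using rtm_val_tr_in_car_and_eq[OF assms(1-3)] by blast
    qed
    then show ?thesis using len ts by (auto simp: elems_def list_all2_conv_all_nth)
  qed
  have wf: "wf_horn T (ctxvars (par S R)) (pmap F R)" using assms(2) R by (auto simp: wf_interp_def)
  have sub: "sat_horn M v (map (sub_atom (plug_sub (map fst (map (tr F) ts)))) (pmap F R)) \<longleftrightarrow>
      sat_horn M (\<lambda>i s. xs ! i) (pmap F R)" if "map (tm_val ?R v) ts = map Some xs" for xs
    by (rule sat_horn_sub[OF tm_val_plug_sub wf])
      (simp_all only: eq that elems_length[OF el[OF that]])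
  have "sat_horn M v (tr_atom F a) \<longleftrightarrow>
     (\<exists>xs. map (tm_val ?R v) ts = map Some xs \<and> sat_horn M (\<lambda>i s. xs ! i) (pmap F R))"
    using sub unfolding Rel tr_atom.simps sat_horn_simps sat_arg_conds eq by (auto simp: comp_def)
  also have "\<dots> \<longleftrightarrow> sat ?R v a"
    unfolding Rel sat_Rel_iff rl_reduct using R el by blast
  finally show ?thesis .
qed

lemma sat_tr_horn:
  assumes "is_model T M" "wf_interp S T F" "valuation M V v" "wf_horn S V \<phi>"
  shows "sat_horn M v (tr_horn F \<phi>) \<longleftrightarrow> sat_horn (reduct S F M) v \<phi>"
  using assms(4) sat_tr_atom[OF assms(1-3)]
  by (induction \<phi>) (auto simp: tr_horn_def)

lemma rtm_val_tr_rtrm: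
  assumes "is_model T M" "wf_interp S T F" "elems M ss xs" "wf_rtrm S ss s r"
  shows "rtm_val M (\<lambda>i s. xs ! i) (tr_rtrm F r) = rtm_val (reduct S F M) (\<lambda>i s. xs ! i) r"
proof -
  have "has_sort S (ctxvars ss) (fst r) s" "wf_horn S (ctxvars ss) (snd r)"
    using assms(4) by (auto simp: wf_rtrm_def)
  then have "rtm_val M (\<lambda>i s. xs ! i) (tr F (fst r)) = tm_val (reduct S F M) (\<lambda>i s. xs ! i) (fst r)"
    "sat_horn M (\<lambda>i s. xs ! i) (tr_horn F (snd r)) \<longleftrightarrow> sat_horn (reduct S F M) (\<lambda>i s. xs ! i) (snd r)"
    using rtm_val_tr[OF assms(1,2) valuation_nth[OF assms(3)]]
      sat_tr_horn[OF assms(1,2) valuation_nth[OF assms(3)]] by blast+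
  then show ?thesis unfolding rtm_val_def tr_rtrm_def by (simp split: if_splits)
qed

text \<open>If either side has a value, its entailment yields equality of the terms and the
  restriction of the other side; hence the two sides are also undefined together.\<close>

lemma rtm_val_rtrm_eq:
  assumes "wf_phl T" "is_model T M" "elems M ss xs" "rtrm_eq T ss r r'"
  shows "rtm_val M (\<lambda>i s. xs ! i) r = rtm_val M (\<lambda>i s. xs ! i) r'"
proof -
  note sound = entails_sound[OF assms(1,2) valuation_nth[OF assms(3)]]
  show ?thesis
  proof (cases "sat_horn M (\<lambda>i s. xs ! i) (defd (fst r) # snd r)")
    case True
    then have "sat_horn M (\<lambda>i s. xs ! i) (Eq (fst r) (fst r') # snd r')"
      using sound assms(4) unfolding rtrm_eq_def by blast
    with True show ?thesis by (auto simp: rtm_val_def)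
  next
    case False
    then have "\<not> sat_horn M (\<lambda>i s. xs ! i) (defd (fst r') # snd r')"
      using sound[of "defd (fst r') # snd r'" "Eq (fst r) (fst r') # snd r"] assms(4)
      unfolding rtrm_eq_def by auto
    with False show ?thesis by (auto simp: rtm_val_def)
  qed
qed

text \<open>An axiom of \<open>S\<close> translates to a theorem of \<open>T\<close>, which holds in
  \<open>M\<close> by soundness; \<open>sat_tr_horn\<close> reads its premise and conclusion back in
  the reduct.\<close>

lemma reduct_is_model:
  assumes "wf_phl S" "wf_phl T" "phl_morphism S T F" "is_model T M"
  shows "is_model S (reduct S F M)"
  unfolding is_model_def
proof (intro conjI allI impI)
  note wf = phl_morphism_wf_interp[OF assms(3)]
  show "f \<in> fsyms S" "elems (reduct S F M) (far S f) xs" "y \<in> car (reduct S F M) (fres S f)"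
    if "fn (reduct S F M) f xs = Some y" for f xs y
  proof -
    show *: "f \<in> fsyms S" "elems (reduct S F M) (far S f) xs"
      using that by (auto simp: fn_reduct split: if_splits)
    then have "wf_rtrm T (far S f) (fres S f) (fmap F f)" using wf by (auto simp: wf_interp_def)
    then show "y \<in> car (reduct S F M) (fres S f)"
      using that * tm_val_in_car[OF assms(4) valuation_nth]
      by (auto simp: fn_reduct rtm_val_def wf_rtrm_def split: if_splits)
  qed
  show "R \<in> psyms S" "elems (reduct S F M) (par S R) xs" if "rl (reduct S F M) R xs" for R xs
    using that by (auto simp: rl_reduct)
  show "\<forall>(V, \<phi>, \<psi>)\<in>axioms S. \<forall>v. (\<forall>(i, s)\<in>V. v i s \<in> car (reduct S F M) s) \<longrightarrow>
        sat_horn (reduct S F M) v \<phi> \<longrightarrow> sat_horn (reduct S F M) v \<psi>"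
  proof clarify
    fix V \<phi> \<psi> v
    assume ax: "(V, \<phi>, \<psi>) \<in> axioms S" and v: "\<forall>(i, s)\<in>V. v i s \<in> car (reduct S F M) s"
      and \<phi>: "sat_horn (reduct S F M) v \<phi>"
    from v have v: "valuation M V v" by (simp add: valuation_def)
    have "wf_horn S V \<phi>" "wf_horn S V \<psi>" using ax assms(1) by (auto simp: wf_phl_def)
    note tr = this[THEN sat_tr_horn[OF assms(4) wf v]]
    have "entails T V (tr_horn F \<phi>) (tr_horn F \<psi>)"
      using assms(3) ax by (auto simp: phl_morphism_def)
    then show "sat_horn (reduct S F M) v \<psi>"
      using entails_sound[OF assms(2,4) v] \<phi> tr by blast
  qed
qed

section \<open>Homomorphisms\<close>

lemma is_homD:
  assumes "is_hom T M N h"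
  shows "a \<in> car M s \<Longrightarrow> h s a \<in> car N s" "a \<notin> car M s \<Longrightarrow> h s a = undefined"
    "fn M f xs = Some y \<Longrightarrow> fn N f (map2 h (far T f) xs) = Some (h (fres T f) y)"
    "rl M R xs \<Longrightarrow> rl N R (map2 h (par T R) xs)"
proof -
  from assms have "\<forall>s a. if a \<in> car M s then h s a \<in> car N s else h s a = undefined"
    unfolding is_hom_def by (rule conjunct1)
  then show "a \<in> car M s \<Longrightarrow> h s a \<in> car N s" "a \<notin> car M s \<Longrightarrow> h s a = undefined"
    by presburger+
  show "fn M f xs = Some y \<Longrightarrow> fn N f (map2 h (far T f) xs) = Some (h (fres T f) y)"
    "rl M R xs \<Longrightarrow> rl N R (map2 h (par T R) xs)"
    using assms unfolding is_hom_def by blast+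
qed

lemma is_hom_elems: "is_hom T M N h \<Longrightarrow> elems M ss xs \<Longrightarrow> elems N ss (map2 h ss xs)"
  by (auto simp: elems_def list_all2_conv_all_nth is_homD(1))

text \<open>Agreement of \<open>w\<close> with the image of \<open>v\<close> is asked on
  \<open>V\<close> only, because both are later list lookups, related only below the length of the
  list. There is no converse, since homomorphisms need not reflect definedness.\<close>

lemma is_hom_tm_val:
  assumes "is_model T M" "is_hom T M N h" "valuation M V v" "has_sort T V t s" "tm_val M v t = Some x"
    "\<And>i s. (i, s) \<in> V \<Longrightarrow> w i s = h s (v i s)"
  shows "tm_val N w t = Some (h s x)"
  using assms(4,5)
proof (induction t arbitrary: s x)
  case (Var i s')
  then show ?case using assms(6) by simp
next
  case (App f ts)
  from App.prems obtain xs where xs: "map (tm_val M v) ts = map Some xs" "fn M f xs = Some x"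
    unfolding tm_val_App_eq_Some_iff by blast
  from App.prems have ts: "list_all2 (has_sort T V) ts (far T f)" and s: "s = fres T f" by auto
  have len: "length ts = length xs" using xs by (metis length_map)
  have "map (tm_val N w) ts = map Some (map2 h (far T f) xs)"
  proof (rule nth_equalityI)
    show "length (map (tm_val N w) ts) = length (map Some (map2 h (far T f) xs))"
      using ts len by (simp add: list_all2_lengthD[OF ts, symmetric])
    fix i assume "i < length (map (tm_val N w) ts)"
    then have i: "i < length ts" by simp
    then have "tm_val M v (ts ! i) = Some (xs ! i)" using xs len by (metis nth_map)
    moreover have "has_sort T V (ts ! i) (far T f ! i)" using ts i by (auto dest: list_all2_nthD)
    ultimately have "tm_val N w (ts ! i) = Some (h (far T f ! i) (xs ! i))"
      using App.IH i by (meson nth_mem)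
    then show "map (tm_val N w) ts ! i = map Some (map2 h (far T f) xs) ! i"
      using i len list_all2_lengthD[OF ts] by simp
  qed
  then show ?case using is_homD(3)[OF assms(2) xs(2)] s unfolding tm_val_App_eq_Some_iff by blast
qed

lemma is_hom_sat:
  assumes "is_model T M" "is_hom T M N h" "valuation M V v" "wf_atom T V a" "sat M v a"
    "\<And>i s. (i, s) \<in> V \<Longrightarrow> w i s = h s (v i s)"
  shows "sat N w a"
proof (cases a)
  case (Eq t u)
  with assms(4,5) obtain s x where "has_sort T V t s" "has_sort T V u s"
    "tm_val M v t = Some x" "tm_val M v u = Some x"
    by (auto simp: sat_Eq_iff simp del: sat.simps)
  then have "tm_val N w t = Some (h s x)" "tm_val N w u = Some (h s x)"
    using is_hom_tm_val[OF assms(1-3) _ _ assms(6)] by blast+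
  then show ?thesis by (simp add: Eq)
next
  case (Rel R ts)
  with assms(5) obtain xs where xs: "map (tm_val M v) ts = map Some xs" "rl M R xs"
    unfolding Rel sat_Rel_iff by blast
  from assms(4) have ts: "list_all2 (has_sort T V) ts (par T R)" by (simp add: Rel)
  have len: "length ts = length xs" using xs by (metis length_map)
  have "map (tm_val N w) ts = map Some (map2 h (par T R) xs)"
  proof (rule nth_equalityI)
    show "length (map (tm_val N w) ts) = length (map Some (map2 h (par T R) xs))"
      using ts len by (simp add: list_all2_lengthD[OF ts, symmetric])
    fix i assume "i < length (map (tm_val N w) ts)"
    then have i: "i < length ts" by simp
    then have "tm_val M v (ts ! i) = Some (xs ! i)" using xs len by (metis nth_map)
    moreover have "has_sort T V (ts ! i) (par T R ! i)" using ts i by (auto dest: list_all2_nthD)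
    ultimately have "tm_val N w (ts ! i) = Some (h (par T R ! i) (xs ! i))"
      using is_hom_tm_val[OF assms(1-3) _ _ assms(6)] by blast
    then show "map (tm_val N w) ts ! i = map Some (map2 h (par T R) xs) ! i"
      using i len list_all2_lengthD[OF ts] by simp
  qed
  then show ?thesis using is_homD(4)[OF assms(2) xs(2)] unfolding Rel sat_Rel_iff by blast
qed

lemma is_hom_reduct:
  assumes "is_model T M" "wf_interp S T F" "is_hom T M N h"
  shows "is_hom S (reduct S F M) (reduct S F N) h"
  unfolding is_hom_def
proof (intro conjI allI impI)
  have nth: "map2 h ss xs ! i = h s (xs ! i)" if "elems M ss xs" "(i, s) \<in> ctxvars ss" for ss xs i s
    using that elems_length[OF that(1)] by (auto simp: ctxvars_def)
  have sat: "sat_horn N (\<lambda>i s. map2 h ss xs ! i) \<phi>"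
    if "elems M ss xs" "wf_horn T (ctxvars ss) \<phi>" "sat_horn M (\<lambda>i s. xs ! i) \<phi>" for ss xs \<phi>
    unfolding sat_horn_def
  proof
    fix a assume "a \<in> set \<phi>"
    with that(2,3) have a: "wf_atom T (ctxvars ss) a" "sat M (\<lambda>i s. xs ! i) a"
      by (auto simp: sat_horn_def wf_horn_def)
    show "sat N (\<lambda>i s. map2 h ss xs ! i) a"
      by (rule is_hom_sat[OF assms(1,3) valuation_nth[OF that(1)] a]) (rule nth[OF that(1)])
  qed
  show "if a \<in> car (reduct S F M) s then h s a \<in> car (reduct S F N) s else h s a = undefined" for s a
    using assms(3) by (simp add: is_hom_def)
  show "fn (reduct S F N) f (map2 h (far S f) xs) = Some (h (fres S f) y)"
    if "fn (reduct S F M) f xs = Some y" for f xs y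
  proof -
    from that have f: "f \<in> fsyms S" "elems M (far S f) xs" "sat_horn M (\<lambda>i s. xs ! i) (snd (fmap F f))"
      "tm_val M (\<lambda>i s. xs ! i) (fst (fmap F f)) = Some y"
      by (auto simp: fn_reduct rtm_val_def split: if_splits)
    then have "wf_rtrm T (far S f) (fres S f) (fmap F f)" using assms(2) by (auto simp: wf_interp_def)
    then have wf: "has_sort T (ctxvars (far S f)) (fst (fmap F f)) (fres S f)"
      "wf_horn T (ctxvars (far S f)) (snd (fmap F f))" by (auto simp: wf_rtrm_def)
    have "tm_val N (\<lambda>i s. map2 h (far S f) xs ! i) (fst (fmap F f)) = Some (h (fres S f) y)"
      by (rule is_hom_tm_val[OF assms(1,3) valuation_nth[OF f(2)] wf(1) f(4)]) (rule nth[OF f(2)])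
    then show ?thesis using f sat[OF f(2) wf(2)] is_hom_elems[OF assms(3)]
      by (simp add: fn_reduct rtm_val_def)
  qed
  show "rl (reduct S F N) R (map2 h (par S R) xs)" if "rl (reduct S F M) R xs" for R xs
    using that sat is_hom_elems[OF assms(3)] assms(2) by (auto simp: rl_reduct wf_interp_def)
qed

section \<open>Sorts in the axioms of an algebraic dependent type theory\<close>

lemma phl_of_simps [simp]:
  "fsyms (phl_of T) = sym_set T" "far (phl_of T) = sym_args T" "fres (phl_of T) = sym_res T"
  "psyms (phl_of T) = {(R, m) | R m. R \<in> preds T}"
  "par (phl_of T) (R, m) = shift_args m (pred_args T R)"
  by (simp_all add: phl_of_def)

lemma sym_set_simps [simp]:
  "One \<in> sym_set T" "Ft n \<in> sym_set T" "TyOf n \<in> sym_set T" "Vr n i \<in> sym_set T \<longleftrightarrow> i < n"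
  "Subst p n k \<in> sym_set T" "Op f m \<in> sym_set T \<longleftrightarrow> f \<in> ops T"
  by (auto simp: sym_set_def)

lemma ctxvars_iff: "(i, s) \<in> ctxvars ss \<longleftrightarrow> i < length ss \<and> s = ss ! i"
  by (auto simp: ctxvars_def)

lemma list_all2_replicate2: "list_all2 P xs (replicate n s) \<longleftrightarrow> length xs = n \<and> (\<forall>x\<in>set xs. P x s)"
  by (auto simp: list_all2_conv_all_nth all_set_conv_all_nth)

lemma list_all2_varterms: "(\<And>i. i < length ss \<Longrightarrow> (i, ss ! i) \<in> V) \<Longrightarrow> list_all2 (has_sort T V) (varterms ss) ss"
  by (auto simp: varterms_def list_all2_conv_all_nth)

lemma length_vars_down [simp]: "length (vars_down n lo G) = n - lo"
  by (simp add: vars_down_def)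

lemma length_var_list [simp]: "length (var_list a k s) = k"
  by (simp add: var_list_def)

context
  fixes T :: "('f, 'r, 'z) adtt_scheme" and V :: "(nat \<times> sort) set"
begin

lemma has_sort_ctx_tm: "has_sort (phl_of T) V t (psort p n) \<Longrightarrow> has_sort (phl_of T) V (ctx_tm p n t) (Ctx, n)"
  by (cases p) auto

lemma has_sort_ft_iter: "has_sort (phl_of T) V t (Ctx, n + i) \<Longrightarrow> has_sort (phl_of T) V (ft_iter n i t) (Ctx, n)"
  by (induction n i t rule: ft_iter.induct) auto

lemma has_sort_ctx_iter: "has_sort (phl_of T) V t (psort p (n + i)) \<Longrightarrow> has_sort (phl_of T) V (ctx_iter p n i t) (Ctx, n)"
  unfolding ctx_iter_def by (intro has_sort_ft_iter has_sort_ctx_tm)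

lemma has_sort_vars_down: "has_sort (phl_of T) V G (Ctx, n) \<Longrightarrow> t \<in> set (vars_down n lo G) \<Longrightarrow> has_sort (phl_of T) V t (Tm, n)"
  by (auto simp: vars_down_def)

lemma wf_ctx_map:
  assumes "has_sort (phl_of T) V G (Ctx, n)" "has_sort (phl_of T) V D (Ctx, k)" "length as = k" "\<forall>a\<in>set as. has_sort (phl_of T) V a (Tm, n)"
  shows "wf_horn (phl_of T) V (ctx_map n k G D as)"
proof -
  have "has_sort (phl_of T) V (ctx_tm TM n (as ! i)) (Ctx, n)" "has_sort (phl_of T) V (App (TyOf n) [as ! i]) (Ctx, Suc n)"
    "has_sort (phl_of T) V (App (Subst TY n i) (G # ft_iter (Suc i) (k - Suc i) D # take i as)) (Ctx, Suc n)"
    if "i < k" for i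
  proof -
    have "has_sort (phl_of T) V (ft_iter (Suc i) (k - Suc i) D) (Ctx, Suc i)"
      using that assms(2) by (intro has_sort_ft_iter) simp
    then show "has_sort (phl_of T) V (ctx_tm TM n (as ! i)) (Ctx, n)" "has_sort (phl_of T) V (App (TyOf n) [as ! i]) (Ctx, Suc n)"
      "has_sort (phl_of T) V (App (Subst TY n i) (G # ft_iter (Suc i) (k - Suc i) D # take i as)) (Ctx, Suc n)"
      using that assms by (auto simp: list_all2_replicate2 min_def dest: in_set_takeD)
  qed
  with assms(1) have "wf_atom (phl_of T) V (Eq (ctx_tm TM n (as ! i)) G)"
    "wf_atom (phl_of T) V (Eq (App (TyOf n) [as ! i])
       (App (Subst TY n i) (G # ft_iter (Suc i) (k - Suc i) D # take i as)))" if "i < k" for i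
    using that unfolding wf_atom.simps by blast+
  then show ?thesis unfolding ctx_map_def wf_horn_simps by simp
qed

lemma has_sort_lift_map:
  assumes "has_sort (phl_of T) V E (Ctx, k + n)" "length as = m" "\<forall>a\<in>set as. has_sort (phl_of T) V a (Tm, k)"
  shows "length (lift_map k n E as) = m + n \<and> (\<forall>a\<in>set (lift_map k n E as). has_sort (phl_of T) V a (Tm, k + n))"
  using assms has_sort_vars_down[OF assms(1)]
  by (auto simp: lift_map_def list_all2_replicate2)

lemma has_sort_ext_ctx:
  assumes "has_sort (phl_of T) V D (Ctx, k)" "length as = m" "\<forall>a\<in>set as. has_sort (phl_of T) V a (Tm, k)"
  shows "has_sort (phl_of T) V B (Ctx, m + n) \<Longrightarrow> has_sort (phl_of T) V (ext_ctx k m n D B as) (Ctx, k + n)"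
proof (induction n arbitrary: B)
  case (Suc n)
  have E: "has_sort (phl_of T) V (ext_ctx k m n D (App (Ft (m + n)) [B]) as) (Ctx, k + n)"
    using Suc.prems by (intro Suc.IH) auto
  show ?case using has_sort_lift_map[OF E assms(2,3)] E Suc.prems
    by (auto simp: Let_def list_all2_replicate2)
qed (use assms in auto)

lemma has_sort_ext_subst:
  assumes "has_sort (phl_of T) V D (Ctx, k)" "length as = m" "\<forall>a\<in>set as. has_sort (phl_of T) V a (Tm, k)" "has_sort (phl_of T) V x (psort p (m + n))"
  shows "has_sort (phl_of T) V (ext_subst p k m n D x as) (psort p (k + n))"
proof -
  have E: "has_sort (phl_of T) V (ext_ctx k m n D (ctx_tm p (m + n) x) as) (Ctx, k + n)"
    by (intro has_sort_ext_ctx has_sort_ctx_tm assms)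
  show ?thesis using has_sort_lift_map[OF E assms(2,3)] E assms(4)
    by (auto simp: ext_subst_def Let_def list_all2_replicate2)
qed

lemma has_sort_arg_vars:
  assumes "ctxvars (shift_args m ps) \<subseteq> V" "i < length ps"
  shows "has_sort (phl_of T) V (arg_vars m ps ! i) (psort (fst (ps ! i)) (m + snd (ps ! i)))"
proof -
  have "(Suc i, shift_args m ps ! Suc i) \<in> V"
    using assms by (force simp: ctxvars_def shift_args_def)
  then show ?thesis using assms(2)
    by (simp add: arg_vars_def varterms_def shift_args_def nth_tl split_beta del: upt_Suc)
qed

lemma length_arg_vars [simp]: "length (arg_vars m ps) = length ps"
  by (simp add: arg_vars_def varterms_def shift_args_def)

lemma has_sort_context:
  assumes "ctxvars (shift_args m ps) \<subseteq> V"
  shows "has_sort (phl_of T) V (Var 0 (Ctx, m)) (Ctx, m)"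
  using assms by (force simp: ctxvars_def shift_args_def)

lemma wf_args_over:
  assumes "ctxvars (shift_args m ps) \<subseteq> V"
  shows "wf_horn (phl_of T) V (args_over m ps)"
proof -
  have "wf_atom (phl_of T) V (args_over m ps ! i)" if "i < length ps" for i
    using has_sort_ctx_iter[OF has_sort_arg_vars[OF assms that]] has_sort_context[OF assms] that
    by (auto simp: args_over_def split_beta simp del: has_sort_Var)
  moreover have "length (args_over m ps :: ('f, 'r) shorn) = length ps" by (simp add: args_over_def)
  ultimately show ?thesis unfolding wf_horn_def all_set_conv_all_nth by simp
qed

lemma has_sort_ext_args:
  assumes "ctxvars (shift_args m ps) \<subseteq> V" "has_sort (phl_of T) V D (Ctx, k)" "length as = m" "\<forall>a\<in>set as. has_sort (phl_of T) V a (Tm, k)"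
  shows "list_all2 (has_sort (phl_of T) V) (D # map2 (\<lambda>(p, n) x. ext_subst p k m n D x as) ps (arg_vars m ps)) (shift_args k ps)"
  using assms(2) has_sort_ext_subst[OF assms(2-4) has_sort_arg_vars[OF assms(1)]]
  by (simp add: shift_args_def) (auto simp: list_all2_conv_all_nth split_beta)

end

lemma list_all2_varterms_append:
  "list_all2 (has_sort T (ctxvars (ss @ ss'))) (varterms ss) ss"
  by (rule list_all2_varterms) (auto simp: ctxvars_iff nth_append)

lemma ctxvars_append: "ctxvars ss \<subseteq> ctxvars (ss @ ss')"
  by (auto simp: ctxvars_iff nth_append)

lemma has_sort_var_list:
  assumes "\<And>i. i < k \<Longrightarrow> (start + i, s) \<in> V"
  shows "\<forall>a\<in>set (var_list start k s). has_sort T V a s"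
  using assms by (auto simp: var_list_def)

text \<open>\<open>is_theory\<close> demands well-sortedness of the extra axioms only; for the fixed
  axioms it has to be derived from their definitions, family by family.\<close>

lemma wf_subst_axioms:
  assumes "(V, \<phi>, \<psi>) \<in> subst_axioms"
  shows "wf_horn (phl_of T) V \<phi> \<and> wf_horn (phl_of T) V \<psi>"
  using assms unfolding subst_axioms_def Un_iff
proof (elim disjE)
  assume "(V, \<phi>, \<psi>) \<in> one_axioms"
  then show ?thesis by (auto simp: one_axioms_def ctxvars_iff)
next
  assume "(V, \<phi>, \<psi>) \<in> total_axioms"
  then show ?thesis by (auto simp: total_axioms_def ctxvars_iff)
next
  assume "(V, \<phi>, \<psi>) \<in> subst_def_axioms"
  then obtain p n k where
    V: "V = ctxvars ((Ctx, n) # psort p k # replicate k (Tm, n))" and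
    eq: "{\<phi>, \<psi>} = {[defd (App (Subst p n k) (Var 0 (Ctx, n) # Var 1 (psort p k) # var_list 2 k (Tm, n)))],
      ctx_map n k (Var 0 (Ctx, n)) (ctx_tm p k (Var 1 (psort p k))) (var_list 2 k (Tm, n))}"
    unfolding subst_def_axioms_def Let_def by blast
  have as: "\<forall>a\<in>set (var_list 2 k (Tm, n)). has_sort (phl_of T) V a (Tm, n)"
    by (rule has_sort_var_list) (simp add: V ctxvars_iff)
  have G: "has_sort (phl_of T) V (Var 0 (Ctx, n)) (Ctx, n)"
    and t: "has_sort (phl_of T) V (Var 1 (psort p k)) (psort p k)"
    by (simp_all add: V ctxvars_iff)
  have "wf_horn (phl_of T) V (ctx_map n k (Var 0 (Ctx, n)) (ctx_tm p k (Var 1 (psort p k))) (var_list 2 k (Tm, n)))"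
    using wf_ctx_map[OF G has_sort_ctx_tm[OF t] _ as] by simp
  moreover have "wf_horn (phl_of T) V
      [defd (App (Subst p n k) (Var 0 (Ctx, n) # Var 1 (psort p k) # var_list 2 k (Tm, n)))]"
    using G t as by (simp add: list_all2_replicate2)
  ultimately show ?thesis using eq by (auto simp: doubleton_eq_iff)
next
  assume "(V, \<phi>, \<psi>) \<in> subst_typing_axioms"
  then consider (TY) n k where
      "V = ctxvars ((Ctx, n) # psort TY k # replicate k (Tm, n))"
      "\<phi> = [defd (App (Subst TY n k) (Var 0 (Ctx, n) # Var 1 (psort TY k) # var_list 2 k (Tm, n)))]"
      "\<psi> = [Eq (ctx_tm TY n (App (Subst TY n k) (Var 0 (Ctx, n) # Var 1 (psort TY k) # var_list 2 k (Tm, n))))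
        (Var 0 (Ctx, n))]"
    | (TM) n k where
      "V = ctxvars ((Ctx, n) # psort TM k # replicate k (Tm, n))"
      "\<phi> = [defd (App (Subst TM n k) (Var 0 (Ctx, n) # Var 1 (psort TM k) # var_list 2 k (Tm, n)))]"
      "\<psi> = [Eq (App (TyOf n) [App (Subst TM n k) (Var 0 (Ctx, n) # Var 1 (psort TM k) # var_list 2 k (Tm, n))])
        (App (Subst TY n k) (Var 0 (Ctx, n) # App (TyOf k) [Var 1 (psort TM k)] # var_list 2 k (Tm, n)))]"
    unfolding subst_typing_axioms_def Let_def by blast
  then show ?thesis
  proof cases
    case TY
    have "\<forall>a\<in>set (var_list 2 k (Tm, n)). has_sort (phl_of T) V a (Tm, n)"
      by (rule has_sort_var_list) (simp add: TY ctxvars_iff)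
    then show ?thesis using TY by (simp add: list_all2_replicate2 ctxvars_iff)
  next
    case TM
    have "\<forall>a\<in>set (var_list 2 k (Tm, n)). has_sort (phl_of T) V a (Tm, n)"
      by (rule has_sort_var_list) (simp add: TM ctxvars_iff)
    then show ?thesis using TM by (simp add: list_all2_replicate2 ctxvars_iff)
  qed
next
  assume "(V, \<phi>, \<psi>) \<in> var_typing_axioms"
  then obtain n i where i: "i < n" and V: "V = ctxvars [(Ctx, n)]" and
    eq: "\<phi> = []" "\<psi> = [Eq (App (TyOf n) [App (Vr n i) [Var 0 (Ctx, n)]])
         (App (Subst TY n (n - Suc i)) (Var 0 (Ctx, n) # ft_iter (n - i) i (Var 0 (Ctx, n)) #
            vars_down n (Suc i) (Var 0 (Ctx, n))))]"
    unfolding var_typing_axioms_def by blast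
  have G: "has_sort (phl_of T) V (Var 0 (Ctx, n)) (Ctx, n)"
    by (simp_all add: V ctxvars_iff)
  then have "has_sort (phl_of T) V (ft_iter (n - i) i (Var 0 (Ctx, n))) (Ctx, n - i)"
    using i by (intro has_sort_ft_iter) simp
  \<comment> \<open>\<open>Subst TY n (n - Suc i)\<close> expects an argument of sort
    \<open>(Ctx, Suc (n - Suc i))\<close>, while the iterate of \<open>Ft\<close> has sort
    \<open>(Ctx, n - i)\<close>. \<open>Suc_diff_Suc\<close> identifies the two because
    \<open>i < n\<close>.\<close>
  then show ?thesis using eq i G has_sort_vars_down[OF G]
    by (auto simp: list_all2_replicate2 Suc_diff_Suc simp del: has_sort_Var)
next
  assume "(V, \<phi>, \<psi>) \<in> unit_axioms"
  then obtain p n where V: "V = ctxvars [psort p n]" and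
    eq: "\<phi> = []" "\<psi> = [Eq (App (Subst p n n) (ctx_tm p n (Var 0 (psort p n)) # Var 0 (psort p n) #
      vars_down n 0 (ctx_tm p n (Var 0 (psort p n))))) (Var 0 (psort p n))]"
    unfolding unit_axioms_def by blast
  have t: "has_sort (phl_of T) V (Var 0 (psort p n)) (psort p n)"
    by (simp_all add: V ctxvars_iff)
  show ?thesis using eq t has_sort_ctx_tm[OF t] has_sort_vars_down[OF has_sort_ctx_tm[OF t]]
    by (auto simp: list_all2_replicate2 simp del: has_sort_Var)
next
  assume "(V, \<phi>, \<psi>) \<in> subst_var_axioms"
  then obtain n k i where i: "i < k" and V: "V = ctxvars ((Ctx, n) # (Ctx, k) # replicate k (Tm, n))" and
    eq: "\<phi> = [defd (App (Subst TM n k) (Var 0 (Ctx, n) # App (Vr k i) [Var 1 (Ctx, k)] # var_list 2 k (Tm, n)))]"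
      "\<psi> = [Eq (App (Subst TM n k) (Var 0 (Ctx, n) # App (Vr k i) [Var 1 (Ctx, k)] # var_list 2 k (Tm, n)))
         (var_list 2 k (Tm, n) ! (k - Suc i))]"
    unfolding subst_var_axioms_def by blast
  have as: "\<forall>a\<in>set (var_list 2 k (Tm, n)). has_sort (phl_of T) V a (Tm, n)"
    by (rule has_sort_var_list) (simp add: V ctxvars_iff)
  then have "has_sort (phl_of T) V (var_list 2 k (Tm, n) ! (k - Suc i)) (Tm, n)"
    using i by (simp add: list_all2_replicate2)
  with as show ?thesis using eq i by (simp add: list_all2_replicate2 V ctxvars_iff)
next
  assume "(V, \<phi>, \<psi>) \<in> assoc_axioms"
  then obtain p n k l where
    V: "V = ctxvars ((Ctx, n) # (Ctx, k) # psort p l # replicate l (Tm, k) @ replicate k (Tm, n))" and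
    eq: "\<phi> = [defd (App (Subst p n k) (Var 0 (Ctx, n) #
          App (Subst p k l) (Var 1 (Ctx, k) # Var 2 (psort p l) # var_list 3 l (Tm, k)) #
          var_list (3 + l) k (Tm, n)))]"
      "\<psi> = [Eq (App (Subst p n k) (Var 0 (Ctx, n) #
          App (Subst p k l) (Var 1 (Ctx, k) # Var 2 (psort p l) # var_list 3 l (Tm, k)) #
          var_list (3 + l) k (Tm, n)))
        (App (Subst p n l) (Var 0 (Ctx, n) # Var 2 (psort p l) #
          map (\<lambda>b. App (Subst TM n k) (Var 0 (Ctx, n) # b # var_list (3 + l) k (Tm, n)))
            (var_list 3 l (Tm, k))))]"
    unfolding assoc_axioms_def Let_def by blast
  have as: "\<forall>a\<in>set (var_list (3 + l) k (Tm, n)). has_sort (phl_of T) V a (Tm, n)"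
    by (rule has_sort_var_list) (simp add: V ctxvars_iff nth_append nth_Cons')
  have bs: "\<forall>a\<in>set (var_list 3 l (Tm, k)). has_sort (phl_of T) V a (Tm, k)"
    by (rule has_sort_var_list) (simp add: V ctxvars_iff nth_append nth_Cons')
  have "has_sort (phl_of T) V (Var 0 (Ctx, n)) (Ctx, n)" "has_sort (phl_of T) V (Var 1 (Ctx, k)) (Ctx, k)"
    "has_sort (phl_of T) V (Var 2 (psort p l)) (psort p l)"
    by (simp_all add: V ctxvars_iff)
  with as bs show ?thesis unfolding eq by (auto simp: list_all2_replicate2 simp del: has_sort_Var)
qed

lemma wf_phl_of:
  assumes "\<forall>(V, \<phi>, \<psi>)\<in>extra_axioms T. wf_horn (phl_of T) V \<phi> \<and> wf_horn (phl_of T) V \<psi>"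
  shows "wf_phl (phl_of T)"
  unfolding wf_phl_def
proof (clarify, unfold phl_of_def[of T, THEN arg_cong[of _ _ axioms], simplified] Un_iff)
  fix V \<phi> \<psi>
  assume "(((((V, \<phi>, \<psi>) \<in> subst_axioms \<or> (V, \<phi>, \<psi>) \<in> op_context_axioms T) \<or> (V, \<phi>, \<psi>) \<in> pred_context_axioms T) \<or>
       (V, \<phi>, \<psi>) \<in> op_subst_axioms T) \<or> (V, \<phi>, \<psi>) \<in> pred_subst_axioms T) \<or> (V, \<phi>, \<psi>) \<in> extra_axioms T"
  then show "wf_horn (phl_of T) V \<phi> \<and> wf_horn (phl_of T) V \<psi>"
  proof (elim disjE)
    assume "(V, \<phi>, \<psi>) \<in> op_context_axioms T"
    then obtain f m where f: "f \<in> ops T" and V: "V = ctxvars (shift_args m (op_args T f))" and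
      eq: "\<phi> = [defd (App (Op f m) (varterms (shift_args m (op_args T f))))]"
      "\<psi> = Eq (ctx_iter (fst (op_res T f)) m (snd (op_res T f)) (App (Op f m) (varterms (shift_args m (op_args T f)))))
        (Var 0 (Ctx, m)) # args_over m (op_args T f)"
      unfolding op_context_axioms_def by blast
    have t: "has_sort (phl_of T) V (App (Op f m) (varterms (shift_args m (op_args T f))))
       (psort (fst (op_res T f)) (m + snd (op_res T f)))"
      using f by (auto intro!: list_all2_varterms simp: V ctxvars_iff)
    have G: "has_sort (phl_of T) V (Var 0 (Ctx, m)) (Ctx, m)"
      unfolding V by (rule has_sort_context[OF order_refl])
    have "wf_atom (phl_of T) V (defd (App (Op f m) (varterms (shift_args m (op_args T f)))))"
      "wf_atom (phl_of T) V (Eq (ctx_iter (fst (op_res T f)) m (snd (op_res T f))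
        (App (Op f m) (varterms (shift_args m (op_args T f))))) (Var 0 (Ctx, m)))"
      using t has_sort_ctx_iter[OF t] G unfolding wf_atom.simps by blast+
    then show ?thesis using wf_args_over[of m "op_args T f" V T] unfolding eq V by simp
  next
    assume "(V, \<phi>, \<psi>) \<in> pred_context_axioms T"
    then obtain R m where "R \<in> preds T" and V: "V = ctxvars (shift_args m (pred_args T R))" and
      eq: "\<phi> = [Rel (R, m) (varterms (shift_args m (pred_args T R)))]" "\<psi> = args_over m (pred_args T R)"
      unfolding pred_context_axioms_def by blast
    then show ?thesis using wf_args_over[of m "pred_args T R" V T]
      by (auto intro!: list_all2_varterms simp: ctxvars_iff)
  next
    assume "(V, \<phi>, \<psi>) \<in> op_subst_axioms T"
    then obtain f m k where f: "f \<in> ops T" and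
      all: "let ps = op_args T f; ss = shift_args m ps; l = length ss;
         D = Var l (Ctx, k); as = var_list (Suc l) m (Tm, k);
         t = App (Op f m) (varterms ss);
         lhs = ext_subst (fst (op_res T f)) k m (snd (op_res T f)) D t as;
         rhs = App (Op f k)
           (D # map2 (\<lambda>(p, n) x. ext_subst p k m n D x as) ps (arg_vars m ps))
       in V = ctxvars (ss @ (Ctx, k) # replicate m (Tm, k)) \<and>
          \<phi> = defd t # ctx_map k m D (Var 0 (Ctx, m)) as \<and> \<psi> = [Eq lhs rhs]"
      unfolding op_subst_axioms_def Let_def by blast
    define ss where "ss = shift_args m (op_args T f)"
    define D :: "'a stm" where "D = Var (length ss) (Ctx, k)"
    define as :: "'a stm list" where "as = var_list (Suc (length ss)) m (Tm, k)"
    define t where "t = App (Op f m) (varterms ss)"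
    have V: "V = ctxvars (ss @ (Ctx, k) # replicate m (Tm, k))" and
      \<phi>: "\<phi> = defd t # ctx_map k m D (Var 0 (Ctx, m)) as" and
      \<psi>: "\<psi> = [Eq (ext_subst (fst (op_res T f)) k m (snd (op_res T f)) D t as)
         (App (Op f k) (D # map2 (\<lambda>(p, n) x. ext_subst p k m n D x as) (op_args T f) (arg_vars m (op_args T f))))]"
      using all unfolding ss_def D_def as_def t_def Let_def by blast+
    have t: "has_sort (phl_of T) V t (psort (fst (op_res T f)) (m + snd (op_res T f)))"
      using f list_all2_varterms_append[of "phl_of T" ss "(Ctx, k) # replicate m (Tm, k)"]
      by (simp add: t_def V ss_def)
    have sub: "ctxvars (shift_args m (op_args T f)) \<subseteq> V"
      unfolding V ss_def by (rule ctxvars_append)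
    have D: "has_sort (phl_of T) V D (Ctx, k)" by (simp add: D_def V ctxvars_iff nth_append)
    have as: "\<forall>a\<in>set as. has_sort (phl_of T) V a (Tm, k)" unfolding as_def
      by (rule has_sort_var_list) (simp add: V ctxvars_iff nth_append)
    have len: "length as = m" by (simp add: as_def)
    have "wf_horn (phl_of T) V \<phi>" unfolding \<phi> wf_horn_simps wf_atom.simps
      using t wf_ctx_map[OF D has_sort_context[OF sub] len as] by blast
    moreover have "has_sort (phl_of T) V
        (App (Op f k) (D # map2 (\<lambda>(p, n) x. ext_subst p k m n D x as) (op_args T f) (arg_vars m (op_args T f))))
        (psort (fst (op_res T f)) (k + snd (op_res T f)))"
      using has_sort_ext_args[OF sub D len as] f by simp
    then have "wf_horn (phl_of T) V \<psi>" unfolding \<psi> wf_horn_simps(2) wf_atom.simps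
      using has_sort_ext_subst[OF D len as t] wf_horn_simps(1) by blast
    ultimately show ?thesis ..
  next
    assume "(V, \<phi>, \<psi>) \<in> pred_subst_axioms T"
    then obtain R m k where R: "R \<in> preds T" and
      all: "let ps = pred_args T R; ss = shift_args m ps; l = length ss;
         D = Var l (Ctx, k); as = var_list (Suc l) m (Tm, k)
       in V = ctxvars (ss @ (Ctx, k) # replicate m (Tm, k)) \<and>
          \<phi> = Rel (R, m) (varterms ss) # ctx_map k m D (Var 0 (Ctx, m)) as \<and>
          \<psi> = [Rel (R, k) (D # map2 (\<lambda>(p, n) x. ext_subst p k m n D x as) ps (arg_vars m ps))]"
      unfolding pred_subst_axioms_def Let_def by blast
    define ss where "ss = shift_args m (pred_args T R)"
    define D :: "'a stm" where "D = Var (length ss) (Ctx, k)"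
    define as :: "'a stm list" where "as = var_list (Suc (length ss)) m (Tm, k)"
    have V: "V = ctxvars (ss @ (Ctx, k) # replicate m (Tm, k))" and
      \<phi>: "\<phi> = Rel (R, m) (varterms ss) # ctx_map k m D (Var 0 (Ctx, m)) as" and
      \<psi>: "\<psi> = [Rel (R, k) (D # map2 (\<lambda>(p, n) x. ext_subst p k m n D x as) (pred_args T R) (arg_vars m (pred_args T R)))]"
      using all unfolding ss_def D_def as_def Let_def by blast+
    have t: "wf_atom (phl_of T) V (Rel (R, m) (varterms ss))"
      using R list_all2_varterms_append[of "phl_of T" ss "(Ctx, k) # replicate m (Tm, k)"]
      by (simp add: V ss_def)
    have sub: "ctxvars (shift_args m (pred_args T R)) \<subseteq> V"
      unfolding V ss_def by (rule ctxvars_append)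
    have D: "has_sort (phl_of T) V D (Ctx, k)" by (simp add: D_def V ctxvars_iff nth_append)
    have as: "\<forall>a\<in>set as. has_sort (phl_of T) V a (Tm, k)" unfolding as_def
      by (rule has_sort_var_list) (simp add: V ctxvars_iff nth_append)
    have len: "length as = m" by (simp add: as_def)
    have "wf_horn (phl_of T) V \<phi>" unfolding \<phi> using t wf_ctx_map[OF D has_sort_context[OF sub] len as]
      by auto
    moreover have "wf_horn (phl_of T) V \<psi>" unfolding \<psi>
      using has_sort_ext_args[OF sub D len as] R by auto
    ultimately show ?thesis ..
  next
    assume "(V, \<phi>, \<psi>) \<in> subst_axioms"
    then show ?thesis by (rule wf_subst_axioms)
  next
    assume "(V, \<phi>, \<psi>) \<in> extra_axioms T"
    then show ?thesis using assms by blast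
  qed
qed

lemma is_theory_wf_phl: "is_theory T \<Longrightarrow> wf_phl (phl_of T)"
  by (intro wf_phl_of) (auto simp: is_theory_def)

section \<open>Universal models\<close>

text \<open>The variables of \<open>trm\<close> are numbered by naturals. The left adjoint takes all
  elements of a model as generators, so generators range over an arbitrary type here; their sorts
  are supplied separately by \<open>ks\<close>.\<close>

datatype ('f, 'k) gterm = Gen 'k | Ap 'f "('f, 'k) gterm list"

primrec gval :: "('f, 'r, 's, 'u) model \<Rightarrow> ('k \<Rightarrow> 'u) \<Rightarrow> ('f, 'k) gterm \<Rightarrow> 'u option" where
  "gval N c (Gen k) = Some (c k)"
| "gval N c (Ap f ts) = (case those (map (gval N c) ts) of None \<Rightarrow> None | Some xs \<Rightarrow> fn N f xs)"

primrec gsort :: "('f, 'r, 's) phl \<Rightarrow> ('k \<Rightarrow> 's) \<Rightarrow> ('f, 'k) gterm \<Rightarrow> 's" where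
  "gsort T ks (Gen k) = ks k"
| "gsort T ks (Ap f ts) = fres T f"

text \<open>The detour through \<open>list_all id (map ...)\<close> puts the recursive call into a
  form that primitive recursion through lists accepts; \<open>gwf_Ap\<close> restores the readable
  form. Well-sorted terms may still be undefined.\<close>

primrec gwf :: "('f, 'r, 's) phl \<Rightarrow> 'k set \<Rightarrow> ('k \<Rightarrow> 's) \<Rightarrow> ('f, 'k) gterm \<Rightarrow> bool" where
  "gwf T K ks (Gen k) \<longleftrightarrow> k \<in> K"
| "gwf T K ks (Ap f ts) \<longleftrightarrow>
     f \<in> fsyms T \<and> list_all id (map (gwf T K ks) ts) \<and> map (gsort T ks) ts = far T f"

primrec gsub :: "(nat \<Rightarrow> 's \<Rightarrow> ('f, 'k) gterm) \<Rightarrow> ('f, 's) trm \<Rightarrow> ('f, 'k) gterm" where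
  "gsub \<theta> (Var i s) = \<theta> i s"
| "gsub \<theta> (App f ts) = Ap f (map (gsub \<theta>) ts)"

declare gval.simps(2) [simp del] gwf.simps(2) [simp del]

lemma gwf_Ap [simp]:
  "gwf T K ks (Ap f ts) \<longleftrightarrow> f \<in> fsyms T \<and> (\<forall>t\<in>set ts. gwf T K ks t) \<and> map (gsort T ks) ts = far T f"
  by (auto simp: list_all_iff gwf.simps(2))

lemma gval_Ap_eq_Some_iff:
  "gval N c (Ap f ts) = Some y \<longleftrightarrow> (\<exists>xs. map (gval N c) ts = map Some xs \<and> fn N f xs = Some y)"
  by (auto simp: those_eq_Some_iff[symmetric] gval.simps(2) split: option.splits)

lemma gval_gsub:
  assumes "\<forall>i s. (i, s) \<in> V \<longrightarrow> gval N c (\<theta> i s) = Some (v i s)" "has_sort T V t s"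
  shows "gval N c (gsub \<theta> t) = tm_val N v t"
  using assms(2)
proof (induction t arbitrary: s)
  case (Var i s')
  then show ?case using assms(1) by simp
next
  case (App f ts)
  have "map (gval N c) (map (gsub \<theta>) ts) = map (tm_val N v) ts"
    using App list_all2_has_sort_D[of T V ts "far T f"] by fastforce
  then show ?case by (simp del: map_map add: gval.simps(2))
qed

lemma gwf_gsub:
  assumes "\<forall>i s. (i, s) \<in> V \<longrightarrow> gwf T K ks (\<theta> i s) \<and> gsort T ks (\<theta> i s) = s" "has_sort T V t s"
  shows "gwf T K ks (gsub \<theta> t) \<and> gsort T ks (gsub \<theta> t) = s"
  using assms(2)
proof (induction t arbitrary: s)
  case (Var i s')
  then show ?case using assms(1) by simp
next
  case (App f ts)
  then have ts: "list_all2 (has_sort T V) ts (far T f)" by simp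
  have *: "gwf T K ks (gsub \<theta> (ts ! i)) \<and> gsort T ks (gsub \<theta> (ts ! i)) = far T f ! i" if "i < length ts" for i
    using App.IH[of "ts ! i" "far T f ! i"] that list_all2_nthD[OF ts that] by simp
  have "map (gsort T ks) (map (gsub \<theta>) ts) = far T f"
    by (rule nth_equalityI) (use * ts in \<open>auto dest: list_all2_lengthD\<close>)
  moreover have "\<forall>t\<in>set (map (gsub \<theta>) ts). gwf T K ks t"
    using * by (auto simp: all_set_conv_all_nth)
  ultimately show ?case using App.prems by (simp del: map_map set_map)
qed

text \<open>
  The closed terms over the generators \<open>K\<close> that are defined in all members of a class \<open>CC\<close> of
  models with chosen generators, modulo equality in all members of \<open>CC\<close>, form a model. It is
  universal for \<open>CC\<close> as soon as \<open>CC\<close> contains it. This avoids working with derivations.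
\<close>

locale term_model =
  fixes T :: "('f, 'r, 's) phl" and K :: "'k set" and ks :: "'k \<Rightarrow> 's"
    and CC :: "('f, 'r, 's, 'u) model \<Rightarrow> ('k \<Rightarrow> 'u) \<Rightarrow> bool"
    and code :: "('f, 'k) gterm \<Rightarrow> 'u"
  assumes wf: "wf_phl T"
    and CC_model: "CC N c \<Longrightarrow> is_model T N"
    and CC_gen: "CC N c \<Longrightarrow> k \<in> K \<Longrightarrow> c k \<in> car N (ks k)"
    and inj_code: "inj_on code {t. gwf T K ks t}"
begin

abbreviation "G \<equiv> {t. gwf T K ks t}"

definition D :: "('f, 'k) gterm set" where
  "D = {t \<in> G. \<forall>N c. CC N c \<longrightarrow> gval N c t \<noteq> None}"

text \<open>Membership in \<open>G\<close> is part of the condition on the right side so that a term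
  chosen to satisfy \<open>equ t\<close> lies in \<open>G\<close>.\<close>

definition equ :: "('f, 'k) gterm \<Rightarrow> ('f, 'k) gterm \<Rightarrow> bool" where
  "equ t u \<longleftrightarrow> u \<in> G \<and> gsort T ks t = gsort T ks u \<and> (\<forall>N c. CC N c \<longrightarrow> gval N c t = gval N c u)"

text \<open>Classes of terms do not have type \<open>'u\<close>, but codes of representatives do.
  Equivalent terms \<open>t\<close> and \<open>u\<close> have the same predicate
  \<open>equ t = equ u\<close>, hence the same chosen representative.\<close>

definition nf :: "('f, 'k) gterm \<Rightarrow> ('f, 'k) gterm" where
  "nf t = (SOME u. equ t u)"

definition q :: "('f, 'k) gterm \<Rightarrow> 'u" where
  "q t = code (nf t)"

definition dec :: "'u \<Rightarrow> ('f, 'k) gterm" where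
  "dec = inv_into G code"

lemma equ_nf: "t \<in> G \<Longrightarrow> equ t (nf t)"
  unfolding nf_def by (rule someI[of _ t]) (simp add: equ_def)

lemma dec_q: "t \<in> G \<Longrightarrow> dec (q t) = nf t"
  using equ_nf[of t] inv_into_f_f[OF inj_code] by (simp add: dec_def q_def equ_def)

lemma equ_dec_q: "t \<in> G \<Longrightarrow> equ t (dec (q t))"
  using dec_q equ_nf by simp

lemma q_eq_iff: "t \<in> G \<Longrightarrow> u \<in> G \<Longrightarrow> q t = q u \<longleftrightarrow> equ t u"
proof
  assume *: "t \<in> G" "u \<in> G" "q t = q u"
  then have "nf t = nf u" using dec_q by metis
  then show "equ t u" using equ_nf[of t] equ_nf[of u] * by (simp add: equ_def)
next
  assume *: "t \<in> G" "u \<in> G" "equ t u"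
  then have "equ t = equ u" by (auto simp: equ_def fun_eq_iff)
  then show "q t = q u" by (simp add: q_def nf_def)
qed

lemma q_cong: "t \<in> G \<Longrightarrow> equ t u \<Longrightarrow> q u = q t"
  using q_eq_iff[of t u] by (simp add: equ_def)

text \<open>Up to coding, this is the submodel generated by the generators in the product of all
  members of \<open>CC\<close>: equality, definedness and relations are tested in every component.
  Arguments are decoded to representatives before an operation is applied.\<close>

definition Term :: "('f, 'r, 's, 'u) model" where
  "Term = \<lparr>car = (\<lambda>s. {q t | t. t \<in> D \<and> gsort T ks t = s}),
    fn = (\<lambda>f xs. if f \<in> fsyms T \<and> list_all2 (\<lambda>s x. x \<in> {q t | t. t \<in> D \<and> gsort T ks t = s}) (far T f) xs \<and>
            Ap f (map dec xs) \<in> D then Some (q (Ap f (map dec xs))) else None),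
    rl = (\<lambda>R xs. R \<in> psyms T \<and> list_all2 (\<lambda>s x. x \<in> {q t | t. t \<in> D \<and> gsort T ks t = s}) (par T R) xs \<and>
            (\<forall>N c. CC N c \<longrightarrow> rl N R (map (\<lambda>x. the (gval N c (dec x))) xs)))\<rparr>"

lemma car_Term: "car Term s = {q t | t. t \<in> D \<and> gsort T ks t = s}"
  by (simp add: Term_def)

lemma fn_Term: "fn Term f xs = (if f \<in> fsyms T \<and> elems Term (far T f) xs \<and> Ap f (map dec xs) \<in> D
    then Some (q (Ap f (map dec xs))) else None)"
  by (simp add: Term_def elems_def)

lemma rl_Term: "rl Term R xs \<longleftrightarrow> R \<in> psyms T \<and> elems Term (par T R) xs \<and>
    (\<forall>N c. CC N c \<longrightarrow> rl N R (map (\<lambda>x. the (gval N c (dec x))) xs))"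
  by (simp add: Term_def elems_def)

lemma DG: "t \<in> D \<Longrightarrow> t \<in> G"
  by (simp add: D_def)

lemma dec_Term:
  assumes "x \<in> car Term s"
  shows "dec x \<in> D" "gsort T ks (dec x) = s" "q (dec x) = x"
proof -
  obtain t where t: "t \<in> D" "gsort T ks t = s" "x = q t" using assms by (auto simp: car_Term)
  note e = equ_dec_q[OF DG[OF t(1)]]
  show "dec x \<in> D" "gsort T ks (dec x) = s" using e t by (auto simp: equ_def D_def)
  show "q (dec x) = x" using e t q_eq_iff[of t "dec x"] DG[OF t(1)] by (auto simp: equ_def)
qed

lemma D_gval: "t \<in> D \<Longrightarrow> CC N c \<Longrightarrow> \<exists>x. gval N c t = Some x"
  by (auto simp: D_def)

lemma D_Ap: "Ap f ts \<in> D \<Longrightarrow> t \<in> set ts \<Longrightarrow> t \<in> D"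
proof -
  assume *: "Ap f ts \<in> D" "t \<in> set ts"
  have "gval N c t \<noteq> None" if "CC N c" for N c
    using D_gval[OF *(1) that] map_eq_map_Some_D[OF _ *(2)] unfolding gval_Ap_eq_Some_iff by blast
  then show "t \<in> D" using * by (auto simp: D_def)
qed

lemma Gen_D: "k \<in> K \<Longrightarrow> Gen k \<in> D"
  by (simp add: D_def)

lemma gval_in_car:
  assumes "CC N c" "t \<in> G" "gval N c t = Some x"
  shows "x \<in> car N (gsort T ks t)"
proof (cases t)
  case (Gen k)
  then show ?thesis using assms CC_gen by auto
next
  case (Ap f ts)
  then obtain xs where "fn N f xs = Some x" using assms(3) gval_Ap_eq_Some_iff by metis
  then show ?thesis using is_model_fnD[OF CC_model[OF assms(1)]] Ap by auto
qed

lemma gval_Ap_cong: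
  "map (gval N c) ts = map (gval N c) us \<Longrightarrow> gval N c (Ap f ts) = gval N c (Ap f us)"
  by (simp add: gval.simps(2))

lemma equ_Ap:
  assumes "Ap f ts \<in> G" "list_all2 equ ts us"
  shows "equ (Ap f ts) (Ap f us)"
proof -
  have "map (gval N c) ts = map (gval N c) us" if "CC N c" for N c
    using assms(2) that by (induction rule: list_all2_induct) (auto simp: equ_def)
  moreover have "map (gsort T ks) ts = map (gsort T ks) us \<and> (\<forall>u\<in>set us. u \<in> G)"
    using assms(2) by (induction rule: list_all2_induct) (auto simp: equ_def)
  ultimately show ?thesis
    using assms(1) unfolding equ_def by (auto intro!: gval_Ap_cong)
qed

lemma equ_D: "equ t u \<Longrightarrow> t \<in> D \<longleftrightarrow> u \<in> D" if "t \<in> G"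
  using that by (auto simp: D_def equ_def)

text \<open>Evaluation in \<open>Term\<close> is reduced to substitution: the elements assigned to
  the variables are replaced by representing terms, which gives one term over the generators that
  can be evaluated in every member of \<open>CC\<close>.\<close>

definition tv :: "(nat \<Rightarrow> 's \<Rightarrow> 'u) \<Rightarrow> ('f, 's) trm \<Rightarrow> ('f, 'k) gterm" where
  "tv v = gsub (\<lambda>i s. dec (v i s))"

lemma tv_G:
  assumes "valuation Term V v" "has_sort T V t s"
  shows "tv v t \<in> G" "gsort T ks (tv v t) = s"
proof -
  have "\<forall>i s. (i, s) \<in> V \<longrightarrow> gwf T K ks (dec (v i s)) \<and> gsort T ks (dec (v i s)) = s"
    using assms(1) dec_Term DG by (fastforce simp: valuation_def)
  from gwf_gsub[OF this assms(2)] show "tv v t \<in> G" "gsort T ks (tv v t) = s"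
    by (auto simp: tv_def)
qed

lemma map_tm_val_Term:
  assumes "valuation Term V v" "list_all2 (has_sort T V) ts ss"
    and "\<forall>t\<in>set ts. tm_val Term v t = (if tv v t \<in> D then Some (q (tv v t)) else None)"
  shows "map (tm_val Term v) ts = map Some xs \<longleftrightarrow>
    (\<forall>t\<in>set ts. tv v t \<in> D) \<and> xs = map (\<lambda>t. q (tv v t)) ts"
  using assms(3) by (induction ts arbitrary: xs) (auto simp: Cons_eq_map_conv split: if_splits)

lemma elems_tv:
  assumes "valuation Term V v" "list_all2 (has_sort T V) ts ss" "\<forall>t\<in>set ts. tv v t \<in> D"
  shows "elems Term ss (map (\<lambda>t. q (tv v t)) ts)"
  using assms(2,3) tv_G[OF assms(1)]
  by (induction rule: list_all2_induct) (auto simp: car_Term)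

lemma tm_val_Term:
  assumes "valuation Term V v" "has_sort T V t s"
  shows "tm_val Term v t = (if tv v t \<in> D then Some (q (tv v t)) else None)"
  using assms(2)
proof (induction t arbitrary: s)
  case (Var i s')
  then have "v i s' \<in> car Term s'" using assms(1) by (auto simp: valuation_def)
  then show ?case using dec_Term by (simp add: tv_def)
next
  case (App f ts)
  then have ts: "list_all2 (has_sort T V) ts (far T f)" by simp
  have IH: "\<forall>t\<in>set ts. tm_val Term v t = (if tv v t \<in> D then Some (q (tv v t)) else None)"
    using App.IH list_all2_has_sort_D[OF ts] by blast
  have tv: "tv v (App f ts) = Ap f (map (tv v) ts)" by (simp add: tv_def)
  have G: "Ap f (map (tv v) ts) \<in> G" using tv_G[OF assms(1) App.prems] tv by simp
  show ?case
  proof (cases "\<forall>t\<in>set ts. tv v t \<in> D")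
    case True
    let ?xs = "map (\<lambda>t. q (tv v t)) ts"
    have xs: "map (tm_val Term v) ts = map Some ?xs"
      using map_tm_val_Term[OF assms(1) ts IH] True by blast
    \<comment> \<open>The operation of \<open>Term\<close> acts on the chosen representatives of the
      arguments, not on the terms \<open>tv v t\<close>; congruence of \<open>equ\<close> bridges
      the difference.\<close>
    have "list_all2 equ (map (tv v) ts) (map dec ?xs)"
      using True equ_dec_q DG by (simp add: list_all2_conv_all_nth)
    note e = equ_Ap[OF G this]
    have "tm_val Term v (App f ts) = fn Term f ?xs"
      using xs by (simp add: those_eq_Some_iff[symmetric] del: map_map)
    also have "\<dots> = (if Ap f (map dec ?xs) \<in> D then Some (q (Ap f (map dec ?xs))) else None)"
      using elems_tv[OF assms(1) ts True] App.prems by (simp add: fn_Term)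
    also have "\<dots> = (if tv v (App f ts) \<in> D then Some (q (tv v (App f ts))) else None)"
      unfolding tv equ_D[OF G e] q_cong[OF G e] ..
    finally show ?thesis .
  next
    case False
    then have "tv v (App f ts) \<notin> D" using D_Ap unfolding tv by fastforce
    moreover have "tm_val Term v (App f ts) \<noteq> Some y" for y
      using map_tm_val_Term[OF assms(1) ts IH] False unfolding tm_val_App_eq_Some_iff by blast
    ultimately show ?thesis by (auto simp del: tm_val.simps)
  qed
qed

text \<open>The projection of a valuation to the component \<open>(N, c)\<close>. Decoded elements
  are defined in all members of \<open>CC\<close>, so \<open>the\<close> is harmless on elements of
  the carriers.\<close>

definition vN :: "(nat \<Rightarrow> 's \<Rightarrow> 'u) \<Rightarrow> ('f, 'r, 's, 'u) model \<Rightarrow> ('k \<Rightarrow> 'u) \<Rightarrow> nat \<Rightarrow> 's \<Rightarrow> 'u" where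
  "vN v N c i s = the (gval N c (dec (v i s)))"

lemma gval_dec_vN:
  assumes "valuation Term V v" "CC N c"
  shows "\<forall>i s. (i, s) \<in> V \<longrightarrow> gval N c (dec (v i s)) = Some (vN v N c i s)"
  using assms dec_Term(1) D_gval by (fastforce simp: valuation_def vN_def)

lemma valuation_vN:
  assumes "valuation Term V v" "CC N c"
  shows "valuation N V (vN v N c)"
  unfolding valuation_def
proof clarify
  fix i s assume "(i, s) \<in> V"
  then have "v i s \<in> car Term s" "gval N c (dec (v i s)) = Some (vN v N c i s)"
    using assms(1) gval_dec_vN[OF assms] by (auto simp: valuation_def)
  then show "vN v N c i s \<in> car N s"
    using gval_in_car[OF assms(2)] dec_Term DG by metis
qed

lemma gval_tv:
  assumes "valuation Term V v" "CC N c" "has_sort T V t s"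
  shows "gval N c (tv v t) = tm_val N (vN v N c) t"
  unfolding tv_def using gval_gsub[OF gval_dec_vN[OF assms(1,2)] assms(3)] .

text \<open>Later used with a generator for \<open>u\<close>, to check that an interpreted operation
  takes the value prescribed by the operations of a given model.\<close>

lemma tm_val_Term_eq_Some_iff:
  assumes "valuation Term V v" "has_sort T V t s" "u \<in> D" "gsort T ks u = s"
  shows "tm_val Term v t = Some (q u) \<longleftrightarrow> (\<forall>N c. CC N c \<longrightarrow> tm_val N (vN v N c) t = gval N c u)"
proof -
  note t = tv_G[OF assms(1,2)]
  have "tm_val Term v t = Some (q u) \<longleftrightarrow> tv v t \<in> D \<and> q (tv v t) = q u"
    using tm_val_Term[OF assms(1,2)] by auto
  also have "\<dots> \<longleftrightarrow> equ (tv v t) u"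
    using q_eq_iff[OF t(1) DG[OF assms(3)]] equ_D[OF t(1), of u] assms(3) by blast
  also have "\<dots> \<longleftrightarrow> (\<forall>N c. CC N c \<longrightarrow> tm_val N (vN v N c) t = gval N c u)"
    using t assms DG gval_tv[OF assms(1) _ assms(2)] by (auto simp: equ_def)
  finally show ?thesis .
qed

text \<open>As in a product, an atom is tested componentwise. Definedness of its terms is included,
  because satisfaction in all components puts them into \<open>D\<close>.\<close>

lemma sat_Term:
  assumes "valuation Term V v" "wf_atom T V a"
  shows "sat Term v a \<longleftrightarrow> (\<forall>N c. CC N c \<longrightarrow> sat N (vN v N c) a)"
proof (cases a)
  case (Eq t u)
  then obtain s where s: "has_sort T V t s" "has_sort T V u s" using assms(2) by auto
  note t = tv_G[OF assms(1) s(1)] and u = tv_G[OF assms(1) s(2)]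
  have "sat Term v a \<longleftrightarrow> tv v t \<in> D \<and> tv v u \<in> D \<and> q (tv v t) = q (tv v u)"
    unfolding Eq sat_Eq_iff using tm_val_Term[OF assms(1) s(1)] tm_val_Term[OF assms(1) s(2)]
    by (auto split: if_splits)
  also have "\<dots> \<longleftrightarrow> tv v t \<in> D \<and> equ (tv v t) (tv v u)"
    using q_eq_iff[OF t(1) u(1)] equ_D[OF t(1)] by blast
  also have "\<dots> \<longleftrightarrow> (\<forall>N c. CC N c \<longrightarrow> sat N (vN v N c) a)"
    using t u gval_tv[OF assms(1) _ s(1)] gval_tv[OF assms(1) _ s(2)]
    by (auto simp: D_def equ_def Eq)
  finally show ?thesis .
next
  case (Rel R ts)
  then have R: "R \<in> psyms T" and ts: "list_all2 (has_sort T V) ts (par T R)" using assms(2) by auto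
  have IH: "\<forall>t\<in>set ts. tm_val Term v t = (if tv v t \<in> D then Some (q (tv v t)) else None)"
    using tm_val_Term[OF assms(1)] list_all2_has_sort_D[OF ts] by blast
  have gv: "gval N c (tv v t) = tm_val N (vN v N c) t" "tv v t \<in> G" if "t \<in> set ts" "CC N c" for t N c
    using gval_tv[OF assms(1) that(2)] tv_G[OF assms(1)] list_all2_has_sort_D[OF ts that(1)] by blast+
  let ?xs = "map (\<lambda>t. q (tv v t)) ts"
  have val: "map (tm_val N (vN v N c)) ts = map Some (map (\<lambda>x. the (gval N c (dec x))) ?xs)"
    if "\<forall>t\<in>set ts. tv v t \<in> D" "CC N c" for N c
  proof -
    have "tm_val N (vN v N c) t = Some (the (gval N c (dec (q (tv v t)))))" if t: "t \<in> set ts" for t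
    proof -
      have "gval N c (dec (q (tv v t))) = gval N c (tv v t)"
        using equ_dec_q[OF gv(2)[OF t \<open>CC N c\<close>]] \<open>CC N c\<close> by (simp add: equ_def)
      moreover obtain x where "gval N c (tv v t) = Some x"
        using D_gval \<open>CC N c\<close> t \<open>\<forall>t\<in>set ts. tv v t \<in> D\<close> by blast
      ultimately show ?thesis using gv(1)[OF t \<open>CC N c\<close>] by simp
    qed
    then show ?thesis by simp
  qed
  have "sat Term v a \<longleftrightarrow> (\<forall>t\<in>set ts. tv v t \<in> D) \<and> rl Term R ?xs"
    unfolding Rel sat_Rel_iff map_tm_val_Term[OF assms(1) ts IH] by blast
  also have "\<dots> \<longleftrightarrow> (\<forall>t\<in>set ts. tv v t \<in> D) \<and>
      (\<forall>N c. CC N c \<longrightarrow> rl N R (map (\<lambda>x. the (gval N c (dec x))) ?xs))"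
    unfolding rl_Term using elems_tv[OF assms(1) ts] R by blast
  also have "\<dots> \<longleftrightarrow> (\<forall>N c. CC N c \<longrightarrow> sat N (vN v N c) a)" (is "?l \<longleftrightarrow> ?r")
  proof
    assume ?l
    then show ?r unfolding Rel sat_Rel_iff using val by blast
  next
    assume r: ?r
    have D: "\<forall>t\<in>set ts. tv v t \<in> D"
    proof
      fix t assume t: "t \<in> set ts"
      have "gval N c (tv v t) \<noteq> None" if "CC N c" for N c
        using r that map_eq_map_Some_D[OF _ t] unfolding Rel sat_Rel_iff gv(1)[OF t that] by blast
      moreover have "tv v t \<in> G" using tv_G[OF assms(1)] list_all2_has_sort_D[OF ts t] by blast
      ultimately show "tv v t \<in> D" by (simp add: D_def)
    qed
    moreover have "rl N R (map (\<lambda>x. the (gval N c (dec x))) ?xs)" if "CC N c" for N c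
    proof -
      obtain ys where "map (tm_val N (vN v N c)) ts = map Some ys" "rl N R ys"
        using r \<open>CC N c\<close> unfolding Rel sat_Rel_iff by blast
      then show ?thesis using val[OF D that] by (metis inj_map_eq_map inj_Some)
    qed
    ultimately show ?l by blast
  qed
  finally show ?thesis .
qed

lemma sat_horn_Term:
  assumes "valuation Term V v" "wf_horn T V \<phi>"
  shows "sat_horn Term v \<phi> \<longleftrightarrow> (\<forall>N c. CC N c \<longrightarrow> sat_horn N (vN v N c) \<phi>)"
  using sat_Term[OF assms(1)] assms(2) by (auto simp: sat_horn_def wf_horn_def)

text \<open>A premise that holds in \<open>Term\<close> holds in each component; the axiom, applied
  there, gives the conclusion in each component and hence in \<open>Term\<close>.\<close>

lemma is_model_Term: "is_model T Term"
  unfolding is_model_def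
proof (intro conjI allI impI)
  show "f \<in> fsyms T" "elems Term (far T f) xs" "y \<in> car Term (fres T f)" if "fn Term f xs = Some y" for f xs y
    using that by (force simp: fn_Term car_Term split: if_splits)+
  show "R \<in> psyms T" "elems Term (par T R) xs" if "rl Term R xs" for R xs
    using that by (simp_all add: rl_Term)
  show "\<forall>(V, \<phi>, \<psi>)\<in>axioms T. \<forall>v. (\<forall>(i, s)\<in>V. v i s \<in> car Term s) \<longrightarrow>
        sat_horn Term v \<phi> \<longrightarrow> sat_horn Term v \<psi>"
  proof clarify
    fix V \<phi> \<psi> v
    assume ax: "(V, \<phi>, \<psi>) \<in> axioms T" and "\<forall>(i, s)\<in>V. v i s \<in> car Term s" and \<phi>: "sat_horn Term v \<phi>"
    then have v: "valuation Term V v" by (simp add: valuation_def)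
    have w: "wf_horn T V \<phi>" "wf_horn T V \<psi>" using wf ax by (auto simp: wf_phl_def)
    show "sat_horn Term v \<psi>"
      using \<phi> is_model_axiomD[OF CC_model ax valuation_vN[OF v]]
      unfolding sat_horn_Term[OF v w(1)] sat_horn_Term[OF v w(2)] by blast
  qed
qed

definition gen :: "'k \<Rightarrow> 'u" where
  "gen k = q (Gen k)"

lemma gen_in_car: "k \<in> K \<Longrightarrow> gen k \<in> car Term (ks k)"
  using Gen_D by (force simp: car_Term gen_def)

lemma gval_dec_gen: "k \<in> K \<Longrightarrow> CC N c \<Longrightarrow> gval N c (dec (gen k)) = Some (c k)"
  using equ_dec_q[of "Gen k"] by (simp add: gen_def equ_def)

definition the_hom :: "('f, 'r, 's, 'u) model \<Rightarrow> ('k \<Rightarrow> 'u) \<Rightarrow> 's \<Rightarrow> 'u \<Rightarrow> 'u" where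
  "the_hom N c s x = (if x \<in> car Term s then the (gval N c (dec x)) else undefined)"

lemma map2_the_hom:
  assumes "elems Term ss xs" "CC N c"
  shows "map (gval N c) (map dec xs) = map Some (map2 (the_hom N c) ss xs)"
    "map2 (the_hom N c) ss xs = map (\<lambda>x. the (gval N c (dec x))) xs"
proof -
  have *: "gval N c (dec x) = Some (the_hom N c s x)" if "x \<in> car Term s" for s x
    using that D_gval[OF dec_Term(1)[OF that] assms(2)] by (auto simp: the_hom_def)
  show "map (gval N c) (map dec xs) = map Some (map2 (the_hom N c) ss xs)"
    "map2 (the_hom N c) ss xs = map (\<lambda>x. the (gval N c (dec x))) xs"
    using assms(1) unfolding elems_def by (induction rule: list_all2_induct) (auto simp: *)
qed

lemma is_hom_the_hom:
  assumes "CC N c"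
  shows "is_hom T Term N (the_hom N c)"
  unfolding is_hom_def
proof (intro conjI allI impI)
  show "if a \<in> car Term s then the_hom N c s a \<in> car N s else the_hom N c s a = undefined" for s a
  proof (cases "a \<in> car Term s")
    case True
    then obtain x where "gval N c (dec a) = Some x" using D_gval[OF dec_Term(1) assms] by blast
    then show ?thesis using gval_in_car[OF assms DG[OF dec_Term(1)[OF True]]] dec_Term(2)[OF True] True
      by (simp add: the_hom_def)
  qed (simp add: the_hom_def)
  show "fn N f (map2 (the_hom N c) (far T f) xs) = Some (the_hom N c (fres T f) y)"
    if "fn Term f xs = Some y" for f xs y
  proof -
    from that have *: "elems Term (far T f) xs" "Ap f (map dec xs) \<in> D" "y = q (Ap f (map dec xs))"
      by (auto simp: fn_Term split: if_splits)
    then have y: "y \<in> car Term (fres T f)" by (force simp: car_Term)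
    have "gval N c (dec y) = gval N c (Ap f (map dec xs))"
      using equ_dec_q[OF DG[OF *(2)]] assms unfolding *(3) by (simp add: equ_def)
    also have "\<dots> = fn N f (map2 (the_hom N c) (far T f) xs)"
      using map2_the_hom(1)[OF *(1) assms]
      by (simp add: gval.simps(2) those_eq_Some_iff[symmetric] del: map_map)
    finally show ?thesis using D_gval[OF dec_Term(1)[OF y] assms] y by (auto simp: the_hom_def)
  qed
  show "rl N R (map2 (the_hom N c) (par T R) xs)" if "rl Term R xs" for R xs
    using that map2_the_hom(2)[OF _ assms] assms by (auto simp: rl_Term)
qed

lemma the_hom_gen: "CC N c \<Longrightarrow> k \<in> K \<Longrightarrow> the_hom N c (ks k) (gen k) = c k"
  using gen_in_car gval_dec_gen by (simp add: the_hom_def)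

text \<open>Every element is the class of a term in the generators, and subterms of a term in
  \<open>D\<close> are in \<open>D\<close>. Induction on the term thus stays inside
  \<open>Term\<close>, where homomorphisms commute with the operations.\<close>

lemma hom_unique:
  assumes "is_hom T Term N h" "is_hom T Term N h'" "\<And>k. k \<in> K \<Longrightarrow> h (ks k) (gen k) = h' (ks k) (gen k)"
  shows "h = h'"
proof -
  have *: "h (gsort T ks t) (q t) = h' (gsort T ks t) (q t)" if "t \<in> D" for t
    using that
  proof (induction t)
    case (Gen k)
    then show ?case using assms(3) by (simp add: gen_def D_def)
  next
    case (Ap f ts)
    let ?xs = "map q ts"
    have G: "Ap f ts \<in> G" using DG[OF Ap.prems] .
    then have f: "f \<in> fsyms T" "map (gsort T ks) ts = far T f" by auto
    have D: "\<forall>t\<in>set ts. t \<in> D" using D_Ap[OF Ap.prems] by blast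
    have el: "elems Term (far T f) ?xs" unfolding f(2)[symmetric]
      using D by (auto simp: elems_def list_all2_conv_all_nth car_Term)
    have "list_all2 equ ts (map dec ?xs)"
      using D equ_dec_q DG by (simp add: list_all2_conv_all_nth)
    note e = equ_Ap[OF G this]
    have fn: "fn Term f ?xs = Some (q (Ap f ts))"
      using f el equ_D[OF G e] Ap.prems q_cong[OF G e] by (simp add: fn_Term del: map_map)
    have "map2 h (far T f) ?xs = map2 h' (far T f) ?xs"
      unfolding f(2)[symmetric] using Ap.IH D by (auto simp: zip_map_map zip_same_conv_map)
    then show ?case
      using is_homD(3)[OF assms(1) fn] is_homD(3)[OF assms(2) fn]
      by (metis gsort.simps(2) option.inject)
  qed
  show ?thesis
  proof (intro ext)
    fix s x
    show "h s x = h' s x"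
    proof (cases "x \<in> car Term s")
      case True
      then show ?thesis using * by (auto simp: car_Term)
    next
      case False
      then show ?thesis using is_homD(2)[OF assms(1)] is_homD(2)[OF assms(2)] by simp
    qed
  qed
qed

end

section \<open>Cardinalities\<close>

text \<open>A code of lists by iterated pairing inside \<open>'u\<close>. The leading
  \<open>a\<close> or \<open>b\<close> is a tag that keeps the empty list apart from a nonempty one,
  whence the condition \<open>a \<noteq> b\<close>.\<close>

definition enc_list :: "('u \<times> 'u \<Rightarrow> 'u) \<Rightarrow> 'u \<Rightarrow> 'u \<Rightarrow> 'u list \<Rightarrow> 'u" where
  "enc_list p a b xs = foldr (\<lambda>x y. p (b, p (x, y))) xs (p (a, a))"

lemma enc_list_inj:
  assumes "inj p" "a \<noteq> b" "enc_list p a b xs = enc_list p a b ys"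
  shows "xs = ys"
  using assms(3)
proof (induction xs arbitrary: ys)
  case Nil
  then show ?case using assms(1,2) by (cases ys) (auto simp: enc_list_def inj_eq)
next
  case (Cons x xs)
  then show ?case using assms(1,2) by (cases ys) (auto simp: enc_list_def inj_eq)
qed

primrec gcode :: "('u \<times> 'u \<Rightarrow> 'u) \<Rightarrow> 'u \<Rightarrow> 'u \<Rightarrow> ('f \<Rightarrow> 'u) \<Rightarrow> ('k \<Rightarrow> 'u) \<Rightarrow> ('f, 'k) gterm \<Rightarrow> 'u" where
  "gcode p a b fc kc (Gen k) = p (a, kc k)"
| "gcode p a b fc kc (Ap f ts) = p (b, p (fc f, enc_list p a b (map (gcode p a b fc kc) ts)))"

text \<open>Injectivity is confined to well-sorted terms, since symbols and generators are coded
  injectively only on \<open>fsyms T\<close> and \<open>K\<close>. The pairing and the tags let the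
  head and the arguments be read off.\<close>

lemma gcode_inj:
  assumes "inj p" "a \<noteq> b" "inj_on fc (fsyms T)" "inj_on kc K"
    "gwf T K ks t" "gwf T K ks u" "gcode p a b fc kc t = gcode p a b fc kc u"
  shows "t = u"
  using assms(5-7)
proof (induction t arbitrary: u)
  case (Gen k)
  then obtain k' where u: "u = Gen k'" using assms(1,2) by (cases u) (auto simp: inj_eq)
  then have "kc k = kc k'" "k \<in> K" "k' \<in> K" using Gen assms(1) by (auto simp: inj_eq)
  then show ?case using inj_onD[OF assms(4)] u by blast
next
  case (Ap f ts)
  then obtain g us where u: "u = Ap g us" using assms(1,2) by (cases u) (auto simp: inj_eq)
  have enc: "map (gcode p a b fc kc) ts = map (gcode p a b fc kc) us"
    using Ap.prems(3) assms(1) by (intro enc_list_inj[OF assms(1,2)]) (simp add: u inj_eq)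
  have "fc f = fc g" using Ap.prems(3) assms(1) by (simp add: u inj_eq)
  moreover have "f \<in> fsyms T" "g \<in> fsyms T" using Ap.prems by (simp_all add: u)
  ultimately have "f = g" using inj_onD[OF assms(3)] by blast
  moreover have "ts = us"
  proof (rule nth_equalityI)
    show len: "length ts = length us" using enc by (metis length_map)
    fix i assume i: "i < length ts"
    then have "gcode p a b fc kc (ts ! i) = gcode p a b fc kc (us ! i)"
      using enc len by (metis nth_map)
    then show "ts ! i = us ! i" using Ap.IH[of "ts ! i" "us ! i"] Ap.prems(1,2) i len by (auto simp: u)
  qed
  ultimately show ?case by (simp add: u)
qed

text \<open>An infinite set has the same cardinality as its square.\<close>

lemma ex_inj_pair: "infinite (UNIV :: 'u set) \<Longrightarrow> \<exists>p :: 'u \<times> 'u \<Rightarrow> 'u. inj p"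
  using card_of_Times_same_infinite[of "UNIV :: 'u set"] ordIso_iff_ordLeq card_of_ordLeq
  by (metis UNIV_Times_UNIV)

lemma ex_inj_nat: "infinite (UNIV :: 'u set) \<Longrightarrow> \<exists>e :: nat \<Rightarrow> 'u. inj e"
  by (simp add: infinite_iff_countable_subset)

lemma ex_inj_gterm:
  fixes fc :: "'f \<Rightarrow> 'u" and kc :: "'k \<Rightarrow> 'u"
  assumes "infinite (UNIV :: 'u set)" "inj_on fc (fsyms T)" "inj_on kc K"
  shows "\<exists>code :: ('f, 'k) gterm \<Rightarrow> 'u. inj_on code {t. gwf T K ks t}"
proof -
  obtain p :: "'u \<times> 'u \<Rightarrow> 'u" where p: "inj p" using ex_inj_pair[OF assms(1)] by blast
  obtain e :: "nat \<Rightarrow> 'u" where "inj e" using ex_inj_nat[OF assms(1)] by blast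
  then have "e 0 \<noteq> e 1" by (simp add: inj_eq)
  then have inj: "inj_on (gcode p (e 0) (e 1) fc kc) {t. gwf T K ks t}"
    by (intro inj_onI gcode_inj[OF p _ assms(2,3)]) simp_all
  show ?thesis by (rule exI) (rule inj)
qed

fun pk_code :: "pk \<Rightarrow> nat" where
  "pk_code TY = 0"
| "pk_code TM = 1"

text \<open>The first entry tags the constructor. The lists become elements of \<open>'u\<close>
  through \<open>enc_list\<close>, so that \<open>g\<close> has to code the basic symbols
  only.\<close>

fun fsym_code :: "('f \<Rightarrow> 'u) \<Rightarrow> (nat \<Rightarrow> 'u) \<Rightarrow> 'f fsym \<Rightarrow> 'u list" where
  "fsym_code g e One = [e 0]"
| "fsym_code g e (Ft n) = [e 1, e n]"
| "fsym_code g e (TyOf n) = [e 2, e n]"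
| "fsym_code g e (Vr n i) = [e 3, e n, e i]"
| "fsym_code g e (Subst p n k) = [e 4, e (pk_code p), e n, e k]"
| "fsym_code g e (Op f n) = [e 5, e n, g f]"

lemma pk_code_inj: "pk_code p = pk_code p' \<longleftrightarrow> p = p'"
  by (cases p; cases p') auto

lemma inj_on_fsym_code: "inj e \<Longrightarrow> inj_on g (ops T) \<Longrightarrow> inj_on (fsym_code g e) (sym_set T)"
proof (rule inj_onI)
  fix f f' assume "inj e" "inj_on g (ops T)" "f \<in> sym_set T" "f' \<in> sym_set T" "fsym_code g e f = fsym_code g e f'"
  then show "f = f'" by (cases f; cases f') (auto simp: inj_eq pk_code_inj dest: inj_onD)
qed

lemma ex_inj_sym_set:
  fixes T :: "('f, 'r) id_theory"
  assumes "small_theory TYPE('u) T"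
  shows "\<exists>fc :: 'f fsym \<Rightarrow> 'u. inj_on fc (fsyms (phl_of T))"
proof -
  from assms obtain g :: "'f \<Rightarrow> 'u" where inf: "infinite (UNIV :: 'u set)" and g: "inj_on g (ops T)"
    by (auto simp: small_theory_def)
  obtain p :: "'u \<times> 'u \<Rightarrow> 'u" where p: "inj p" using ex_inj_pair[OF inf] by blast
  obtain e :: "nat \<Rightarrow> 'u" where e: "inj e" using ex_inj_nat[OF inf] by blast
  then have "e 0 \<noteq> e 1" by (simp add: inj_eq)
  then have "inj_on (\<lambda>f. enc_list p (e 0) (e 1) (fsym_code g e f)) (sym_set T)"
    using inj_on_fsym_code[OF e g] enc_list_inj[OF p]
    by (intro inj_onI) (meson inj_onD)
  then show ?thesis by auto
qed

text \<open>Carriers of different sorts may overlap, so an element used as a generator must be coded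
  together with its sort.\<close>

lemma ex_inj_sorted:
  assumes "infinite (UNIV :: 'u set)"
  shows "\<exists>kc :: sort \<times> 'u \<Rightarrow> 'u. inj kc"
proof -
  obtain p :: "'u \<times> 'u \<Rightarrow> 'u" where p: "inj p" using ex_inj_pair[OF assms] by blast
  obtain e :: "nat \<Rightarrow> 'u" where e: "inj e" using ex_inj_nat[OF assms] by blast
  define kc where "kc = (\<lambda>((k, n), x). p (e (case k of Ctx \<Rightarrow> 0 | Tm \<Rightarrow> 1), p (e n, x)))"
  have "inj kc"
  proof (rule injI)
    fix a b assume "kc a = kc b"
    moreover obtain k n x k' n' x' where "a = ((k, n), x)" "b = ((k', n'), x')"
      by (metis surj_pair)
    ultimately show "a = b" using p e by (auto simp: kc_def inj_eq split: kind.splits)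
  qed
  then show ?thesis by (intro exI)
qed

section \<open>Free models\<close>

lemma sub_Var [simp]: "sub Var t = t"
  by (induction t) (auto intro: map_idI)

lemma sub_atom_Var [simp]: "sub_atom Var a = a"
  by (cases a) (auto intro: map_idI)

text \<open>The substitution lemma for the identity substitution \<open>Var\<close>: only the values
  at variables in \<open>V\<close> enter.\<close>

lemma sat_horn_cong:
  assumes "wf_horn T V \<phi>" "\<forall>i s. (i, s) \<in> V \<longrightarrow> v i s = w i s"
  shows "sat_horn M v \<phi> \<longleftrightarrow> sat_horn M w \<phi>"
  using sat_horn_sub[of V M v Var w T \<phi>] assms by (simp add: map_idI)

lemma tm_val_cong:
  assumes "has_sort T V t s" "\<forall>i s. (i, s) \<in> V \<longrightarrow> v i s = w i s"
  shows "tm_val M v t = tm_val M w t"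
  using tm_val_sub[of V M v Var w T t s] assms by simp

lemma small_theory_term_model:
  fixes T :: "('f, 'r) id_theory" and kc :: "'k \<Rightarrow> 'u"
  assumes "is_theory T" "small_theory TYPE('u) T" "inj_on kc K"
    "\<And>N c. CC N c \<Longrightarrow> is_model (phl_of T) N"
    "\<And>N c k. CC N c \<Longrightarrow> k \<in> K \<Longrightarrow> c k \<in> car N (ks k)"
  shows "\<exists>code :: ('f fsym, 'k) gterm \<Rightarrow> 'u. term_model (phl_of T) K ks CC code"
proof -
  have "infinite (UNIV :: 'u set)" using assms(2) by (simp add: small_theory_def)
  moreover obtain fc :: "'f fsym \<Rightarrow> 'u" where "inj_on fc (fsyms (phl_of T))"
    using ex_inj_sym_set[OF assms(2)] by blast
  ultimately obtain code :: "('f fsym, 'k) gterm \<Rightarrow> 'u" where "inj_on code {t. gwf (phl_of T) K ks t}"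
    using ex_inj_gterm[OF _ _ assms(3)] by blast
  then have "term_model (phl_of T) K ks CC code"
    using assms is_theory_wf_phl by unfold_locales auto
  then show ?thesis by blast
qed

lemma Obj_Mod [simp]: "M \<in> Obj (Mod T) \<longleftrightarrow> is_model (phl_of T) M"
  by (simp add: Mod_def)

text \<open>The class consists of all models with a chosen tuple satisfying \<open>\<phi>\<close>.
  As \<open>Term\<close> tests formulas componentwise, its generators satisfy \<open>\<phi>\<close>
  too; projections give the homomorphisms, and generation by \<open>gen\<close> makes them
  unique.\<close>

lemma ex_free_model:
  fixes T :: "('f, 'r) id_theory"
  assumes T: "is_theory T" "small_theory TYPE('u) T"
    and \<phi>: "wf_horn (phl_of T) (ctxvars ss) \<phi>"
  shows "\<exists>M xs. free_model T ss (\<lambda>M xs. sat_horn M (\<lambda>i s. xs ! i) \<phi>) (M :: ('f, 'r, 'u) smodel) xs"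
proof -
  define K where "K = {..<length ss}"
  define CC :: "('f, 'r, 'u) smodel \<Rightarrow> (nat \<Rightarrow> 'u) \<Rightarrow> bool" where
    "CC N c \<longleftrightarrow> is_model (phl_of T) N \<and> (\<forall>i\<in>K. c i \<in> car N (ss ! i)) \<and> sat_horn N (\<lambda>i s. c i) \<phi>" for N c
  obtain e :: "nat \<Rightarrow> 'u" where "inj e" using ex_inj_nat T(2) by (auto simp: small_theory_def)
  then obtain code :: "('f fsym, nat) gterm \<Rightarrow> 'u" where
    "term_model (phl_of T) K (\<lambda>i. ss ! i) CC code"
    using small_theory_term_model[OF T, of e K CC "\<lambda>i. ss ! i"] by (auto simp: CC_def inj_on_def)
  then interpret term_model "phl_of T" K "\<lambda>i. ss ! i" CC code .
  define xs where "xs = map gen [0..<length ss]"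
  have el: "elems Term ss xs"
    using gen_in_car by (auto simp: xs_def elems_def list_all2_conv_all_nth K_def)
  have vN: "\<forall>i s. (i, s) \<in> ctxvars ss \<longrightarrow> vN (\<lambda>i s. xs ! i) N c i s = c i" if "CC N c" for N c
  proof (intro allI impI)
    fix i s assume "(i, s) \<in> ctxvars ss"
    then have "i \<in> K" "xs ! i = gen i" by (simp_all add: ctxvars_iff K_def xs_def)
    then show "vN (\<lambda>i s. xs ! i) N c i s = c i" using gval_dec_gen[OF _ that] by (simp add: vN_def)
  qed
  have "sat_horn Term (\<lambda>i s. xs ! i) \<phi>"
    unfolding sat_horn_Term[OF valuation_nth[OF el] \<phi>]
  proof (intro allI impI)
    fix N c assume "CC N c"
    then show "sat_horn N (vN (\<lambda>i s. xs ! i) N c) \<phi>"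
      unfolding sat_horn_cong[OF \<phi> vN[OF \<open>CC N c\<close>]] by (simp add: CC_def)
  qed
  moreover have "\<exists>!h. is_hom (phl_of T) Term N h \<and> map2 h ss xs = ys"
    if N: "is_model (phl_of T) N" "elems N ss ys" "sat_horn N (\<lambda>i s. ys ! i) \<phi>" for N ys
  proof -
    have len: "length ys = length ss" using elems_length[OF N(2)] .
    have CC: "CC N (\<lambda>i. ys ! i)" using N elems_nth[OF N(2)] by (simp add: CC_def K_def)
    show ?thesis
    proof (rule ex1I, rule conjI)
      show "is_hom (phl_of T) Term N (the_hom N (\<lambda>i. ys ! i))" by (rule is_hom_the_hom[OF CC])
      show "map2 (the_hom N (\<lambda>i. ys ! i)) ss xs = ys"
        by (rule nth_equalityI) (use len the_hom_gen[OF CC] in \<open>auto simp: xs_def K_def\<close>)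
      fix h assume h: "is_hom (phl_of T) Term N h \<and> map2 h ss xs = ys"
      show "h = the_hom N (\<lambda>i. ys ! i)"
      proof (rule hom_unique)
        fix k assume k: "k \<in> K"
        then have "h (ss ! k) (gen k) = map2 h ss xs ! k" by (simp add: K_def xs_def)
        then show "h (ss ! k) (gen k) = the_hom N (\<lambda>i. ys ! i) (ss ! k) (gen k)"
          using the_hom_gen[OF CC k] h by simp
      qed (use h is_hom_the_hom[OF CC] in auto)
    qed
  qed
  ultimately have "free_model T ss (\<lambda>M xs. sat_horn M (\<lambda>i s. xs ! i) \<phi>) Term xs"
    using el is_model_Term unfolding free_model_def Obj_Mod by blast
  then show ?thesis by blast
qed

section \<open>The category of models\<close>

lemma Hom_Mod [simp]:
  "a \<in> Hom (Mod T) M N \<longleftrightarrow>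
     (\<exists>h. a = (M, h, N) \<and> is_model (phl_of T) M \<and> is_model (phl_of T) N \<and> is_hom (phl_of T) M N h)"
  by (auto simp: Hom_def Mod_def)

lemma Arr_Mod [simp]:
  "(M, h, N) \<in> Arr (Mod T) \<longleftrightarrow> is_model (phl_of T) M \<and> is_model (phl_of T) N \<and> is_hom (phl_of T) M N h"
  by (simp add: Mod_def)

lemma Dom_Cod_Mod [simp]: "Dom (Mod T) (M, h, N) = M" "Cod (Mod T) (M, h, N) = N"
  by (simp_all add: Mod_def)

definition hcomp ::
  "('f, 'r, 's, 'u) model \<Rightarrow> ('s \<Rightarrow> 'u \<Rightarrow> 'u) \<Rightarrow> ('s \<Rightarrow> 'u \<Rightarrow> 'u) \<Rightarrow> 's \<Rightarrow> 'u \<Rightarrow> 'u" where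
  "hcomp M g h s a = (if a \<in> car M s then g s (h s a) else undefined)"

lemma Comp_Mod [simp]: "Comp (Mod T) (M', g, N) (M, h, N') = (M, hcomp M g h, N)"
  by (simp add: Mod_def hcomp_def fun_eq_iff)

lemma map2_hcomp: "elems M ss xs \<Longrightarrow> map2 (hcomp M g h) ss xs = map2 g ss (map2 h ss xs)"
  unfolding elems_def by (induction rule: list_all2_induct) (auto simp: hcomp_def)

lemma is_hom_hcomp:
  assumes "is_model T M" "is_hom T M N h" "is_hom T N P g"
  shows "is_hom T M P (hcomp M g h)"
  unfolding is_hom_def
proof (intro conjI allI impI)
  show "if a \<in> car M s then hcomp M g h s a \<in> car P s else hcomp M g h s a = undefined" for s a
    using is_homD(1)[OF assms(2)] is_homD(1)[OF assms(3)] by (simp add: hcomp_def)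
  show "fn P f (map2 (hcomp M g h) (far T f) xs) = Some (hcomp M g h (fres T f) y)"
    if "fn M f xs = Some y" for f xs y
    using is_homD(3)[OF assms(3) is_homD(3)[OF assms(2) that]] is_model_fnD[OF assms(1) that]
    by (simp add: map2_hcomp) (simp add: hcomp_def)
  show "rl P R (map2 (hcomp M g h) (par T R) xs)" if "rl M R xs" for R xs
    using is_homD(4)[OF assms(3) is_homD(4)[OF assms(2) that]] is_model_rlD[OF assms(1) that]
    by (simp add: map2_hcomp)
qed

definition hid :: "('f, 'r, 's, 'u) model \<Rightarrow> 's \<Rightarrow> 'u \<Rightarrow> 'u" where
  "hid M s a = (if a \<in> car M s then a else undefined)"

lemma Ident_Mod [simp]: "Ident (Mod T) M = (M, hid M, M)"
  by (simp add: Mod_def hid_def fun_eq_iff)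

lemma map2_hid: "elems M ss xs \<Longrightarrow> map2 (hid M) ss xs = xs"
  unfolding elems_def by (induction rule: list_all2_induct) (auto simp: hid_def)

lemma is_hom_hid: "is_model T M \<Longrightarrow> is_hom T M M (hid M)"
  unfolding is_hom_def
  using is_model_fnD[of T M] is_model_rlD[of T M] by (auto simp: map2_hid hid_def)

lemma hcomp_hid_left: "is_hom T M N h \<Longrightarrow> hcomp M (hid N) h = h"
  by (auto simp: fun_eq_iff hcomp_def hid_def is_homD(1,2))

lemma hcomp_hid_right: "is_hom T M N h \<Longrightarrow> hcomp M h (hid M) = h"
  by (auto simp: fun_eq_iff hcomp_def hid_def is_homD(1,2))

lemma hcomp_assoc: "is_hom T M N h \<Longrightarrow> hcomp M (hcomp N k g) h = hcomp M k (hcomp M g h)"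
  by (auto simp: fun_eq_iff hcomp_def is_homD(1))

lemma free_model_Nil_initial:
  "free_model T [] (\<lambda>M xs. sat_horn M (\<lambda>i s. xs ! i) []) M xs \<Longrightarrow> initial (Mod T) M"
  unfolding free_model_def initial_def by (simp add: Ex1_def)

lemma ex_initial:
  fixes T :: "('f, 'r) id_theory"
  assumes "is_theory T" "small_theory TYPE('u) T"
  shows "\<exists>M :: ('f, 'r, 'u) smodel. initial (Mod T) M"
  using ex_free_model[OF assms, of "[]" "[]"] free_model_Nil_initial by fastforce

section \<open>The terminal model\<close>

text \<open>All operations are total and all predicates true. The single element is
  \<open>undefined\<close>, the value that homomorphisms take outside the carriers, so that the only
  homomorphism to this model is a constant function.\<close>

definition one_model :: "('f, 'r, 's) phl \<Rightarrow> ('f, 'r, 's, 'u) model" where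
  "one_model T = \<lparr>car = (\<lambda>s. {undefined}),
     fn = (\<lambda>f xs. if f \<in> fsyms T \<and> xs = map (\<lambda>s. undefined) (far T f) then Some undefined else None),
     rl = (\<lambda>R xs. R \<in> psyms T \<and> xs = map (\<lambda>s. undefined) (par T R))\<rparr>"

lemma elems_one_model: "elems (one_model T) ss xs \<longleftrightarrow> xs = map (\<lambda>s. undefined) ss"
  by (induction ss arbitrary: xs) (auto simp: one_model_def)

lemma tm_val_one_model:
  fixes T :: "('f, 'r, 's) phl"
  assumes "valuation (one_model T) V v" "has_sort T V t s"
  shows "tm_val (one_model T) v t = Some undefined"
  using assms(2)
proof (induction t arbitrary: s)
  case (Var i s')
  then show ?case using assms(1) by (auto simp: valuation_def one_model_def)
next
  case (App f ts)
  then have ts: "list_all2 (has_sort T V) ts (far T f)" by simp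
  then have "map (tm_val (one_model T) v) ts = map Some (map (\<lambda>s. undefined) (far T f))"
    using App.IH list_all2_has_sort_D[OF ts] list_all2_lengthD[OF ts]
    by (intro nth_equalityI) (auto, metis nth_mem)
  then show ?case using App.prems unfolding tm_val_App_eq_Some_iff by (auto simp: one_model_def)
qed

lemma sat_one_model:
  assumes "valuation (one_model T) V v" "wf_atom T V a"
  shows "sat (one_model T) v a"
proof (cases a)
  case (Eq t u)
  then obtain s where "has_sort T V t s" "has_sort T V u s" using assms(2) by auto
  then show ?thesis using tm_val_one_model[OF assms(1)] by (simp add: Eq)
next
  case (Rel R ts)
  then have R: "R \<in> psyms T" and ts: "list_all2 (has_sort T V) ts (par T R)" using assms(2) by auto
  have "tm_val (one_model T) v t = Some undefined" if "t \<in> set ts" for t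
    using tm_val_one_model[OF assms(1)] list_all2_has_sort_D[OF ts that] by blast
  then have "map (tm_val (one_model T) v) ts = map Some (map (\<lambda>s. undefined) (par T R))"
    using list_all2_lengthD[OF ts] by (intro nth_equalityI) auto
  then show ?thesis using R unfolding Rel sat_Rel_iff by (auto simp: one_model_def)
qed

lemma is_model_one_model: "wf_phl (T :: ('f, 'r, 's) phl) \<Longrightarrow> is_model T (one_model T)"
  unfolding is_model_def elems_one_model
proof (intro conjI)
  assume wf: "wf_phl T"
  show "\<forall>(V, \<phi>, \<psi>)\<in>axioms T. \<forall>v. (\<forall>(i, s)\<in>V. v i s \<in> car (one_model T) s) \<longrightarrow>
        sat_horn (one_model T) v \<phi> \<longrightarrow> sat_horn (one_model T) v \<psi>"
  proof clarify
    fix V \<phi> \<psi> v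
    assume ax: "(V, \<phi>, \<psi>) \<in> axioms T" and "\<forall>(i, s)\<in>V. v i s \<in> car (one_model T) s"
    then have "valuation (one_model T) V v" by (simp add: valuation_def)
    then show "sat_horn (one_model T) v \<psi>" using wf ax sat_one_model
      by (fastforce simp: wf_phl_def sat_horn_def wf_horn_def)
  qed
qed (auto simp: one_model_def)

lemma terminal_one_model:
  assumes "wf_phl (phl_of T)"
  shows "terminal (Mod T) (one_model (phl_of T))"
  unfolding terminal_def
proof (intro conjI ballI)
  let ?I = "one_model (phl_of T)"
  show "?I \<in> Obj (Mod T)" using is_model_one_model[OF assms] by simp
  fix M assume M: "M \<in> Obj (Mod T)"
  have el: "map2 (\<lambda>s a. undefined) ss xs = map (\<lambda>s. undefined) ss" if "elems M ss xs" for ss xs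
    using that unfolding elems_def by (induction rule: list_all2_induct) auto
  have "is_hom (phl_of T) M ?I (\<lambda>s a. undefined)"
    unfolding is_hom_def using M is_model_fnD[of "phl_of T" M] is_model_rlD[of "phl_of T" M]
    by (auto simp: el one_model_def simp del: phl_of_simps)
  moreover have "h = (\<lambda>s a. undefined)" if "is_hom (phl_of T) M ?I h" for h
    using is_homD(1,2)[OF that] by (fastforce simp: fun_eq_iff one_model_def)
  ultimately show "\<exists>!a. a \<in> Hom (Mod T) M ?I"
    using M is_model_one_model[OF assms] by (auto intro!: ex1I)
qed

section \<open>Categorical arguments\<close>

locale cat =
  fixes C :: "('o, 'a) category"
  assumes Dom_Obj: "a \<in> Arr C \<Longrightarrow> Dom C a \<in> Obj C"
    and Cod_Obj: "a \<in> Arr C \<Longrightarrow> Cod C a \<in> Obj C"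
    and Ident_Hom: "X \<in> Obj C \<Longrightarrow> Ident C X \<in> Hom C X X"
    and Comp_Hom: "f \<in> Hom C X Y \<Longrightarrow> g \<in> Hom C Y Z \<Longrightarrow> Comp C g f \<in> Hom C X Z"
    and Comp_assoc: "f \<in> Hom C X Y \<Longrightarrow> g \<in> Hom C Y Z \<Longrightarrow> k \<in> Hom C Z W \<Longrightarrow>
      Comp C (Comp C k g) f = Comp C k (Comp C g f)"
    and Ident_left: "f \<in> Hom C X Y \<Longrightarrow> Comp C (Ident C Y) f = f"
    and Ident_right: "f \<in> Hom C X Y \<Longrightarrow> Comp C f (Ident C X) = f"
begin

lemma Arr_Hom: "a \<in> Arr C \<Longrightarrow> a \<in> Hom C (Dom C a) (Cod C a)"
  by (simp add: Hom_def)

lemma Hom_D: "a \<in> Hom C X Y \<Longrightarrow> a \<in> Arr C" "a \<in> Hom C X Y \<Longrightarrow> Dom C a = X"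
    "a \<in> Hom C X Y \<Longrightarrow> Cod C a = Y"
  by (simp_all add: Hom_def)

lemma Hom_Obj: "a \<in> Hom C X Y \<Longrightarrow> X \<in> Obj C" "a \<in> Hom C X Y \<Longrightarrow> Y \<in> Obj C"
  using Dom_Obj Cod_Obj by (auto simp: Hom_def)

lemma lifts_iff:
  assumes "i \<in> Hom C P Q" "p \<in> Hom C X Y"
  shows "lifts C i p \<longleftrightarrow> (\<forall>u\<in>Hom C P X. \<forall>v\<in>Hom C Q Y. Comp C p u = Comp C v i \<longrightarrow>
        (\<exists>d\<in>Hom C Q X. Comp C d i = u \<and> Comp C p d = v))"
  unfolding lifts_def using assms by (simp add: Hom_def)

text \<open>Lifting \<open>j\<close> against \<open>p\<close> in the square with top
  \<open>i\<close> and bottom the identity of \<open>Y\<close> gives a section \<open>d\<close> of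
  \<open>p\<close> with \<open>d \<circ> j = i\<close>. The identity of \<open>X\<close> together
  with \<open>d\<close> and \<open>p\<close> then exhibits the retract.\<close>

lemma retract_argument:
  assumes "i \<in> Hom C X Z" "p \<in> Hom C Z Y" "j = Comp C p i" "lifts C j p"
  shows "retract_of C j i"
proof -
  have j: "j \<in> Hom C X Y" using assms Comp_Hom by blast
  have Y: "Ident C Y \<in> Hom C Y Y" and X: "Ident C X \<in> Hom C X X"
    using Ident_Hom Hom_Obj assms(1,2) by blast+
  obtain d where d: "d \<in> Hom C Y Z" "Comp C d j = i" "Comp C p d = Ident C Y"
    using assms(4)[unfolded lifts_iff[OF j assms(2)]] assms(1,3) Y Ident_left[OF j] by metis
  show ?thesis
    unfolding retract_of_def Hom_D(2,3)[OF j] Hom_D(2,3)[OF assms(1)]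
  proof (intro bexI conjI)
    show "Comp C (Ident C X) (Ident C X) = Ident C X" using Ident_left[OF X] .
    show "Comp C p d = Ident C Y" using d(3) .
    show "Comp C i (Ident C X) = Comp C d j" using Ident_right[OF assms(1)] d(2) by simp
    show "Comp C j (Ident C X) = Comp C p i" using Ident_right[OF j] assms(3) by simp
  qed (use X d assms in auto)
qed

text \<open>With an initial domain the top of the square is forced and both triangles and squares on
  that side commute automatically.\<close>

lemma lifts_initial_iff:
  assumes "initial C Z" "i \<in> Hom C Z X" "q \<in> Hom C A B"
  shows "lifts C i q \<longleftrightarrow> (\<forall>v\<in>Hom C X B. \<exists>d\<in>Hom C X A. Comp C q d = v)"
proof -
  have uniq: "u = u'" if "u \<in> Hom C Z Y" "u' \<in> Hom C Z Y" for u u' Y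
    using assms(1) that Hom_Obj(2) unfolding initial_def by blast
  show ?thesis unfolding lifts_iff[OF assms(2,3)]
  proof (intro iffI ballI impI)
    fix v assume *: "\<forall>u\<in>Hom C Z A. \<forall>v\<in>Hom C X B. Comp C q u = Comp C v i \<longrightarrow>
          (\<exists>d\<in>Hom C X A. Comp C d i = u \<and> Comp C q d = v)" and v: "v \<in> Hom C X B"
    obtain u where u: "u \<in> Hom C Z A"
      using assms(1) Hom_Obj(1)[OF assms(3)] unfolding initial_def by blast
    have "Comp C q u = Comp C v i" using uniq Comp_Hom[OF u assms(3)] Comp_Hom[OF assms(2) v] .
    then show "\<exists>d\<in>Hom C X A. Comp C q d = v" using * u v by blast
  next
    fix u v assume "\<forall>v\<in>Hom C X B. \<exists>d\<in>Hom C X A. Comp C q d = v" "u \<in> Hom C Z A" "v \<in> Hom C X B"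
    then obtain d where "d \<in> Hom C X A" "Comp C q d = v" by blast
    moreover have "Comp C d i = u" using uniq Comp_Hom[OF assms(2) calculation(1)] \<open>u \<in> _\<close> .
    ultimately show "\<exists>d\<in>Hom C X A. Comp C d i = u \<and> Comp C q d = v" by blast
  qed
qed

text \<open>Frees cofibrancy from the choice of an initial object and of an arrow out of it: what
  remains is lifting of arrows out of \<open>X\<close>.\<close>

lemma cofibrant_llp_iff:
  assumes "\<exists>Z. initial C Z" "S \<subseteq> Arr C"
  shows "cofibrant C (llp C S) X \<longleftrightarrow> X \<in> Obj C \<and>
    (\<forall>q\<in>S. \<forall>v\<in>Hom C X (Cod C q). \<exists>d\<in>Hom C X (Dom C q). Comp C q d = v)"
proof -
  have *: "i \<in> llp C S \<longleftrightarrow> (\<forall>q\<in>S. \<forall>v\<in>Hom C X (Cod C q). \<exists>d\<in>Hom C X (Dom C q). Comp C q d = v)"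
    if i: "initial C Z" "i \<in> Hom C Z X" for Z i
  proof -
    have "lifts C i q \<longleftrightarrow> (\<forall>v\<in>Hom C X (Cod C q). \<exists>d\<in>Hom C X (Dom C q). Comp C q d = v)"
      if "q \<in> S" for q
      by (rule lifts_initial_iff[OF i Arr_Hom]) (use that assms(2) in blast)
    then show ?thesis using Hom_D(1)[OF i(2)] by (simp add: llp_def)
  qed
  show ?thesis
  proof
    assume "cofibrant C (llp C S) X"
    then show "X \<in> Obj C \<and> (\<forall>q\<in>S. \<forall>v\<in>Hom C X (Cod C q). \<exists>d\<in>Hom C X (Dom C q). Comp C q d = v)"
      using * Hom_Obj(2) unfolding cofibrant_def by blast
  next
    assume X: "X \<in> Obj C \<and> (\<forall>q\<in>S. \<forall>v\<in>Hom C X (Cod C q). \<exists>d\<in>Hom C X (Dom C q). Comp C q d = v)"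
    obtain Z where Z: "initial C Z" using assms(1) by blast
    then obtain i where "i \<in> Hom C Z X" using X unfolding initial_def by blast
    then show "cofibrant C (llp C S) X" using * Z X unfolding cofibrant_def by blast
  qed
qed

text \<open>The domain being cofibrant, \<open>j\<close> factors into a trivial cofibration followed
  by a fibration. Fibrations are defined by lifting against \<open>J\<close>, so the retract
  argument applies and closure under retracts finishes.\<close>

lemma triv_cof_of_lifts_fibs:
  assumes "left_semi_model_structure C Cof W (rlp C J)" "j \<in> J" "J \<subseteq> Arr C"
    "cofibrant C Cof (Dom C j)"
  shows "j \<in> Cof \<inter> W"
proof -
  have j: "j \<in> Arr C" using assms by blast
  have "\<forall>f\<in>Arr C. cofibrant C Cof (Dom C f) \<longrightarrow>
      (\<exists>i\<in>Cof \<inter> W. \<exists>p\<in>rlp C J. Cod C i = Dom C p \<and> Comp C p i = f)"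
    and ret: "retract_closed C Cof" "retract_closed C W" and sub: "Cof \<subseteq> Arr C"
    using assms(1) unfolding left_semi_model_structure_def by blast+
  with assms(4) j obtain i p where ip: "i \<in> Cof \<inter> W" "p \<in> rlp C J" "Cod C i = Dom C p" "Comp C p i = j"
    by blast
  have "i \<in> Hom C (Dom C i) (Dom C p)" "p \<in> Hom C (Dom C p) (Cod C p)"
    using ip sub by (auto simp: Hom_def rlp_def)
  moreover have "lifts C j p" using ip assms(2) by (simp add: rlp_def)
  ultimately have "retract_of C j i" using retract_argument ip(4) by metis
  then show ?thesis using ret j ip(1) unfolding retract_closed_def by blast
qed

end

text \<open>The left adjoint is given on objects only, by a choice of universal arrows; its action
  on arrows is recovered from the universal property.\<close>

locale adj = C: cat C + D: cat D for C :: "('o, 'a) category" and D :: "('p, 'b) category" +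
  fixes Go :: "'p \<Rightarrow> 'o" and Ga :: "'b \<Rightarrow> 'a" and Fo :: "'o \<Rightarrow> 'p" and eta :: "'o \<Rightarrow> 'a"
  assumes Ga_Hom: "k \<in> Hom D X Y \<Longrightarrow> Ga k \<in> Hom C (Go X) (Go Y)"
    and Ga_Comp: "f \<in> Hom D X Y \<Longrightarrow> g \<in> Hom D Y Z \<Longrightarrow> Ga (Comp D g f) = Comp C (Ga g) (Ga f)"
    and universal: "A \<in> Obj C \<Longrightarrow> universal_arrow C D Go Ga A (Fo A) (eta A)"
begin

lemma Fo_Obj: "X \<in> Obj C \<Longrightarrow> Fo X \<in> Obj D"
  using universal by (simp add: universal_arrow_def)

lemma eta_Hom: "X \<in> Obj C \<Longrightarrow> eta X \<in> Hom C X (Go (Fo X))"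
  using universal by (simp add: universal_arrow_def)

lemma transpose_unique_ex:
  "X \<in> Obj C \<Longrightarrow> Y \<in> Obj D \<Longrightarrow> g \<in> Hom C X (Go Y) \<Longrightarrow>
    \<exists>!k. k \<in> Hom D (Fo X) Y \<and> Comp C (Ga k) (eta X) = g"
  using universal by (simp add: universal_arrow_def)

lemma transpose_ex:
  assumes "Y \<in> Obj D" "g \<in> Hom C X (Go Y)"
  obtains k where "k \<in> Hom D (Fo X) Y" "Comp C (Ga k) (eta X) = g"
  using transpose_unique_ex[OF C.Hom_Obj(1)[OF assms(2)] assms] by blast

lemma transpose_inj:
  assumes "X \<in> Obj C" "k \<in> Hom D (Fo X) Y" "k' \<in> Hom D (Fo X) Y"
    "Comp C (Ga k) (eta X) = Comp C (Ga k') (eta X)"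
  shows "k = k'"
  using transpose_unique_ex[OF assms(1) D.Hom_Obj(2)[OF assms(2)]
      C.Comp_Hom[OF eta_Hom[OF assms(1)] Ga_Hom[OF assms(2)]]] assms(2-4) by metis

lemma Comp_eta:
  assumes "X \<in> Obj C" "k \<in> Hom D (Fo X) Y" "g \<in> Hom D Y Z"
  shows "Comp C (Ga (Comp D g k)) (eta X) = Comp C (Ga g) (Comp C (Ga k) (eta X))"
  using Ga_Comp[OF assms(2,3)] C.Comp_assoc[OF eta_Hom[OF assms(1)] Ga_Hom[OF assms(2)] Ga_Hom[OF assms(3)]]
  by simp

text \<open>Repeats the definite description of \<open>push_arr\<close> abstractly, so that the two
  coincide by unfolding once the locale is interpreted.\<close>

definition push :: "'a \<Rightarrow> 'b" where
  "push h = (THE k. k \<in> Hom D (Fo (Dom C h)) (Fo (Cod C h)) \<and>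
     Comp C (Ga k) (eta (Dom C h)) = Comp C (eta (Cod C h)) h)"

lemma push:
  assumes "h \<in> Hom C X Y"
  shows "push h \<in> Hom D (Fo X) (Fo Y)" "Comp C (Ga (push h)) (eta X) = Comp C (eta Y) h"
proof -
  note X = C.Hom_Obj[OF assms]
  have "\<exists>!k. k \<in> Hom D (Fo X) (Fo Y) \<and> Comp C (Ga k) (eta X) = Comp C (eta Y) h"
    by (intro transpose_unique_ex X Fo_Obj C.Comp_Hom[OF assms eta_Hom])
  from theI'[OF this] show "push h \<in> Hom D (Fo X) (Fo Y)" "Comp C (Ga (push h)) (eta X) = Comp C (eta Y) h"
    unfolding push_def C.Hom_D[OF assms] by blast+
qed

text \<open>Transposition turns a square from \<open>i\<close> to \<open>Ga q\<close> into a square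
  from \<open>push i\<close> to \<open>q\<close>; a diagonal of the latter transposes back.\<close>

lemma lifts_push:
  assumes i: "i \<in> Hom C P Q" and q: "q \<in> Hom D A B" and lift: "lifts D (push i) q"
  shows "lifts C i (Ga q)"
  unfolding C.lifts_iff[OF i Ga_Hom[OF q]]
proof (intro ballI impI)
  fix u v assume u: "u \<in> Hom C P (Go A)" and v: "v \<in> Hom C Q (Go B)"
    and sq: "Comp C (Ga q) u = Comp C v i"
  note P = C.Hom_Obj[OF i] and A = D.Hom_Obj[OF q]
  obtain u' where u': "u' \<in> Hom D (Fo P) A" "Comp C (Ga u') (eta P) = u"
    using transpose_ex[OF A(1) u] .
  obtain v' where v': "v' \<in> Hom D (Fo Q) B" "Comp C (Ga v') (eta Q) = v"
    using transpose_ex[OF A(2) v] .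
  note Fi = push[OF i]
  have "Comp D q u' = Comp D v' (push i)"
  proof (rule transpose_inj[OF P(1) D.Comp_Hom[OF u'(1) q] D.Comp_Hom[OF Fi(1) v'(1)]])
    have "Comp C (Ga (Comp D v' (push i))) (eta P) = Comp C (Ga v') (Comp C (eta Q) i)"
      using Comp_eta[OF P(1) Fi(1) v'(1)] Fi(2) by simp
    also have "\<dots> = Comp C v i"
      using C.Comp_assoc[OF i eta_Hom[OF P(2)] Ga_Hom[OF v'(1)]] v'(2) by simp
    finally show "Comp C (Ga (Comp D q u')) (eta P) = Comp C (Ga (Comp D v' (push i))) (eta P)"
      using Comp_eta[OF P(1) u'(1) q] u'(2) sq by simp
  qed
  then obtain d where d: "d \<in> Hom D (Fo Q) A" "Comp D d (push i) = u'" "Comp D q d = v'"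
    using lift[unfolded D.lifts_iff[OF Fi(1) q]] u'(1) v'(1) by blast
  have "Comp C (Comp C (Ga d) (eta Q)) i = Comp C (Ga d) (Comp C (eta Q) i)"
    using C.Comp_assoc[OF i eta_Hom[OF P(2)] Ga_Hom[OF d(1)]] .
  also have "\<dots> = Comp C (Ga (Comp D d (push i))) (eta P)"
    using Comp_eta[OF P(1) Fi(1) d(1)] Fi(2) by simp
  finally have "Comp C (Comp C (Ga d) (eta Q)) i = u" using d(2) u'(2) by simp
  moreover have "Comp C (Ga q) (Comp C (Ga d) (eta Q)) = v"
    using Comp_eta[OF P(2) d(1) q] d(3) v'(2) by simp
  moreover have "Comp C (Ga d) (eta Q) \<in> Hom C Q (Go A)"
    using C.Comp_Hom[OF eta_Hom[OF P(2)] Ga_Hom[OF d(1)]] .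
  ultimately show "\<exists>d\<in>Hom C Q (Go A). Comp C d i = u \<and> Comp C (Ga q) d = v" by blast
qed

text \<open>By \<open>lifts_push\<close>, \<open>Ga\<close> sends \<open>rlp D J\<close> into
  \<open>rlp C I\<close>. To lift an arrow out of \<open>Fo X\<close>, its transpose is lifted in
  \<open>C\<close> and the result is transposed back.\<close>

lemma Fo_cofibrant:
  assumes "\<exists>Z. initial C Z" "\<exists>Z. initial D Z" "I \<subseteq> Arr C"
    "\<And>i. i \<in> I \<Longrightarrow> push i \<in> llp D (rlp D J)"
    "cofibrant C (llp C (rlp C I)) X"
  shows "cofibrant D (llp D (rlp D J)) (Fo X)"
proof -
  have sub: "rlp C I \<subseteq> Arr C" "rlp D J \<subseteq> Arr D" by (auto simp: rlp_def)
  have X: "X \<in> Obj C"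
    and lift: "\<forall>q\<in>rlp C I. \<forall>v\<in>Hom C X (Cod C q). \<exists>d\<in>Hom C X (Dom C q). Comp C q d = v"
    using assms(5) unfolding C.cofibrant_llp_iff[OF assms(1) sub(1)] by blast+
  show ?thesis unfolding D.cofibrant_llp_iff[OF assms(2) sub(2)]
  proof (intro conjI ballI)
    show "Fo X \<in> Obj D" by (rule Fo_Obj[OF X])
    fix q v assume q: "q \<in> rlp D J" and v: "v \<in> Hom D (Fo X) (Cod D q)"
    have qH: "q \<in> Hom D (Dom D q) (Cod D q)" using q sub D.Arr_Hom by blast
    note Gq = Ga_Hom[OF qH]
    have "Ga q \<in> rlp C I" unfolding rlp_def
    proof (intro CollectI conjI ballI)
      show "Ga q \<in> Arr C" using C.Hom_D(1)[OF Gq] .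
      fix i assume i: "i \<in> I"
      then have "lifts D (push i) q" using assms(4) q unfolding llp_def by blast
      moreover have "i \<in> Hom C (Dom C i) (Cod C i)" using i assms(3) C.Arr_Hom by blast
      ultimately show "lifts C i (Ga q)" using lifts_push qH by blast
    qed
    moreover have "Comp C (Ga v) (eta X) \<in> Hom C X (Cod C (Ga q))"
      using C.Comp_Hom[OF eta_Hom[OF X] Ga_Hom[OF v]] C.Hom_D(3)[OF Gq] by simp
    ultimately obtain d where d: "d \<in> Hom C X (Go (Dom D q))" "Comp C (Ga q) d = Comp C (Ga v) (eta X)"
      using lift C.Hom_D(2)[OF Gq] by metis
    obtain d' where d': "d' \<in> Hom D (Fo X) (Dom D q)" "Comp C (Ga d') (eta X) = d"
      using transpose_ex[OF D.Hom_Obj(1)[OF qH] d(1)] .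
    have "Comp D q d' = v"
      by (rule transpose_inj[OF X D.Comp_Hom[OF d'(1) qH] v])
        (simp add: Comp_eta[OF X d'(1) qH] d'(2) d(2))
    then show "\<exists>d\<in>Hom D (Fo X) (Dom D q). Comp D q d = v" using d'(1) by blast
  qed
qed

end

lemma cat_Mod: "cat (Mod T)"
proof
  fix a assume "a \<in> Arr (Mod T)"
  moreover obtain M h N where "a = (M, h, N)" by (metis surj_pair)
  ultimately show "Dom (Mod T) a \<in> Obj (Mod T)" "Cod (Mod T) a \<in> Obj (Mod T)" by simp_all
qed (auto simp: is_hom_hid is_hom_hcomp hcomp_assoc hcomp_hid_left hcomp_hid_right)

section \<open>Units\<close>

lemma pull_arr [simp]: "pull_arr T1 F (M, h, N) = (pull_obj T1 F M, h, pull_obj T1 F N)"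
  by (simp add: pull_arr_def)

lemma car_pull_obj [simp]: "car (pull_obj T1 F M) = car M"
  by (simp add: pull_obj_def)

lemma elems_pull_obj [simp]: "elems (pull_obj T1 F M) = elems M"
  by (simp add: pull_obj_def)

lemma hcomp_pull_obj [simp]: "hcomp (pull_obj T1 F M) = hcomp M"
  by (simp add: fun_eq_iff hcomp_def)

lemma adtt_morphism_phl: "adtt_morphism S T F \<Longrightarrow> phl_morphism (phl_of S) (phl_of T) F"
  by (simp add: adtt_morphism_def)

lemma is_model_pull_obj:
  assumes "is_theory T1" "is_theory T2" "adtt_morphism T1 T2 F" "is_model (phl_of T2) M"
  shows "is_model (phl_of T1) (pull_obj T1 F M)"
  unfolding pull_obj_def
  by (rule reduct_is_model[OF is_theory_wf_phl is_theory_wf_phl adtt_morphism_phl]) (fact assms)+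

lemma is_hom_pull_obj:
  assumes "adtt_morphism T1 T2 F" "is_model (phl_of T2) M" "is_hom (phl_of T2) M N h"
  shows "is_hom (phl_of T1) (pull_obj T1 F M) (pull_obj T1 F N) h"
  unfolding pull_obj_def
  by (rule is_hom_reduct[OF assms(2) phl_morphism_wf_interp[OF adtt_morphism_phl[OF assms(1)]] assms(3)])

text \<open>The generators are all elements of \<open>X\<close> with their sorts, and the class
  consists of the models \<open>N\<close> of \<open>T2\<close> with a homomorphism from
  \<open>X\<close> to the reduct of \<open>N\<close>. The point to check is that the generators
  themselves form such a homomorphism into the reduct of \<open>Term\<close>.\<close>

lemma ex_unit:
  fixes T1 :: "('f, 'r) id_theory" and T2 :: "('g, 'q) id_theory" and X :: "('f, 'r, 'u) smodel"
  assumes T: "is_theory T1" "is_theory T2" "small_theory TYPE('u) T2" "adtt_morphism T1 T2 F"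
    and X: "is_model (phl_of T1) X"
  shows "\<exists>Z e. is_unit T1 T2 F X Z e"
proof -
  define K where "K = {(s, x). x \<in> car X s}"
  \<comment> \<open>Homomorphisms are \<open>undefined\<close> outside the carriers, so an
    assignment of the generators has to be cut off there.\<close>
  define hm where "hm c s x = (if x \<in> car X s then c (s, x) else undefined)" for c :: "sort \<times> 'u \<Rightarrow> 'u" and s x
  define CC :: "('g, 'q, 'u) smodel \<Rightarrow> (sort \<times> 'u \<Rightarrow> 'u) \<Rightarrow> bool" where
    "CC N c \<longleftrightarrow> is_model (phl_of T2) N \<and> is_hom (phl_of T1) X (pull_obj T1 F N) (hm c)" for N c
  have "infinite (UNIV :: 'u set)" using T(3) by (simp add: small_theory_def)
  then obtain kc :: "sort \<times> 'u \<Rightarrow> 'u" where "inj kc" using ex_inj_sorted by blast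
  then have kc: "inj_on kc K" by (rule inj_on_subset) simp
  have CC: "c k \<in> car N (fst k)" if "CC N c" "k \<in> K" for N c k
  proof -
    have "hm c (fst k) (snd k) \<in> car (pull_obj T1 F N) (fst k)"
      using that is_homD(1) by (fastforce simp: CC_def K_def)
    then show ?thesis using that(2) by (auto simp: hm_def K_def)
  qed
  obtain code :: "('g fsym, sort \<times> 'u) gterm \<Rightarrow> 'u" where "term_model (phl_of T2) K fst CC code"
    using small_theory_term_model[OF T(2,3) kc, of CC fst] CC by (auto simp: CC_def)
  then interpret term_model "phl_of T2" K fst CC code .
  note wfi = phl_morphism_wf_interp[OF adtt_morphism_phl[OF T(4)]]
  have K: "(s, x) \<in> K \<longleftrightarrow> x \<in> car X s" for s x by (simp add: K_def)
  have gen: "hm gen s x \<in> car Term s" if "x \<in> car X s" for s x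
    using gen_in_car[of "(s, x)"] that by (simp add: K hm_def)
  have el: "elems Term ss (map2 (hm gen) ss xs)" if "elems X ss xs" for ss xs
    using that gen by (auto simp: elems_def list_all2_conv_all_nth)
  have vN: "\<forall>i s. (i, s) \<in> ctxvars ss \<longrightarrow>
      vN (\<lambda>i s. map2 (hm gen) ss xs ! i) N c i s = map2 (hm c) ss xs ! i"
    if "CC N c" "elems X ss xs" for N c ss xs
  proof (intro allI impI)
    fix i s assume "(i, s) \<in> ctxvars ss"
    then have i: "i < length ss" "s = ss ! i" by (simp_all add: ctxvars_iff)
    then have k: "xs ! i \<in> car X s" "(s, xs ! i) \<in> K" using elems_nth[OF that(2)] by (simp_all add: K)
    then show "vN (\<lambda>i s. map2 (hm gen) ss xs ! i) N c i s = map2 (hm c) ss xs ! i"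
      using gval_dec_gen[OF k(2) that(1)] i elems_length[OF that(2)] by (simp add: vN_def hm_def)
  qed
  have homN: "is_hom (phl_of T1) X (pull_obj T1 F N) (hm c)" if "CC N c" for N c
    using that by (simp add: CC_def)
  have unit: "is_hom (phl_of T1) X (pull_obj T1 F Term) (hm gen)"
    unfolding is_hom_def
  proof (intro conjI allI impI)
    show "if a \<in> car X s then hm gen s a \<in> car (pull_obj T1 F Term) s else hm gen s a = undefined" for s a
      using gen by (simp add: hm_def)
  next
    fix f xs y assume y: "fn X f xs = Some y"
    let ?ss = "far (phl_of T1) f" and ?s = "fres (phl_of T1) f"
    let ?v = "\<lambda>i s. map2 (hm gen) ?ss xs ! i"
    from is_model_fnD[OF X y] have f: "f \<in> fsyms (phl_of T1)" "elems X ?ss xs" "y \<in> car X ?s" by blast+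
    then have "wf_rtrm (phl_of T2) ?ss ?s (fmap F f)" using wfi unfolding wf_interp_def by blast
    then have wf: "has_sort (phl_of T2) (ctxvars ?ss) (fst (fmap F f)) ?s"
      "wf_horn (phl_of T2) (ctxvars ?ss) (snd (fmap F f))" unfolding wf_rtrm_def by blast+
    note val = valuation_nth[OF el[OF f(2)]]
    \<comment> \<open>Every member of the class receives a homomorphism from \<open>X\<close>. Hence
      the interpretation of \<open>f\<close> at the images of \<open>xs\<close> is defined in each
      of them and equals the image of \<open>y\<close>; agreement in all members is what
      \<open>Term\<close> asks for.\<close>
    have N: "sat_horn N (vN ?v N c) (snd (fmap F f)) \<and> tm_val N (vN ?v N c) (fst (fmap F f)) = Some (c (?s, y))"
      if C: "CC N c" for N c
    proof -
      have "fn (pull_obj T1 F N) f (map2 (hm c) ?ss xs) = Some (c (?s, y))"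
        using is_homD(3)[OF homN[OF C] y] f(3) by (simp add: hm_def)
      then have "rtm_val N (\<lambda>i s. map2 (hm c) ?ss xs ! i) (fmap F f) = Some (c (?s, y))"
        by (simp add: pull_obj_def fn_reduct split: if_splits del: phl_of_simps)
      then show ?thesis
        unfolding sat_horn_cong[OF wf(2) vN[OF C f(2)]] tm_val_cong[OF wf(1) vN[OF C f(2)]]
        by (simp add: rtm_val_def split: if_splits)
    qed
    have k: "(?s, y) \<in> K" using f(3) by (simp add: K)
    have "tm_val Term ?v (fst (fmap F f)) = Some (q (Gen (?s, y)))"
      using tm_val_Term_eq_Some_iff[OF val wf(1) Gen_D[OF k]] N by simp
    moreover have "sat_horn Term ?v (snd (fmap F f))"
      unfolding sat_horn_Term[OF val wf(2)] using N by blast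
    ultimately show "fn (pull_obj T1 F Term) f (map2 (hm gen) ?ss xs) = Some (hm gen ?s y)"
      using f el[OF f(2)] by (simp add: pull_obj_def fn_reduct rtm_val_def hm_def gen_def del: phl_of_simps)
  next
    fix R xs assume R: "rl X R xs"
    let ?ss = "par (phl_of T1) R"
    let ?v = "\<lambda>i s. map2 (hm gen) ?ss xs ! i"
    from is_model_rlD[OF X R] have f: "R \<in> psyms (phl_of T1)" "elems X ?ss xs" by blast+
    then have wf: "wf_horn (phl_of T2) (ctxvars ?ss) (pmap F R)" using wfi unfolding wf_interp_def by blast
    note val = valuation_nth[OF el[OF f(2)]]
    have "sat_horn N (vN ?v N c) (pmap F R)" if C: "CC N c" for N c
      using is_homD(4)[OF homN[OF C] R] unfolding sat_horn_cong[OF wf vN[OF C f(2)]]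
      by (simp add: pull_obj_def rl_reduct)
    then have "sat_horn Term ?v (pmap F R)" unfolding sat_horn_Term[OF val wf] by blast
    then show "rl (pull_obj T1 F Term) R (map2 (hm gen) ?ss xs)"
      using f el[OF f(2)] by (simp add: pull_obj_def rl_reduct del: phl_of_simps)
  qed
  have "is_unit T1 T2 F X Term (X, hm gen, pull_obj T1 F Term)"
    unfolding is_unit_def universal_arrow_def
  proof (intro conjI ballI)
    show "Term \<in> Obj (Mod T2)" by (simp add: is_model_Term)
    show "(X, hm gen, pull_obj T1 F Term) \<in> Hom (Mod T1) X (pull_obj T1 F Term)"
      using X unit is_model_pull_obj[OF T(1,2,4) is_model_Term] by simp
    fix Y g assume Y: "Y \<in> Obj (Mod T2)" and "g \<in> Hom (Mod T1) X (pull_obj T1 F Y)"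
    then obtain h where g: "g = (X, h, pull_obj T1 F Y)" and h: "is_hom (phl_of T1) X (pull_obj T1 F Y) h"
      by auto
    \<comment> \<open>Reading \<open>h\<close> as an assignment of generators puts \<open>Y\<close>
      into the class, so the projection \<open>the_hom\<close> is the required arrow.\<close>
    let ?c = "\<lambda>(s, x). h s x"
    have hm: "hm ?c = h" using is_homD(2)[OF h] by (auto simp: hm_def fun_eq_iff)
    then have C: "CC Y ?c" using Y h by (simp add: CC_def)
    show "\<exists>!k. k \<in> Hom (Mod T2) Term Y \<and>
        Comp (Mod T1) (pull_arr T1 F k) (X, hm gen, pull_obj T1 F Term) = g"
    proof (rule ex1I, rule conjI)
      show "(Term, the_hom Y ?c, Y) \<in> Hom (Mod T2) Term Y"
        using is_hom_the_hom[OF C] Y is_model_Term by simp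
      have "hcomp X (the_hom Y ?c) (hm gen) = h"
        using the_hom_gen[OF C] is_homD(2)[OF h] by (force simp: fun_eq_iff hcomp_def hm_def K_def)
      then show "Comp (Mod T1) (pull_arr T1 F (Term, the_hom Y ?c, Y)) (X, hm gen, pull_obj T1 F Term) = g"
        by (simp add: g)
    next
      fix k assume k: "k \<in> Hom (Mod T2) Term Y \<and>
          Comp (Mod T1) (pull_arr T1 F k) (X, hm gen, pull_obj T1 F Term) = g"
      then obtain k' where k': "k = (Term, k', Y)" "is_hom (phl_of T2) Term Y k'" by auto
      then have "hcomp X k' (hm gen) = h" using k by (simp add: g)
      then have "hcomp X k' (hm gen) s x = h s x" for s x by simp
      then have "k' s (gen (s, x)) = h s x" if "x \<in> car X s" for s x
        using that by (metis hcomp_def hm_def)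
      then have "k' = the_hom Y ?c"
        using hom_unique[OF k'(2) is_hom_the_hom[OF C]] the_hom_gen[OF C] by (force simp: K_def)
      then show "k = (Term, the_hom Y ?c, Y)" using k' by simp
    qed
  qed
  then show ?thesis by blast
qed

lemma is_unit_push:
  fixes T1 :: "('f, 'r) id_theory" and T2 :: "('g, 'q) id_theory" and X :: "('f, 'r, 'u) smodel"
  assumes "is_theory T1" "is_theory T2" "small_theory TYPE('u) T2" "adtt_morphism T1 T2 F"
    "is_model (phl_of T1) X"
  shows "is_unit T1 T2 F X (push_obj T1 T2 F X) (unit_arr T1 T2 F X)"
proof -
  have "\<exists>p. case p of (Z, e) \<Rightarrow> is_unit T1 T2 F X Z e" using ex_unit[OF assms] by auto
  from someI_ex[OF this] have "case push_unit T1 T2 F X of (Z, e) \<Rightarrow> is_unit T1 T2 F X Z e"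
    unfolding push_unit_def .
  then show ?thesis by (simp add: push_obj_def unit_arr_def case_prod_beta)
qed

lemma adj_Mod:
  fixes T1 :: "('f, 'r) id_theory" and T2 :: "('g, 'q) id_theory"
  assumes "is_theory T1" "is_theory T2" "small_theory TYPE('u) T2" "adtt_morphism T1 T2 F"
  shows "adj (Mod T1 :: (_, ('f, 'r, 'u) model_arrow) category) (Mod T2) (pull_obj T1 F) (pull_arr T1 F)
    (push_obj T1 T2 F) (unit_arr T1 T2 F)"
proof -
  interpret C: cat "Mod T1 :: (_, ('f, 'r, 'u) model_arrow) category" by (rule cat_Mod)
  interpret D: cat "Mod T2 :: (_, ('g, 'q, 'u) model_arrow) category" by (rule cat_Mod)
  show ?thesis
  proof
    show "pull_arr T1 F k \<in> Hom (Mod T1) (pull_obj T1 F X) (pull_obj T1 F Y)"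
      if "k \<in> Hom (Mod T2) X Y" for k and X Y :: "('g, 'q, 'u) smodel"
      using that is_model_pull_obj[OF assms(1,2,4)] is_hom_pull_obj[OF assms(4)] by auto
    show "pull_arr T1 F (Comp (Mod T2) g f) = Comp (Mod T1) (pull_arr T1 F g) (pull_arr T1 F f)"
      if "f \<in> Hom (Mod T2) X Y" "g \<in> Hom (Mod T2) Y Z" for f g and X Y Z :: "('g, 'q, 'u) smodel"
      using that by auto
    show "universal_arrow (Mod T1) (Mod T2) (pull_obj T1 F) (pull_arr T1 F) A (push_obj T1 T2 F A)
        (unit_arr T1 T2 F A)" if "A \<in> Obj (Mod T1)" for A :: "('f, 'r, 'u) smodel"
      using is_unit_push[OF assms] that by (simp add: is_unit_def)
  qed
qed

section \<open>Reducts preserve the structure of contextual categories and identity types\<close>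

text \<open>Morphisms of theories send the symbols of the theory of substitutions literally to
  themselves, so these operations are equal in a model and its reduct. On lists outside the carriers
  both are undefined, by the model condition.\<close>

lemma fn_reduct_App:
  assumes "is_model T M" "fmap F f = (App g (varterms ss), [])" "far S f = ss" "far T g = ss"
    "f \<in> fsyms S \<longleftrightarrow> g \<in> fsyms T"
  shows "fn (reduct S F M) f xs = fn M g xs"
proof (cases "f \<in> fsyms S \<and> elems M ss xs")
  case True
  have "map (tm_val M (\<lambda>i s. xs ! i)) (varterms ss) = map Some xs"
    using elems_length[of M ss xs] True by (intro nth_equalityI) (auto simp: varterms_def)
  then have "those (map (tm_val M (\<lambda>i s. xs ! i)) (varterms ss)) = Some xs"
    by (simp only: those_eq_Some_iff)
  then show ?thesis using True assms by (simp add: fn_reduct rtm_val_def)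
next
  case False
  then have "fn M g xs \<noteq> Some y" for y using is_model_fnD[OF assms(1), of g xs y] assms by auto
  then have "fn M g xs = None" by (cases "fn M g xs") auto
  then show ?thesis using False assms by (auto simp: fn_reduct)
qed

lemma fn_pull_obj:
  assumes "adtt_morphism T1 T2 F" "is_model (phl_of T2) M"
  shows "fn (pull_obj T1 F M) One xs = fn M One xs"
    "fn (pull_obj T1 F M) (Ft n) xs = fn M (Ft n) xs"
    "fn (pull_obj T1 F M) (TyOf n) xs = fn M (TyOf n) xs"
    "fn (pull_obj T1 F M) (Vr n i) xs = fn M (Vr n i) xs"
    "fn (pull_obj T1 F M) (Subst p n k) xs = fn M (Subst p n k) xs"
  using assms(1) unfolding pull_obj_def adtt_morphism_def
  by (auto intro!: fn_reduct_App[OF assms(2)] simp: varterms_def)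

lemma Op_Id0: "Op () n \<in> fsyms (phl_of Id0)"
    "far (phl_of Id0) (Op () n) = [(Ctx, n), (Tm, n), (Tm, n)]" "fres (phl_of Id0) (Op () n) = (Ctx, Suc n)"
  by (simp_all add: Id0_def shift_args_def)

text \<open>Identity types of the reduct are interpreted along \<open>id_mor T1\<close> and then
  \<open>F\<close>. The morphism respects \<open>Id0\<close> up to provable equality, which
  soundness turns into equality of values in \<open>M\<close>.\<close>

lemma fn_Id0_pull_obj:
  assumes "is_theory T1" "is_theory T2" "theory_morphism T1 T2 F" "is_model (phl_of T2) M"
  shows "fn (reduct (phl_of Id0) (id_mor T1) (pull_obj T1 F M)) (Op () n) xs =
    fn (reduct (phl_of Id0) (id_mor T2) M) (Op () n) xs"
proof (cases "elems M [(Ctx, n), (Tm, n), (Tm, n)] xs")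
  case True
  let ?ss = "[(Ctx, n), (Tm, n), (Tm, n)]" and ?v = "\<lambda>i s. xs ! i"
  have F: "wf_interp (phl_of T1) (phl_of T2) F"
    using assms(3) by (simp add: theory_morphism_def phl_morphism_wf_interp adtt_morphism_phl)
  have "wf_interp (phl_of Id0) (phl_of T1) (id_mor T1)"
    using assms(1) by (simp add: is_theory_def phl_morphism_wf_interp adtt_morphism_phl)
  then have "wf_rtrm (phl_of T1) (far (phl_of Id0) (Op () n)) (fres (phl_of Id0) (Op () n))
      (fmap (id_mor T1) (Op () n))"
    unfolding wf_interp_def using Op_Id0 by blast
  then have wf: "wf_rtrm (phl_of T1) ?ss (Ctx, Suc n) (fmap (id_mor T1) (Op () n))"
    unfolding Op_Id0 .
  have "rtm_val (pull_obj T1 F M) ?v (fmap (id_mor T1) (Op () n)) =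
      rtm_val M ?v (tr_rtrm F (fmap (id_mor T1) (Op () n)))"
    unfolding pull_obj_def by (rule rtm_val_tr_rtrm[OF assms(4) F True wf, symmetric])
  also have "\<dots> = rtm_val M ?v (fmap (id_mor T2) (Op () n))"
    using rtm_val_rtrm_eq[OF is_theory_wf_phl[OF assms(2)] assms(4) True] assms(3)
    by (simp add: theory_morphism_def)
  finally show ?thesis by (simp add: fn_reduct)
next
  case False
  then show ?thesis by (simp add: fn_reduct Op_Id0 del: phl_of_simps elems_simps)
qed

lemma pull_obj_ops:
  assumes "is_theory T1" "is_theory T2" "theory_morphism T1 T2 F" "is_model (phl_of T2) M"
  shows "ft_of (pull_obj T1 F M) = ft_of M" "ty_of (pull_obj T1 F M) = ty_of M"
    "vr_of (pull_obj T1 F M) = vr_of M" "wk (pull_obj T1 F M) = wk M" "inst (pull_obj T1 F M) = inst M"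
    "id_of T1 (pull_obj T1 F M) = id_of T2 M" "typed (pull_obj T1 F M) = typed M"
proof -
  have "adtt_morphism T1 T2 F" using assms(3) by (simp add: theory_morphism_def)
  note fn = fn_pull_obj[OF this assms(4)]
  show 1: "ft_of (pull_obj T1 F M) = ft_of M" "ty_of (pull_obj T1 F M) = ty_of M"
    "vr_of (pull_obj T1 F M) = vr_of M"
    by (simp_all add: fun_eq_iff ft_of_def ty_of_def vr_of_def fn)
  show "wk (pull_obj T1 F M) = wk M" "inst (pull_obj T1 F M) = inst M"
    by (simp_all add: fun_eq_iff wk_def inst_def 1 fn)
  show "id_of T1 (pull_obj T1 F M) = id_of T2 M"
    by (simp add: fun_eq_iff id_of_def 1 fn_Id0_pull_obj[OF assms])
  show "typed (pull_obj T1 F M) = typed M"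
    by (simp add: fun_eq_iff typed_def 1)
qed

lemma bd_pull_obj:
  assumes "is_theory T1" "is_theory T2" "theory_morphism T1 T2 F" "is_model (phl_of T2) M"
  shows "bd (pull_obj T1 F M) p n a = bd M p n a"
  using pull_obj_ops[OF assms] by (cases p) simp_all

lemma is_homotopy_pull_obj:
  assumes "is_theory T1" "is_theory T2" "theory_morphism T1 T2 F" "is_model (phl_of T2) M"
  shows "is_homotopy T1 (pull_obj T1 F M) p n a a' hs \<longleftrightarrow> is_homotopy T2 M p n a a' hs"
  using pull_obj_ops[OF assms] by (cases p) (simp_all add: tm_homotopy_def ty_homotopy_def)

lemma pull_arr_weqs_iff:
  assumes "is_theory T1" "is_theory T2" "theory_morphism T1 T2 F" "k \<in> Arr (Mod T2)"
  shows "pull_arr T1 F k \<in> weqs T1 \<longleftrightarrow> k \<in> weqs T2"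
proof -
  obtain M h N where k: "k = (M, h, N)" by (metis surj_pair)
  with assms(4) have M: "is_model (phl_of T2) M" and N: "is_model (phl_of T2) N"
    and h: "is_hom (phl_of T2) M N h" by simp_all
  have F: "adtt_morphism T1 T2 F" using assms(3) by (simp add: theory_morphism_def)
  have "pull_arr T1 F k \<in> Arr (Mod T1)"
    using is_hom_pull_obj[OF F M h] by (simp add: k M N is_model_pull_obj[OF assms(1,2) F])
  then show ?thesis using assms(4)
    unfolding k weqs_def homotopic_def
    by (simp add: bd_pull_obj[OF assms(1-3) M] bd_pull_obj[OF assms(1-3) N]
        is_homotopy_pull_obj[OF assms(1-3) N])
qed

section \<open>Homomorphisms preserve the structure of contextual categories and homotopies\<close>

lemma fn_total:
  fixes T :: "('f, 'r, 'z) adtt_scheme"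
  assumes "is_model (phl_of T) M" "a \<in> car M s"
    "(ctxvars [s], [], [defd (App f [Var 0 s])]) \<in> (subst_axioms :: ('f fsym, 'r psym, sort) sequent set)"
  shows "\<exists>y. fn M f [a] = Some y"
proof -
  have "(ctxvars [s], [], [defd (App f [Var 0 s])]) \<in> axioms (phl_of T)"
    using assms(3) by (simp add: phl_of_def)
  moreover have "valuation M (ctxvars [s]) (\<lambda>i s. a)"
    using assms(2) by (auto simp: valuation_def ctxvars_iff)
  ultimately have "sat_horn M (\<lambda>i s. a) [defd (App f [Var 0 s])]"
    using is_model_axiomD[OF assms(1)] by (metis sat_horn_simps(1))
  then show ?thesis by auto
qed

text \<open>Justifies the uses of \<open>the\<close> in \<open>ft_of\<close>, \<open>ty_of\<close>
  and \<open>vr_of\<close>: the totality axioms hold in every model.\<close>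

lemma ops_total:
  assumes "is_model (phl_of T) M"
  shows "A \<in> car M (Ctx, Suc n) \<Longrightarrow> fn M (Ft n) [A] = Some (ft_of M n A)"
    "a \<in> car M (Tm, n) \<Longrightarrow> fn M (TyOf n) [a] = Some (ty_of M n a)"
    "G \<in> car M (Ctx, n) \<Longrightarrow> i < n \<Longrightarrow> fn M (Vr n i) [G] = Some (vr_of M n i G)"
proof -
  show "A \<in> car M (Ctx, Suc n) \<Longrightarrow> fn M (Ft n) [A] = Some (ft_of M n A)"
    using fn_total[OF assms, of A "(Ctx, Suc n)" "Ft n"]
    by (auto simp: ft_of_def subst_axioms_def total_axioms_def)
  show "a \<in> car M (Tm, n) \<Longrightarrow> fn M (TyOf n) [a] = Some (ty_of M n a)"
    using fn_total[OF assms, of a "(Tm, n)" "TyOf n"]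
    by (auto simp: ty_of_def subst_axioms_def total_axioms_def)
  show "G \<in> car M (Ctx, n) \<Longrightarrow> i < n \<Longrightarrow> fn M (Vr n i) [G] = Some (vr_of M n i G)"
    using fn_total[OF assms, of G "(Ctx, n)" "Vr n i"]
    by (auto simp: vr_of_def subst_axioms_def total_axioms_def)
qed

lemma ops_in_car:
  assumes "is_model (phl_of T) M"
  shows "A \<in> car M (Ctx, Suc n) \<Longrightarrow> ft_of M n A \<in> car M (Ctx, n)"
    "a \<in> car M (Tm, n) \<Longrightarrow> ty_of M n a \<in> car M (Ctx, Suc n)"
    "G \<in> car M (Ctx, n) \<Longrightarrow> i < n \<Longrightarrow> vr_of M n i G \<in> car M (Tm, n)"
  using ops_total[OF assms] is_model_fnD[OF assms] by fastforce+

context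
  fixes T :: "('f, 'r) id_theory" and M N :: "('f, 'r, 'u) smodel" and h
  assumes M: "is_model (phl_of T) M" and hom: "is_hom (phl_of T) M N h"
begin

lemma hom_ops:
  "A \<in> car M (Ctx, Suc n) \<Longrightarrow> ft_of N n (h (Ctx, Suc n) A) = h (Ctx, n) (ft_of M n A)"
  "a \<in> car M (Tm, n) \<Longrightarrow> ty_of N n (h (Tm, n) a) = h (Ctx, Suc n) (ty_of M n a)"
  "G \<in> car M (Ctx, n) \<Longrightarrow> i < n \<Longrightarrow> vr_of N n i (h (Ctx, n) G) = h (Tm, n) (vr_of M n i G)"
  using ops_total[OF M, THEN is_homD(3)[OF hom]] by (simp_all add: ft_of_def ty_of_def vr_of_def)

lemma hom_bd: "a \<in> car M (psort p n) \<Longrightarrow> bd N p n (h (psort p n) a) = h (dsort p n) (bd M p n a)"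
  by (cases p) (simp_all add: hom_ops)

lemma hom_vars:
  assumes "A \<in> car M (Ctx, Suc n)"
  shows "map2 h (replicate n (Tm, Suc n)) (map (\<lambda>i. vr_of M (Suc n) i A) (rev [1..<Suc n])) =
    map (\<lambda>i. vr_of N (Suc n) i (h (Ctx, Suc n) A)) (rev [1..<Suc n])"
proof -
  have "map2 h (replicate n s) xs = map (h s) xs" if "length xs = n" for s xs
    using that by (induction xs arbitrary: n) auto
  then show ?thesis using assms by (auto simp: hom_ops)
qed

lemma hom_wk:
  assumes "A \<in> car M (Ctx, Suc n)" "wk M n A A' = Some B"
  shows "wk N n (h (Ctx, Suc n) A) (h (Ctx, Suc n) A') = Some (h (Ctx, Suc (Suc n)) B)"
proof -
  let ?xs = "A # A' # map (\<lambda>i. vr_of M (Suc n) i A) (rev [1..<Suc n])"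
  have "map2 h (far (phl_of T) (Subst TY (Suc n) n)) ?xs =
      h (Ctx, Suc n) A # h (Ctx, Suc n) A' # map (\<lambda>i. vr_of N (Suc n) i (h (Ctx, Suc n) A)) (rev [1..<Suc n])"
    using hom_vars[OF assms(1)] by simp
  then show ?thesis
    using is_homD(3)[OF hom, of "Subst TY (Suc n) n" ?xs B] assms(2) by (simp add: wk_def)
qed

lemma hom_inst:
  assumes "A \<in> car M (Ctx, Suc n)" "inst M n A g f = Some B"
  shows "inst N n (h (Ctx, Suc n) A) (h (Tm, Suc n) g) (h (Tm, Suc n) f) = Some (h (Tm, Suc n) B)"
proof -
  let ?xs = "A # g # map (\<lambda>i. vr_of M (Suc n) i A) (rev [1..<Suc n]) @ [f]"
  \<comment> \<open>The \<open>Suc n\<close> substituted terms are \<open>n\<close> variables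
    followed by \<open>f\<close>, so the block of argument sorts is split at its last entry to
    match.\<close>
  have "far (phl_of T) (Subst TM (Suc n) (Suc n)) =
      (Ctx, Suc n) # (Tm, Suc n) # replicate n (Tm, Suc n) @ [(Tm, Suc n)]"
    by (simp add: replicate_append_same)
  then have "map2 h (far (phl_of T) (Subst TM (Suc n) (Suc n))) ?xs =
      h (Ctx, Suc n) A # h (Tm, Suc n) g #
      map (\<lambda>i. vr_of N (Suc n) i (h (Ctx, Suc n) A)) (rev [1..<Suc n]) @ [h (Tm, Suc n) f]"
    using hom_vars[OF assms(1)]
    by (simp del: upt_Suc replicate_Suc sym_args.simps phl_of_simps)
  then show ?thesis
    using is_homD(3)[OF hom, of "Subst TM (Suc n) (Suc n)" ?xs B] assms(2) by (simp add: inst_def)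
qed

text \<open>A homomorphism of models is also one between their reducts to \<open>Id0\<close>, where
  identity types are a basic operation.\<close>

lemma hom_id_of:
  assumes "is_theory T" "a \<in> car M (Tm, n)" "id_of T M n a b = Some B"
  shows "id_of T N n (h (Tm, n) a) (h (Tm, n) b) = Some (h (Ctx, Suc n) B)"
proof -
  have "wf_interp (phl_of Id0) (phl_of T) (id_mor T)"
    using assms(1) by (simp add: is_theory_def phl_morphism_wf_interp adtt_morphism_phl)
  from is_homD(3)[OF is_hom_reduct[OF M this hom] assms(3)[unfolded id_of_def]]
  show ?thesis unfolding Op_Id0 id_of_def
    using assms(2) ops_in_car(2)[OF M assms(2)] by (simp add: hom_ops)
qed

lemma hom_typed:
  assumes "b \<in> car M (Tm, n)" "typed M n G b B" "\<And>C. B = Some C \<Longrightarrow> B' = Some (h (Ctx, Suc n) C)"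
  shows "typed N n (h (Ctx, n) G) (h (Tm, n) b) B'"
  using assms ops_in_car(2)[OF M assms(1)] unfolding typed_def by (auto simp: hom_ops)

lemma hom_ty_homotopy:
  assumes "is_theory T" "A \<in> car M (Ctx, Suc n)" "A' \<in> car M (Ctx, Suc n)"
    "f \<in> car M (Tm, Suc n)" "g \<in> car M (Tm, Suc n)" "p \<in> car M (Tm, Suc n)"
    "g' \<in> car M (Tm, Suc n)" "p' \<in> car M (Tm, Suc n)" "ty_homotopy T M n A A' f g p g' p'"
  shows "ty_homotopy T N n (h (Ctx, Suc n) A) (h (Ctx, Suc n) A') (h (Tm, Suc n) f) (h (Tm, Suc n) g)
    (h (Tm, Suc n) p) (h (Tm, Suc n) g') (h (Tm, Suc n) p')"
proof -
  from assms(9) obtain gf fg' where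
    H: "ft_of M n A = ft_of M n A'" "typed M (Suc n) A f (wk M n A A')" "typed M (Suc n) A' g (wk M n A' A)"
      "typed M (Suc n) A' g' (wk M n A' A)" and
    gf: "inst M n A g f = Some gf" "typed M (Suc n) A p (id_of T M (Suc n) gf (vr_of M (Suc n) 0 A))" and
    fg': "inst M n A' f g' = Some fg'" "typed M (Suc n) A' p' (id_of T M (Suc n) fg' (vr_of M (Suc n) 0 A'))"
    unfolding ty_homotopy_def by blast
  have car: "gf \<in> car M (Tm, Suc n)" "fg' \<in> car M (Tm, Suc n)"
    using is_model_fnD[OF M] gf(1) fg'(1) unfolding inst_def by fastforce+
  have vr: "vr_of N (Suc n) 0 (h (Ctx, Suc n) A) = h (Tm, Suc n) (vr_of M (Suc n) 0 A)"
    "vr_of N (Suc n) 0 (h (Ctx, Suc n) A') = h (Tm, Suc n) (vr_of M (Suc n) 0 A')"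
    using hom_ops(3) assms(2,3) by simp_all
  show ?thesis unfolding ty_homotopy_def vr
  proof (intro conjI exI)
    show "ft_of N n (h (Ctx, Suc n) A) = ft_of N n (h (Ctx, Suc n) A')"
      using H(1) assms(2,3) by (simp add: hom_ops)
    show "inst N n (h (Ctx, Suc n) A) (h (Tm, Suc n) g) (h (Tm, Suc n) f) = Some (h (Tm, Suc n) gf)"
      "inst N n (h (Ctx, Suc n) A') (h (Tm, Suc n) f) (h (Tm, Suc n) g') = Some (h (Tm, Suc n) fg')"
      using hom_inst assms(2,3) gf(1) fg'(1) by blast+
    show "typed N (Suc n) (h (Ctx, Suc n) A) (h (Tm, Suc n) f) (wk N n (h (Ctx, Suc n) A) (h (Ctx, Suc n) A'))"
      by (rule hom_typed[OF assms(4) H(2)]) (rule hom_wk[OF assms(2)])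
    show "typed N (Suc n) (h (Ctx, Suc n) A') (h (Tm, Suc n) g) (wk N n (h (Ctx, Suc n) A') (h (Ctx, Suc n) A))"
      by (rule hom_typed[OF assms(5) H(3)]) (rule hom_wk[OF assms(3)])
    show "typed N (Suc n) (h (Ctx, Suc n) A') (h (Tm, Suc n) g') (wk N n (h (Ctx, Suc n) A') (h (Ctx, Suc n) A))"
      by (rule hom_typed[OF assms(7) H(4)]) (rule hom_wk[OF assms(3)])
    show "typed N (Suc n) (h (Ctx, Suc n) A) (h (Tm, Suc n) p)
        (id_of T N (Suc n) (h (Tm, Suc n) gf) (h (Tm, Suc n) (vr_of M (Suc n) 0 A)))"
      by (rule hom_typed[OF assms(6) gf(2)]) (rule hom_id_of[OF assms(1) car(1)])
    show "typed N (Suc n) (h (Ctx, Suc n) A') (h (Tm, Suc n) p')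
        (id_of T N (Suc n) (h (Tm, Suc n) fg') (h (Tm, Suc n) (vr_of M (Suc n) 0 A')))"
      by (rule hom_typed[OF assms(8) fg'(2)]) (rule hom_id_of[OF assms(1) car(2)])
  qed
qed

text \<open>Needed to push free models on a homotopy forward: the image of the universal homotopy
  under the unit must be a homotopy again.\<close>

lemma hom_is_homotopy:
  assumes "is_theory T" "elems M (psort p n # psort p n # htpy_sorts p n) (a # a' # hs)"
    "is_homotopy T M p n a a' hs"
  shows "is_homotopy T N p n (h (psort p n) a) (h (psort p n) a') (map2 h (htpy_sorts p n) hs)"
proof (cases p)
  case TY
  then obtain f g q g' q' where hs: "hs = [f, g, q, g', q']" "ty_homotopy T M n a a' f g q g' q'"
    using assms(3) by auto
  then show ?thesis using hom_ty_homotopy[OF assms(1) _ _ _ _ _ _ _ hs(2)] assms(2) TY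
    by (simp add: numeral_eq_Suc)
next
  case TM
  then obtain k where hs: "hs = [k]" "id_of T M n a a' = Some (ty_of M n k)"
    using assms(3) by (auto simp: tm_homotopy_def)
  then show ?thesis using hom_id_of[OF assms(1) _ hs(2)] assms(2) TM
    by (simp add: tm_homotopy_def hom_ops)
qed

end

section \<open>Generating cofibrations\<close>

lemma free_model_cong:
  assumes "free_model T ss S M xs" "\<And>N ys. is_model (phl_of T) N \<Longrightarrow> elems N ss ys \<Longrightarrow> S N ys \<longleftrightarrow> S' N ys"
  shows "free_model T ss S' M xs"
  using assms(1) unfolding free_model_def Obj_Mod by (metis assms(2))

lemma free_model_hom:
  assumes "free_model T ss S M xs" "is_model (phl_of T) N" "elems N ss ys" "S N ys"
  obtains h where "is_hom (phl_of T) M N h" "map2 h ss xs = ys"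
  using assms unfolding free_model_def Obj_Mod by metis

lemma free_model_hom_unique:
  assumes "free_model T ss S M xs" "is_model (phl_of T) N" "S N (map2 h ss xs)"
    "is_hom (phl_of T) M N h" "is_hom (phl_of T) M N h'" "map2 h ss xs = map2 h' ss xs"
  shows "h = h'"
proof -
  have "elems N ss (map2 h ss xs)"
    using assms(1,4) is_hom_elems unfolding free_model_def by blast
  then show ?thesis using assms unfolding free_model_def Obj_Mod by metis
qed

text \<open>Arrows from \<open>Z\<close> to \<open>N\<close> correspond to arrows from
  \<open>P\<close> to the reduct of \<open>N\<close>, hence to tuples satisfying \<open>S1\<close>
  there, which are the tuples satisfying \<open>S2\<close> in \<open>N\<close>. Preservation of
  \<open>S1\<close> by homomorphisms makes the image of \<open>xs\<close> such a tuple.\<close>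

lemma free_model_push:
  assumes free: "free_model T1 ss S1 P xs"
    and unit: "is_unit T1 T2 F P Z (P, e, pull_obj T1 F Z)"
    and T: "is_theory T1" "is_theory T2" "adtt_morphism T1 T2 F"
    and S: "\<And>N ys. is_model (phl_of T2) N \<Longrightarrow> S1 (pull_obj T1 F N) ys \<longleftrightarrow> S2 N ys"
    and hom: "\<And>M N h xs. is_model (phl_of T1) M \<Longrightarrow> is_model (phl_of T1) N \<Longrightarrow>
      is_hom (phl_of T1) M N h \<Longrightarrow> elems M ss xs \<Longrightarrow> S1 M xs \<Longrightarrow> S1 N (map2 h ss xs)"
  shows "free_model T2 ss S2 Z (map2 e ss xs)"
proof -
  from free have P: "is_model (phl_of T1) P" "elems P ss xs" "S1 P xs" by (simp_all add: free_model_def)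
  from unit have Z: "is_model (phl_of T2) Z" and e: "is_hom (phl_of T1) P (pull_obj T1 F Z) e"
    by (simp_all add: is_unit_def universal_arrow_def)
  note pull = is_model_pull_obj[OF T]
  have "elems Z ss (map2 e ss xs)" using is_hom_elems[OF e P(2)] by simp
  moreover have "S2 Z (map2 e ss xs)" using hom[OF P(1) pull[OF Z] e P(2,3)] S[OF Z] by simp
  moreover have "\<exists>!k. is_hom (phl_of T2) Z N k \<and> map2 k ss (map2 e ss xs) = ys"
    if N: "is_model (phl_of T2) N" "elems N ss ys" "S2 N ys" for N ys
  proof -
    have N': "elems (pull_obj T1 F N) ss ys" "S1 (pull_obj T1 F N) ys" using N S[OF N(1)] by simp_all
    obtain g where g: "is_hom (phl_of T1) P (pull_obj T1 F N) g" "map2 g ss xs = ys"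
      using free_model_hom[OF free pull[OF N(1)] N'] .
    have "(P, g, pull_obj T1 F N) \<in> Hom (Mod T1) P (pull_obj T1 F N)" using P g pull[OF N(1)] by simp
    moreover have "N \<in> Obj (Mod T2)" using N(1) by simp
    ultimately have "\<exists>!k. k \<in> Hom (Mod T2) Z N \<and>
        Comp (Mod T1) (pull_arr T1 F k) (P, e, pull_obj T1 F Z) = (P, g, pull_obj T1 F N)"
      using unit unfolding is_unit_def universal_arrow_def by blast
    then obtain k where k: "k \<in> Hom (Mod T2) Z N"
        "Comp (Mod T1) (pull_arr T1 F k) (P, e, pull_obj T1 F Z) = (P, g, pull_obj T1 F N)"
      and uniq: "\<And>k'. k' \<in> Hom (Mod T2) Z N \<Longrightarrow>
        Comp (Mod T1) (pull_arr T1 F k') (P, e, pull_obj T1 F Z) = (P, g, pull_obj T1 F N) \<Longrightarrow> k' = k"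
      by blast
    from k(1) obtain k0 where k0: "k = (Z, k0, N)" "is_hom (phl_of T2) Z N k0" by auto
    have ex1: "\<exists>!k. is_hom (phl_of T2) Z N k \<and> hcomp P k e = g"
    proof (rule ex1I, rule conjI)
      show "is_hom (phl_of T2) Z N k0" "hcomp P k0 e = g" using k(2) k0 by simp_all
      show "k' = k0" if "is_hom (phl_of T2) Z N k' \<and> hcomp P k' e = g" for k'
        using uniq[of "(Z, k', N)"] that Z N(1) k0 by simp
    qed
    \<comment> \<open>Arrows out of the free model \<open>P\<close> agree as soon as they agree on
      \<open>xs\<close>; this turns the unique factorization through the unit into unique extension
      of tuples.\<close>
    have "hcomp P k e = g \<longleftrightarrow> map2 k ss (map2 e ss xs) = ys" if "is_hom (phl_of T2) Z N k" for k
    proof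
      assume "hcomp P k e = g"
      then show "map2 k ss (map2 e ss xs) = ys" using map2_hcomp[OF P(2), of k e] g(2) by simp
    next
      assume "map2 k ss (map2 e ss xs) = ys"
      then have "map2 g ss xs = map2 (hcomp P k e) ss xs" using map2_hcomp[OF P(2), of k e] g(2) by simp
      moreover have "is_hom (phl_of T1) P (pull_obj T1 F N) (hcomp P k e)"
        using is_hom_hcomp[OF P(1) e is_hom_pull_obj[OF T(3) Z that]] by simp
      moreover have "S1 (pull_obj T1 F N) (map2 g ss xs)" using g(2) N'(2) by simp
      ultimately show "hcomp P k e = g"
        using free_model_hom_unique[OF free pull[OF N(1)] _ g(1)] by metis
    qed
    then show ?thesis using ex1 by (metis (mono_tags, lifting))
  qed
  ultimately show ?thesis using Z unfolding free_model_def Obj_Mod by blast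
qed

lemma ex_free_any:
  fixes T :: "('f, 'r) id_theory"
  assumes "is_theory T" "small_theory TYPE('u) T"
  shows "\<exists>P A. free_model T [s] (\<lambda>M xs. True) (P :: ('f, 'r, 'u) smodel) [A]"
proof -
  obtain P xs where P: "free_model T [s] (\<lambda>M xs. sat_horn M (\<lambda>i s. xs ! i) []) (P :: ('f, 'r, 'u) smodel) xs"
    using ex_free_model[OF assms, of "[s]" "[]"] by auto
  then obtain A where "xs = [A]" by (auto simp: free_model_def)
  then show ?thesis using P by auto
qed

lemma ex_free_bd:
  fixes T :: "('f, 'r) id_theory"
  assumes "is_theory T" "small_theory TYPE('u) T"
  shows "\<exists>Q A a. free_model T [dsort p n, psort p n] (\<lambda>M xs. bd M p n (xs ! 1) = xs ! 0)
    (Q :: ('f, 'r, 'u) smodel) [A, a]"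
proof -
  \<comment> \<open>Since \<open>Ft\<close> and \<open>TyOf\<close> are total in models, the
    boundary relation is a single equation between terms, to which the construction of free models
    by Horn formulas applies.\<close>
  define f :: "'f fsym" where "f = (case p of TY \<Rightarrow> Ft n | TM \<Rightarrow> TyOf n)"
  define \<phi> :: "('f, 'r) shorn" where "\<phi> = [Eq (App f [Var 1 (psort p n)]) (Var 0 (dsort p n))]"
  let ?ss = "[dsort p n, psort p n]"
  have "wf_horn (phl_of T) (ctxvars ?ss) \<phi>"
    by (cases p) (auto simp: \<phi>_def f_def ctxvars_iff)
  then obtain Q xs where Q: "free_model T ?ss (\<lambda>M xs. sat_horn M (\<lambda>i s. xs ! i) \<phi>) (Q :: ('f, 'r, 'u) smodel) xs"
    using ex_free_model[OF assms] by blast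
  then obtain A a where xs: "xs = [A, a]" by (auto simp: free_model_def)
  have "free_model T ?ss (\<lambda>M xs. bd M p n (xs ! 1) = xs ! 0) Q xs"
  proof (rule free_model_cong[OF Q])
    fix N :: "('f, 'r, 'u) smodel" and ys
    assume N: "is_model (phl_of T) N" "elems N ?ss ys"
    then show "sat_horn N (\<lambda>i s. ys ! i) \<phi> \<longleftrightarrow> bd N p n (ys ! 1) = ys ! 0"
      using ops_total[OF N(1)] by (cases p) (auto simp: \<phi>_def f_def)
  qed
  then show ?thesis unfolding xs by blast
qed

text \<open>Arrows out of the two free models are elements, respectively elements over a boundary,
  so a lift is an element of \<open>X\<close> over \<open>A\<close> with image \<open>a\<close>.
  Existence of the free models supplies a generating cofibration to lift against.\<close>

lemma rlp_gen_cofs: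
  fixes T :: "('f, 'r) id_theory" and X Y :: "('f, 'r, 'u) smodel"
  assumes T: "is_theory T" "small_theory TYPE('u) T"
    and f: "(X, f, Y) \<in> rlp (Mod T) (gen_cofs T)"
    and A: "A \<in> car X (dsort p n)" and a: "a \<in> car Y (psort p n)" "bd Y p n a = f (dsort p n) A"
  shows "\<exists>a'\<in>car X (psort p n). bd X p n a' = A \<and> f (psort p n) a' = a"
proof -
  let ?d = "dsort p n" and ?p = "psort p n"
  let ?S = "\<lambda>(M :: ('f, 'r, 'u) smodel) xs. bd M p n (xs ! 1) = xs ! 0"
  from f have X: "is_model (phl_of T) X" and Y: "is_model (phl_of T) Y" and h: "is_hom (phl_of T) X Y f"
    and lift: "\<And>i. i \<in> gen_cofs T \<Longrightarrow> lifts (Mod T) i (X, f, Y)"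
    by (auto simp: rlp_def)
  obtain P A0 where P: "free_model T [?d] (\<lambda>M xs. True) (P :: ('f, 'r, 'u) smodel) [A0]"
    using ex_free_any[OF T] by blast
  obtain Q A1 a1 where Q: "free_model T [?d, ?p] ?S Q [A1, a1]"
    using ex_free_bd[OF T] by blast
  have PM: "is_model (phl_of T) P" "A0 \<in> car P ?d" using P by (simp_all add: free_model_def)
  have QM: "is_model (phl_of T) Q" "A1 \<in> car Q ?d" "a1 \<in> car Q ?p" "bd Q p n a1 = A1"
    using Q by (simp_all add: free_model_def)
  obtain i where i: "is_hom (phl_of T) P Q i" "i ?d A0 = A1"
    using free_model_hom[OF P QM(1), of "[A1]"] QM by auto
  obtain u where u: "is_hom (phl_of T) P X u" "u ?d A0 = A"
    using free_model_hom[OF P X, of "[A]"] A by auto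
  obtain v where v: "is_hom (phl_of T) Q Y v" "v ?d A1 = f ?d A" "v ?p a1 = a"
    using free_model_hom[OF Q Y, of "[f ?d A, a]"] a is_homD(1)[OF h A] by auto
  have "(P, i, Q) \<in> gen_cofs T"
    unfolding gen_cofs_def using P Q i PM QM by auto
  note lift = lift[OF this]
  have "hcomp P f u = hcomp P v i"
    by (rule free_model_hom_unique[OF P Y _ is_hom_hcomp[OF PM(1) u(1) h] is_hom_hcomp[OF PM(1) i(1) v(1)]])
      (use PM i u v in \<open>simp_all add: hcomp_def\<close>)
  then have sq: "Comp (Mod T) (X, f, Y) (P, u, X) = Comp (Mod T) (Q, v, Y) (P, i, Q)" by simp
  have uv: "(P, u, X) \<in> Hom (Mod T) P X" "(Q, v, Y) \<in> Hom (Mod T) Q Y"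
    using X Y PM QM u(1) v(1) by simp_all
  have "\<exists>d\<in>Hom (Mod T) Q X. Comp (Mod T) d (P, i, Q) = (P, u, X) \<and>
      Comp (Mod T) (X, f, Y) d = (Q, v, Y)"
    using lift[unfolded lifts_def Dom_Cod_Mod] uv sq by blast
  then obtain d where d: "is_hom (phl_of T) Q X d" "hcomp Q f d = v" "hcomp P d i = u" by auto
  have "d ?p a1 \<in> car X ?p" using is_homD(1)[OF d(1)] QM by blast
  moreover have "f ?p (d ?p a1) = a" using d(2) v(3) QM by (auto simp: hcomp_def)
  moreover have "d ?d A1 = A" using d(3) u(2) i(2) PM by (auto simp: hcomp_def)
  then have "bd X p n (d ?p a1) = A" using hom_bd[OF QM(1) d(1) QM(3)] QM by simp
  ultimately show ?thesis by blast
qed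

lemma car_Ctx_0:
  assumes "is_model (phl_of T) M"
  shows "\<exists>G. fn M One [] = Some G \<and> car M (Ctx, 0) = {G}"
proof -
  have "({}, [], [defd (App One [])]) \<in> axioms (phl_of T)"
    "(ctxvars [(Ctx, 0)], [], [Eq (Var 0 (Ctx, 0)) (App One [])]) \<in> axioms (phl_of T)"
    by (simp_all add: phl_of_def subst_axioms_def one_axioms_def)
  note ax = this[THEN is_model_axiomD[OF assms]]
  obtain G where G: "fn M One [] = Some G"
    using ax(1)[of "\<lambda>i s. undefined"] by (auto simp: valuation_def)
  moreover have "G \<in> car M (Ctx, 0)" using is_model_fnD[OF assms G] by simp
  moreover have "x = G" if "x \<in> car M (Ctx, 0)" for x
  proof -
    have "valuation M (ctxvars [(Ctx, 0)]) (\<lambda>i s. x)" using that by (auto simp: valuation_def ctxvars_iff)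
    from ax(2)[OF this] show ?thesis using G by simp
  qed
  ultimately show ?thesis by blast
qed

text \<open>Lifting only provides elements over a boundary already in the image. The induction
  starts at the one-element carrier of \<open>(Ctx, 0)\<close>; a term is lifted after its
  type.\<close>

lemma rlp_gen_cofs_surj:
  fixes T :: "('f, 'r) id_theory" and X Y :: "('f, 'r, 'u) smodel"
  assumes T: "is_theory T" "small_theory TYPE('u) T"
    and f: "(X, f, Y) \<in> rlp (Mod T) (gen_cofs T)"
  shows "a \<in> car Y s \<Longrightarrow> \<exists>a'\<in>car X s. f s a' = a"
proof -
  from f have X: "is_model (phl_of T) X" and Y: "is_model (phl_of T) Y" and h: "is_hom (phl_of T) X Y f"
    by (auto simp: rlp_def)
  note lift = rlp_gen_cofs[OF T f]
  have ctx: "\<forall>a\<in>car Y (Ctx, n). \<exists>a'\<in>car X (Ctx, n). f (Ctx, n) a' = a" for n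
  proof (induction n)
    case 0
    obtain G where "fn X One [] = Some G" "car X (Ctx, 0) = {G}" using car_Ctx_0[OF X] by blast
    moreover obtain G' where "fn Y One [] = Some G'" "car Y (Ctx, 0) = {G'}" using car_Ctx_0[OF Y] by blast
    ultimately show ?case using is_homD(3)[OF h, of One "[]" G] by auto
  next
    case (Suc n)
    then show ?case using lift[of _ TY n] ops_in_car(1)[OF Y] by fastforce
  qed
  assume a: "a \<in> car Y s"
  obtain k n where s: "s = (k, n)" by force
  show ?thesis
  proof (cases k)
    case Ctx
    then show ?thesis using a s ctx by blast
  next
    case Tm
    then obtain A where "A \<in> car X (Ctx, Suc n)" "f (Ctx, Suc n) A = ty_of Y n a"
      using ctx[of "Suc n"] ops_in_car(2)[OF Y] a s by blast
    then show ?thesis using lift[of A TM n a] a s Tm by auto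
  qed
qed

text \<open>An arrow out of \<open>P\<close> is an element of sort \<open>s\<close>, so lifting it
  along \<open>q\<close> amounts to surjectivity of \<open>q\<close> on that sort.\<close>

lemma free_any_cofibrant:
  fixes T :: "('f, 'r) id_theory" and P :: "('f, 'r, 'u) smodel"
  assumes T: "is_theory T" "small_theory TYPE('u) T"
    and P: "free_model T [s] (\<lambda>M xs. True) P [a]"
  shows "cofibrant (Mod T) (cofs T) P"
proof -
  interpret cat "Mod T :: (_, ('f, 'r, 'u) model_arrow) category" by (rule cat_Mod)
  have PM: "is_model (phl_of T) P" "a \<in> car P s" using P by (simp_all add: free_model_def)
  have sub: "rlp (Mod T) (gen_cofs T :: ('f, 'r, 'u) model_arrow set) \<subseteq> Arr (Mod T)" by (auto simp: rlp_def)
  show ?thesis unfolding cofs_def cofibrant_llp_iff[OF ex_initial[OF T] sub]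
  proof (intro conjI ballI)
    show "P \<in> Obj (Mod T)" using PM by simp
    fix q v assume q: "q \<in> rlp (Mod T) (gen_cofs T)" and v: "v \<in> Hom (Mod T) P (Cod (Mod T) q)"
    obtain X f Y where q': "q = (X, f, Y)" by (metis surj_pair)
    with q sub have XY: "is_model (phl_of T) X" "is_model (phl_of T) Y" "is_hom (phl_of T) X Y f" by auto
    from v q' obtain k where k: "v = (P, k, Y)" "is_hom (phl_of T) P Y k" by auto
    obtain a' where a': "a' \<in> car X s" "f s a' = k s a"
      using rlp_gen_cofs_surj[OF T q[unfolded q']] is_homD(1)[OF k(2) PM(2)] by blast
    obtain d where d: "is_hom (phl_of T) P X d" "d s a = a'"
      using free_model_hom[OF P XY(1), of "[a']"] a' by auto
    have "hcomp P f d = k"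
      by (rule free_model_hom_unique[OF P XY(2) _ is_hom_hcomp[OF PM(1) d(1) XY(3)] k(2)])
        (use PM d a' in \<open>simp_all add: hcomp_def\<close>)
    then have "Comp (Mod T) q (P, d, X) = v" by (simp add: q' k(1))
    moreover have "(P, d, X) \<in> Hom (Mod T) P (Dom (Mod T) q)" using PM XY d by (simp add: q')
    ultimately show "\<exists>d\<in>Hom (Mod T) P (Dom (Mod T) q). Comp (Mod T) q d = v" by blast
  qed
qed

lemma gen_triv_cofs_subset:
  fixes T :: "('f, 'r) id_theory"
  assumes "is_theory T" "small_theory TYPE('u) T" "semi_model TYPE('u) T"
  shows "gen_triv_cofs T \<subseteq> (cofs T \<inter> weqs T :: ('f, 'r, 'u) model_arrow set)"
proof
  interpret cat "Mod T :: (_, ('f, 'r, 'u) model_arrow) category" by (rule cat_Mod)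
  fix j :: "('f, 'r, 'u) model_arrow" assume j: "j \<in> gen_triv_cofs T"
  then obtain P i Q p n a where "j = (P, i, Q)" "free_model T [psort p n] (\<lambda>M xs. True) P [a]"
    unfolding gen_triv_cofs_def by blast
  then have "cofibrant (Mod T) (cofs T) (Dom (Mod T) j)"
    using free_any_cofibrant[OF assms(1,2)] by simp
  moreover have "gen_triv_cofs T \<subseteq> Arr (Mod T)" by (auto simp: gen_triv_cofs_def)
  ultimately show "j \<in> cofs T \<inter> weqs T"
    using triv_cof_of_lifts_fibs[of "cofs T" "weqs T" "gen_triv_cofs T" j] j assms(3)
    unfolding semi_model_def fibs_def by blast
qed

lemma gen_cofs_subset_cofs: "gen_cofs T \<subseteq> cofs T"
  unfolding cofs_def llp_def rlp_def gen_cofs_def by blast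

section \<open>The Quillen adjunction\<close>

lemma map2_Cons: "map2 h (s # ss) (x # xs) = h s x # map2 h ss xs" "map2 h [] [] = []"
  by simp_all

text \<open>The generating sets contain every suitable arrow between free models. It therefore
  suffices that both pushed models are free and that the pushed arrow sends the image of the
  generator to the right place; passing to a saturation is unnecessary.\<close>

lemma push_arr_gen:
  fixes T1 :: "('f, 'r) id_theory" and T2 :: "('g, 'q) id_theory" and F :: "('f, 'r, 'g, 'q) mor"
  assumes T: "is_theory T1" "is_theory T2" "small_theory TYPE('u) T2" "theory_morphism T1 T2 F"
  shows "i \<in> gen_cofs T1 \<Longrightarrow> push_arr T1 T2 F i \<in> (gen_cofs T2 :: ('g, 'q, 'u) model_arrow set)"
    "j \<in> gen_triv_cofs T1 \<Longrightarrow> push_arr T1 T2 F j \<in> (gen_triv_cofs T2 :: ('g, 'q, 'u) model_arrow set)"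
proof -
  have F: "adtt_morphism T1 T2 F" using T(4) by (simp add: theory_morphism_def)
  interpret adj "Mod T1 :: (_, ('f, 'r, 'u) model_arrow) category" "Mod T2" "pull_obj T1 F" "pull_arr T1 F"
    "push_obj T1 T2 F" "unit_arr T1 T2 F"
    by (rule adj_Mod[OF T(1-3) F])
  have push_arr: "push_arr T1 T2 F h = push h" for h :: "('f, 'r, 'u) model_arrow"
    by (simp only: push_arr_def push_def adjunct_def Let_def)
  have unit: "\<exists>e. unit_arr T1 T2 F P = (P, e, pull_obj T1 F (push_obj T1 T2 F P)) \<and>
      is_unit T1 T2 F P (push_obj T1 T2 F P) (P, e, pull_obj T1 F (push_obj T1 T2 F P))"
    if "is_model (phl_of T1) P" for P :: "('f, 'r, 'u) smodel"
    using is_unit_push[OF T(1-3) F that] eta_Hom[of P] that by auto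
  \<comment> \<open>Naturality of the unit, read on elements: this locates the image of the
    generator under the pushed arrow.\<close>
  have push_hom: "\<exists>k. push (P, i, Q) = (push_obj T1 T2 F P, k, push_obj T1 T2 F Q) \<and>
      push (P, i, Q) \<in> Arr (Mod T2) \<and> (\<forall>s. \<forall>x\<in>car P s. k s (eP s x) = eQ s (i s x))"
    if PQ: "(P, i, Q) \<in> Arr (Mod T1)"
      and e: "unit_arr T1 T2 F P = (P, eP, pull_obj T1 F (push_obj T1 T2 F P))"
        "unit_arr T1 T2 F Q = (Q, eQ, pull_obj T1 F (push_obj T1 T2 F Q))"
    for P Q :: "('f, 'r, 'u) smodel" and i eP eQ
  proof -
    have "(P, i, Q) \<in> Hom (Mod T1) P Q" using PQ by simp
    note push = push[OF this]
    from push(1) obtain k where k: "push (P, i, Q) = (push_obj T1 T2 F P, k, push_obj T1 T2 F Q)" by auto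
    from push(2) have "hcomp P k eP = hcomp P eQ i" unfolding k e by simp
    then have "k s (eP s x) = eQ s (i s x)" if "x \<in> car P s" for s x
      using that by (metis hcomp_def)
    then show ?thesis using k D.Hom_D(1)[OF push(1)] by blast
  qed
  note free_push = free_model_push[OF _ _ T(1,2) F]
  show "push_arr T1 T2 F i \<in> gen_cofs T2" if "i \<in> gen_cofs T1" for i :: "('f, 'r, 'u) model_arrow"
  proof -
    from that obtain P h Q p n A A' a where i: "i = (P, h, Q)" "i \<in> Arr (Mod T1)"
      and P: "free_model T1 [dsort p n] (\<lambda>M xs. True) P [A]"
      and Q: "free_model T1 [dsort p n, psort p n] (\<lambda>M xs. bd M p n (xs ! 1) = xs ! 0) Q [A', a]"
      and hA: "h (dsort p n) A = A'"
      unfolding gen_cofs_def by blast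
    have PQ: "is_model (phl_of T1) P" "is_model (phl_of T1) Q" "A \<in> car P (dsort p n)"
      using P Q by (simp_all add: free_model_def)
    obtain eP where eP: "unit_arr T1 T2 F P = (P, eP, pull_obj T1 F (push_obj T1 T2 F P))"
      "is_unit T1 T2 F P (push_obj T1 T2 F P) (P, eP, pull_obj T1 F (push_obj T1 T2 F P))"
      using unit[OF PQ(1)] by blast
    obtain eQ where eQ: "unit_arr T1 T2 F Q = (Q, eQ, pull_obj T1 F (push_obj T1 T2 F Q))"
      "is_unit T1 T2 F Q (push_obj T1 T2 F Q) (Q, eQ, pull_obj T1 F (push_obj T1 T2 F Q))"
      using unit[OF PQ(2)] by blast
    obtain k where k: "push i = (push_obj T1 T2 F P, k, push_obj T1 T2 F Q)" "push i \<in> Arr (Mod T2)"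
      "\<forall>s. \<forall>x\<in>car P s. k s (eP s x) = eQ s (h s x)"
      using push_hom[OF i(2)[unfolded i(1)] eP(1) eQ(1)] unfolding i(1) by blast
    have fP: "free_model T2 [dsort p n] (\<lambda>M xs. True) (push_obj T1 T2 F P) (map2 eP [dsort p n] [A])"
      by (rule free_push[OF P eP(2)]) simp_all
    have fQ: "free_model T2 [dsort p n, psort p n] (\<lambda>M xs. bd M p n (xs ! 1) = xs ! 0)
        (push_obj T1 T2 F Q) (map2 eQ [dsort p n, psort p n] [A', a])"
      by (rule free_push[OF Q eQ(2)])
        (auto simp: bd_pull_obj[OF T(1,2,4)] hom_bd)
    have "k (dsort p n) (eP (dsort p n) A) = eQ (dsort p n) A'" using k(3) PQ(3) hA by blast
    then show ?thesis
      using fP[unfolded map2_Cons] fQ[unfolded map2_Cons] k(2)[unfolded k(1)]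
      unfolding push_arr k(1) gen_cofs_def by blast
  qed
  show "push_arr T1 T2 F j \<in> gen_triv_cofs T2" if "j \<in> gen_triv_cofs T1" for j :: "('f, 'r, 'u) model_arrow"
  proof -
    from that obtain P h Q p n a b b' hs where j: "j = (P, h, Q)" "j \<in> Arr (Mod T1)"
      and P: "free_model T1 [psort p n] (\<lambda>M xs. True) P [a]"
      and Q: "free_model T1 (psort p n # psort p n # htpy_sorts p n)
         (\<lambda>M xs. is_homotopy T1 M p n (xs ! 0) (xs ! 1) (drop 2 xs)) Q (b # b' # hs)"
      and ha: "h (psort p n) a = b"
      unfolding gen_triv_cofs_def by blast
    have PQ: "is_model (phl_of T1) P" "is_model (phl_of T1) Q" "a \<in> car P (psort p n)"
      using P Q by (simp_all add: free_model_def)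
    obtain eP where eP: "unit_arr T1 T2 F P = (P, eP, pull_obj T1 F (push_obj T1 T2 F P))"
      "is_unit T1 T2 F P (push_obj T1 T2 F P) (P, eP, pull_obj T1 F (push_obj T1 T2 F P))"
      using unit[OF PQ(1)] by blast
    obtain eQ where eQ: "unit_arr T1 T2 F Q = (Q, eQ, pull_obj T1 F (push_obj T1 T2 F Q))"
      "is_unit T1 T2 F Q (push_obj T1 T2 F Q) (Q, eQ, pull_obj T1 F (push_obj T1 T2 F Q))"
      using unit[OF PQ(2)] by blast
    obtain k where k: "push j = (push_obj T1 T2 F P, k, push_obj T1 T2 F Q)" "push j \<in> Arr (Mod T2)"
      "\<forall>s. \<forall>x\<in>car P s. k s (eP s x) = eQ s (h s x)"
      using push_hom[OF j(2)[unfolded j(1)] eP(1) eQ(1)] unfolding j(1) by blast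
    have fP: "free_model T2 [psort p n] (\<lambda>M xs. True) (push_obj T1 T2 F P) (map2 eP [psort p n] [a])"
      by (rule free_push[OF P eP(2)]) simp_all
    have fQ: "free_model T2 (psort p n # psort p n # htpy_sorts p n)
        (\<lambda>M xs. is_homotopy T2 M p n (xs ! 0) (xs ! 1) (drop 2 xs))
        (push_obj T1 T2 F Q) (map2 eQ (psort p n # psort p n # htpy_sorts p n) (b # b' # hs))"
    proof (rule free_push[OF Q eQ(2)])
      fix M N :: "('f, 'r, 'u) smodel" and h xs
      assume *: "is_model (phl_of T1) M" "is_hom (phl_of T1) M N h"
        "elems M (psort p n # psort p n # htpy_sorts p n) xs"
        "is_homotopy T1 M p n (xs ! 0) (xs ! 1) (drop 2 xs)"
      then obtain x y zs where "xs = x # y # zs" by auto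
      then show "is_homotopy T1 N p n (map2 h (psort p n # psort p n # htpy_sorts p n) xs ! 0)
          (map2 h (psort p n # psort p n # htpy_sorts p n) xs ! 1)
          (drop 2 (map2 h (psort p n # psort p n # htpy_sorts p n) xs))"
        using hom_is_homotopy[OF *(1,2) T(1), of p n x y zs] *(3,4) by (simp add: drop_Suc)
    qed (rule is_homotopy_pull_obj[OF T(1,2,4)])
    have "k (psort p n) (eP (psort p n) a) = eQ (psort p n) b" using k(3) PQ(3) ha by blast
    then show ?thesis
      using fP[unfolded map2_Cons] fQ[unfolded map2_Cons] k(2)[unfolded k(1)]
      unfolding push_arr k(1) gen_triv_cofs_def by blast
  qed
qed

theorem proposition2p5:
  fixes T1 :: "('f, 'r) id_theory" and T2 :: "('g, 'q) id_theory"
    and F :: "('f, 'r, 'g, 'q) mor"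
  assumes "is_theory T1" and "is_theory T2"
    and "small_theory TYPE('u) T1" and "small_theory TYPE('u) T2"
    and "semi_model TYPE('u) T1" and "semi_model TYPE('u) T2"
    and "theory_morphism T1 T2 F"
  shows "quillen_adjunction TYPE('u) T1 T2 F \<and>
    (quillen_equivalence TYPE('u) T1 T2 F \<longleftrightarrow> morita_equivalence TYPE('u) T1 T2 F)"
proof -
  have F: "adtt_morphism T1 T2 F" using assms(7) by (simp add: theory_morphism_def)
  interpret adj "Mod T1 :: (_, ('f, 'r, 'u) model_arrow) category" "Mod T2" "pull_obj T1 F" "pull_arr T1 F"
    "push_obj T1 T2 F" "unit_arr T1 T2 F"
    by (rule adj_Mod[OF assms(1,2,4) F])
  have push_arr: "push_arr T1 T2 F h = push h" for h :: "('f, 'r, 'u) model_arrow"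
    by (simp only: push_arr_def push_def adjunct_def Let_def)
  note push_gen = push_arr_gen[OF assms(1,2,4,7)]
  have "is_adjunction TYPE('u) T1 T2 F"
    unfolding is_adjunction_def
  proof (intro conjI ballI)
    show "pull_obj T1 F M \<in> Obj (Mod T1)" if "M \<in> Obj (Mod T2)" for M :: "('g, 'q, 'u) smodel"
      using that is_model_pull_obj[OF assms(1,2) F] by simp
    show "pull_arr T1 F k \<in> Arr (Mod T1)" if "k \<in> Arr (Mod T2)" for k :: "('g, 'q, 'u) model_arrow"
      using C.Hom_D(1)[OF Ga_Hom[OF D.Arr_Hom[OF that]]] .
    show "is_unit T1 T2 F X (push_obj T1 T2 F X) (unit_arr T1 T2 F X)" if "X \<in> Obj (Mod T1)"
      for X :: "('f, 'r, 'u) smodel"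
      using is_unit_push[OF assms(1,2,4) F] that by simp
  qed
  then have adjunction: "quillen_adjunction TYPE('u) T1 T2 F"
    unfolding quillen_adjunction_def
    using push_gen gen_cofs_subset_cofs gen_triv_cofs_subset[OF assms(2,4,6)] by blast
  have W1: "two_of_three (Mod T1) (weqs T1 :: ('f, 'r, 'u) model_arrow set)"
    using assms(5) unfolding semi_model_def left_semi_model_structure_def by blast
  have cof: "cofibrant (Mod T2) (cofs T2) (push_obj T1 T2 F X)"
    if "cofibrant (Mod T1) (cofs T1) X" for X :: "('f, 'r, 'u) smodel"
    unfolding cofs_def
  proof (rule Fo_cofibrant[OF ex_initial[OF assms(1,3)] ex_initial[OF assms(2,4)]])
    show "gen_cofs T1 \<subseteq> Arr (Mod T1)" by (auto simp: gen_cofs_def)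
    show "push i \<in> llp (Mod T2) (rlp (Mod T2) (gen_cofs T2))" if "i \<in> gen_cofs T1" for i
      using push_gen(1)[OF that] gen_cofs_subset_cofs unfolding push_arr cofs_def by blast
  qed (use that in \<open>simp add: cofs_def\<close>)
  have adjunct_weqs: "pull_arr T1 F k \<in> Arr (Mod T1)" "unit_arr T1 T2 F X \<in> Arr (Mod T1)"
    "Cod (Mod T1) (unit_arr T1 T2 F X) = Dom (Mod T1) (pull_arr T1 F k)"
    "pull_arr T1 F k \<in> weqs T1 \<longleftrightarrow> k \<in> weqs T2"
    if "X \<in> Obj (Mod T1)" "k \<in> Hom (Mod T2) (push_obj T1 T2 F X) Y"
    for X :: "('f, 'r, 'u) smodel" and Y k
    using C.Hom_D[OF Ga_Hom[OF that(2)]] C.Hom_D[OF eta_Hom[OF that(1)]]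
      pull_arr_weqs_iff[OF assms(1,2,7) D.Hom_D(1)[OF that(2)]] by simp_all
  have cof_Obj: "X \<in> Obj (Mod T1)" if "cofibrant (Mod T1) (cofs T1) X" for X :: "('f, 'r, 'u) smodel"
    using that C.Hom_Obj(2) unfolding cofibrant_def by blast
  have "quillen_equivalence TYPE('u) T1 T2 F" if "morita_equivalence TYPE('u) T1 T2 F"
    unfolding quillen_equivalence_def
  proof (intro conjI adjunction allI impI ballI)
    fix X :: "('f, 'r, 'u) smodel" and Y k
    assume X: "cofibrant (Mod T1) (cofs T1) X" and k: "k \<in> Hom (Mod T2) (push_obj T1 T2 F X) Y"
    have "unit_arr T1 T2 F X \<in> weqs T1" using that X unfolding morita_equivalence_def by blast
    then show "k \<in> weqs T2 \<longleftrightarrow> adjunct T1 T2 F X k \<in> weqs T1"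
      using W1 adjunct_weqs[OF cof_Obj[OF X] k] unfolding two_of_three_def adjunct_def by blast
  qed
  moreover have "morita_equivalence TYPE('u) T1 T2 F" if "quillen_equivalence TYPE('u) T1 T2 F"
    unfolding morita_equivalence_def
  proof (intro allI impI)
    fix X :: "('f, 'r, 'u) smodel"
    assume X: "cofibrant (Mod T1) (cofs T1) X"
    let ?Z = "push_obj T1 T2 F X"
    obtain I :: "('g, 'q, 'u) smodel" where I: "terminal (Mod T2) I"
      using terminal_one_model[OF is_theory_wf_phl[OF assms(2)]] by blast
    then obtain t where t: "t \<in> Hom (Mod T2) ?Z I"
      using Fo_Obj[OF cof_Obj[OF X]] unfolding terminal_def by blast
    \<comment> \<open>The fibrant replacement of \<open>f_!(X)\<close> comes from factoring its
      arrow to the terminal model, which the left semi-model structure permits because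
      \<open>f_!(X)\<close> is cofibrant.\<close>
    have "cofibrant (Mod T2) (cofs T2) (Dom (Mod T2) t)" using cof[OF X] D.Hom_D(2)[OF t] by simp
    then obtain i p where ip: "i \<in> cofs T2 \<inter> weqs T2" "p \<in> fibs T2" "Cod (Mod T2) i = Dom (Mod T2) p"
      "Comp (Mod T2) p i = t"
      using assms(6) D.Hom_D(1)[OF t] unfolding semi_model_def left_semi_model_structure_def by blast
    have arr: "i \<in> Arr (Mod T2)" "p \<in> Arr (Mod T2)" using ip by (auto simp: cofs_def llp_def fibs_def rlp_def)
    have p: "p \<in> Hom (Mod T2) (Cod (Mod T2) i) (Cod (Mod T2) p)" using D.Arr_Hom[OF arr(2)] ip(3) by simp
    \<comment> \<open>The factorization axiom mentions only the middle object and the composite; the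
      outer ends of \<open>i\<close> and \<open>p\<close> are recovered from the composite being
      \<open>t\<close>.\<close>
    from D.Comp_Hom[OF D.Arr_Hom[OF arr(1)] p] have "Dom (Mod T2) i = ?Z" "Cod (Mod T2) p = I"
      unfolding ip(4) using D.Hom_D[OF t] D.Hom_D by metis+
    then have i: "i \<in> Hom (Mod T2) ?Z (Cod (Mod T2) i)" and "p \<in> Hom (Mod T2) (Cod (Mod T2) i) I"
      using D.Arr_Hom[OF arr(1)] p by metis+
    moreover from this have "fibrant (Mod T2) (fibs T2) (Cod (Mod T2) i)"
      using I ip(2) unfolding fibrant_def by blast
    \<comment> \<open>The Quillen equivalence is applied to the replacement arrow \<open>i\<close>
      itself, a weak equivalence from \<open>f_!(X)\<close> to a fibrant model.\<close>
    ultimately have "adjunct T1 T2 F X i \<in> weqs T1"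
      using that X ip(1) unfolding quillen_equivalence_def by blast
    then show "unit_arr T1 T2 F X \<in> weqs T1"
      using W1 adjunct_weqs[OF cof_Obj[OF X] i] ip(1) unfolding two_of_three_def adjunct_def by blast
  qed
  ultimately show ?thesis using adjunction by blast
qed

end
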